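(* Let $\psi\in L^2(\mathbb{R}^3,\mathbb{C}^4)$ be a Dirac wavefunction. Then $$1_{\mathbb{R}^3\setminus B_{|t|}}\psi_t\to0\quad\text{in } L^2(\mathbb{R}^3,\mathbb{C}^4)\ \text{ as } |t|\to\infty.$$ If moreover $\mathcal{F}\psi\in\mathcal{C}^\infty_c(\mathbb{R}^3,\mathbb{C}^4)$, then for every $N>0$ there is a finite constant $C_N$ such that $\|1_{\mathbb{R}^3\setminus B_{|t|}}\psi_t\|\le C_N(1+|t|)^{-N}$ for all $t\in\mathbb{R}$.
   Context: Fix a mass $m>0$ and Dirac matrices $\alpha_1,\alpha_2,\alpha_3,\beta$: Hermitian $4\times4$ complex matrices with $\alpha_j\alpha_k+\alpha_k\alpha_j=2\delta_{jk}I_4$, $\alpha_k\beta+\beta\alpha_k=0$, $\beta^2=I_4$. The free Dirac operator is the self-adjoint operator $H=\sum_{k=1}^3\alpha_k\frac{1}{\mathrm{i}}\partial_k+\beta m$ in $L^2(\mathbb{R}^3,\mathbb{C}^4)$ (equivalently $H=\mathcal{F}^{-1}h\mathcal{F}$, where $\mathcal{F}$ is the unitary Fourier transform, $(\mathcal{F}\psi)(p)=(2\pi)^{-3/2}\int \mathrm{e}^{-\mathrm{i}px}\psi(x)\,\mathrm{d}^3x$ for integrable $\psi$, and $h$ denotes multiplication by $h(p)=\sum_k\alpha_kp_k+\beta m$). A Dirac wavefunction is an element of $L^2(\mathbb{R}^3,\mathbb{C}^4)$. For a Dirac wavefunction $\psi$ and $t\in\mathbb{R}$ put $\psi_t:=\mathrm{e}^{\mathrm{i}tH}\psi$.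 $B_r:=\{x\in\mathbb{R}^3:|x|\le r\}$, $1_\Delta$ is the indicator function of $\Delta$, and $\|\cdot\|$ is the $L^2$ norm. $\mathcal{C}^\infty_c(\mathbb{R}^3,\mathbb{C}^4)$ is the space of infinitely differentiable compactly supported functions $\mathbb{R}^3\to\mathbb{C}^4$. *)

theory Defs
  imports "HOL-Analysis.Analysis"
begin

section \<open>Square-integrable spinor fields\<close>

text \<open>
  Elements of $L^2(R^3, C^4)$ are represented by functions; two functions represent the same
  element iff they agree almost everywhere.
\<close>

type_synonym spinor_field = "real ^ 3 \<Rightarrow> complex ^ 4"

definition in_L2 :: "spinor_field \<Rightarrow> bool" where
  "in_L2 f \<longleftrightarrow> f \<in> borel_measurable lborel \<and> integrable lborel (\<lambda>x. (norm (f x))\<^sup>2)"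

text \<open>
  The norm is only meaningful under \<^const>\<open>in_L2\<close>: the integral of a non-integrable function is 0.
  Hence \<open>L2_tendsto\<close> demands membership of all functions involved.
\<close>

definition L2_norm :: "spinor_field \<Rightarrow> real" where
  "L2_norm f = sqrt (LINT x|lborel. (norm (f x))\<^sup>2)"

definition L2_tendsto :: "('i \<Rightarrow> spinor_field) \<Rightarrow> spinor_field \<Rightarrow> 'i filter \<Rightarrow> bool" where
  "L2_tendsto u f F \<longleftrightarrow>
     (\<forall>i. in_L2 (u i)) \<and> in_L2 f \<and> ((\<lambda>i. L2_norm (\<lambda>x. u i x - f x)) \<longlongrightarrow> 0) F"


section \<open>Smooth functions of compact support\<close>

text \<open>
  $C^{k+1}$: Frechet differentiable everywhere, with all directional derivatives of class $C^k$.
\<close>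

primrec Ck :: "nat \<Rightarrow> ('a::euclidean_space \<Rightarrow> 'b::euclidean_space) \<Rightarrow> bool" where
  "Ck 0 f \<longleftrightarrow> continuous_on UNIV f"
| "Ck (Suc k) f \<longleftrightarrow>
     (\<exists>D. (\<forall>x. (f has_derivative (\<lambda>v. D v x)) (at x)) \<and> (\<forall>v. Ck k (D v)))"

definition Cc_infinity :: "('a::euclidean_space \<Rightarrow> 'b::euclidean_space) \<Rightarrow> bool" where
  "Cc_infinity f \<longleftrightarrow> (\<forall>k. Ck k f) \<and> compact (closure {x. f x \<noteq> 0})"


section \<open>The Fourier transform on $L^2$\<close>

definition fourier_integral :: "spinor_field \<Rightarrow> spinor_field" where
  "fourier_integral f p =
     ((2 * pi) powr (- 3 / 2)) *\<^sub>R
       (LINT x|lborel. exp (- \<i> * complex_of_real (p \<bullet> x)) *s f x)"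

text \<open>
  \<open>has_fourier f g\<close> states that \<open>g\<close> represents the Fourier transform of \<open>f\<close>, i.e. the value at
  \<open>f\<close> of the continuous extension to $L^2$ of the Fourier integral on $L^1 \cap L^2$.
\<close>

definition has_fourier :: "spinor_field \<Rightarrow> spinor_field \<Rightarrow> bool" where
  "has_fourier f g \<longleftrightarrow>
     (\<exists>u. (\<forall>n. integrable lborel (u n)) \<and>
          L2_tendsto u f sequentially \<and>
          L2_tendsto (\<lambda>n. fourier_integral (u n)) g sequentially)"


section \<open>The free Dirac operator\<close>

definition hermitian :: "complex ^ 'n ^ 'n \<Rightarrow> bool" where
  "hermitian A \<longleftrightarrow> (\<forall>i j. A $ i $ j = cnj (A $ j $ i))"

definition dirac_matrices :: "(3 \<Rightarrow> complex ^ 4 ^ 4) \<Rightarrow> complex ^ 4 ^ 4 \<Rightarrow> bool" where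
  "dirac_matrices \<alpha> \<beta> \<longleftrightarrow>
     (\<forall>k. hermitian (\<alpha> k)) \<and> hermitian \<beta> \<and>
     (\<forall>j k. \<alpha> j ** \<alpha> k + \<alpha> k ** \<alpha> j = (if j = k then mat 2 else 0)) \<and>
     (\<forall>k. \<alpha> k ** \<beta> + \<beta> ** \<alpha> k = 0) \<and>
     \<beta> ** \<beta> = mat 1"

definition dirac_symbol ::
    "real \<Rightarrow> (3 \<Rightarrow> complex ^ 4 ^ 4) \<Rightarrow> complex ^ 4 ^ 4 \<Rightarrow> real ^ 3 \<Rightarrow> complex ^ 4 ^ 4" where
  "dirac_symbol m \<alpha> \<beta> p = (\<Sum>k\<in>UNIV. (p $ k) *\<^sub>R \<alpha> k) + m *\<^sub>R \<beta>"

text \<open>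
  The self-adjoint operator $H = F^{-1} h F$, given by its graph: \<open>dirac_op m \<alpha> \<beta> f g\<close> states that
  \<open>f\<close> lies in the domain of $H$ and $H f = g$ almost everywhere.  Membership of $f$ in the domain,
  i.e. that $h F f$ is square-integrable, is implied by the square-integrability of \<open>g'\<close>.
\<close>

definition dirac_op ::
    "real \<Rightarrow> (3 \<Rightarrow> complex ^ 4 ^ 4) \<Rightarrow> complex ^ 4 ^ 4 \<Rightarrow> spinor_field \<Rightarrow> spinor_field \<Rightarrow> bool" where
  "dirac_op m \<alpha> \<beta> f g \<longleftrightarrow>
     (\<exists>f' g'. has_fourier f f' \<and> has_fourier g g' \<and>
              (AE p in lborel. g' p = dirac_symbol m \<alpha> \<beta> p *v f' p))"


section \<open>The unitary group of a self-adjoint operator\<close>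

text \<open>
  A strongly continuous one-parameter unitary group on $L^2$, all identities being understood
  almost everywhere.  Linearity and isometry make every \<open>U t\<close> respect almost-everywhere equality;
  surjectivity follows from the group law.
\<close>

definition unitary_group :: "(real \<Rightarrow> spinor_field \<Rightarrow> spinor_field) \<Rightarrow> bool" where
  "unitary_group U \<longleftrightarrow>
     (\<forall>t f. in_L2 f \<longrightarrow> in_L2 (U t f)) \<and>
     (\<forall>t a b f g. in_L2 f \<longrightarrow> in_L2 g \<longrightarrow>
        (AE x in lborel. U t (\<lambda>y. a *s f y + b *s g y) x = a *s U t f x + b *s U t g x)) \<and>
     (\<forall>t f. in_L2 f \<longrightarrow> L2_norm (U t f) = L2_norm f) \<and>
     (\<forall>f. in_L2 f \<longrightarrow> (AE x in lborel. U 0 f x = f x)) \<and>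
     (\<forall>s t f. in_L2 f \<longrightarrow> (AE x in lborel. U (s + t) f x = U s (U t f) x)) \<and>
     (\<forall>f t. in_L2 f \<longrightarrow> L2_tendsto (\<lambda>s. U s f) (U t f) (at t))"

text \<open>
  \<open>is_exp_i A U\<close> states $U_t = e^{i t A}$ for an operator \<open>A\<close> given by its graph: \<open>U\<close> is the
  strongly continuous unitary group with infinitesimal generator $i A$, where the domain of the
  generator consists of \<^emph>\<open>all\<close> \<open>f\<close> for which the difference quotient at 0 converges in $L^2$.
  By Stone's theorem such \<open>U\<close> exists and is unique (up to almost-everywhere equality) when \<open>A\<close> is
  self-adjoint.
\<close>

definition is_exp_i ::
    "(spinor_field \<Rightarrow> spinor_field \<Rightarrow> bool) \<Rightarrow> (real \<Rightarrow> spinor_field \<Rightarrow> spinor_field) \<Rightarrow> bool" where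
  "is_exp_i A U \<longleftrightarrow>
     unitary_group U \<and>
     (\<forall>f g. in_L2 f \<longrightarrow> in_L2 g \<longrightarrow>
        (A f g \<longleftrightarrow>
           L2_tendsto (\<lambda>t x. (1 / t) *\<^sub>R (U t f x - f x)) (\<lambda>x. \<i> *s g x) (at 0)))"

end

theory Submission
  imports Defs "HOL-Probability.Probability"
begin

text \<open>
  For smooth compactly supported $\phi$, the evolution of $F^{-1} \phi$ is a sum of oscillatory
  integrals with phases $p \cdot x \pm t E(p)$, $E(p) = \sqrt{m^2 + |p|^2}$.  Writing $u_a$ for the
  integral with amplitude $a$, integration by parts gives
  $x_j u_a = - t u_{p_j a / E} + i u_{\partial_j a}$, and applying this twice
  $|x|^2 u_b = t^2 u_{|p|^2 b / E^2} + (\mbox{terms with one derivative and weight } t \mbox{ or } |x|)$.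
  With $\sigma = 1 - t^2 / |x|^2$ and $b = E^2 a / (m^2 + \sigma |p|^2)$ the two leading terms combine
  to $|x|^2 u_a$.  For $|t| \le |x|$ the denominator is at least $m^2$, so each such step gains a
  factor $1/|x|$ and $u_a$ decays rapidly outside the light cone.  By Fourier inversion and Parseval,
  these integrals solve the evolution equation in $L^2$, hence agree with the unitary group; the
  first claim follows since such functions are dense and the group is isometric.
\<close>

text \<open>The recursion is integration by parts along the field x - t p/E: its product with the
  phase gradient x + t p/E is |x|^2 - t^2 |p|^2/E^2 = |x|^2 (m^2 + sigma |p|^2)/E^2, so the
  denominator sees (x, t) only through the number sigma. The obstacle is uniformity: after the
  division the amplitudes depend on (x, t), and so might the constants. Hence \<open>wosc\<close>
  keeps the powers of the inverse weight apart from an amplitude that never involves x or t, a form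
  that integration by parts preserves. Positive mass bounds the weight from below even on the cone
  |x| = |t|, where sigma = 0. Each power of decay costs one derivative, so \<open>CcK k\<close>
  counts derivatives, and truncated polynomials serve as cutoffs. The number 6 is twice the
  dimension (integrability), 12 is four times the dimension (domination of mollified functions). The
  group \<open>U\<close> is known only through its generator and \<open>has_fourier\<close> only
  through approximating sequences. The former is identified on test functions by comparison with an
  explicit evolution, the latter by pairing with a dense family.\<close>

section \<open>Calculus of functions of class $C^k$\<close>

declare Ck.simps(2) [simp del]

lemma Ck_SucI:
  assumes "\<And>x. (f has_derivative (\<lambda>v. D v x)) (at x)" "\<And>v. Ck k (D v)"
  shows "Ck (Suc k) f"
  unfolding Ck.simps(2) using assms by (intro exI[of _ D] conjI allI)

lemma Ck_SucD:
  "Ck (Suc k) f \<Longrightarrow> \<exists>D. (\<forall>x. (f has_derivative (\<lambda>v. D v x)) (at x)) \<and> (\<forall>v. Ck k (D v))"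
  by (simp add: Ck.simps(2))

lemma Ck_continuous:
  assumes "Ck k f"
  shows "continuous_on UNIV f"
proof (cases k)
  case (Suc n)
  from Ck_SucD[OF assms[unfolded Suc]] obtain D where "\<And>x. (f has_derivative (\<lambda>v. D v x)) (at x)"
    by blast
  then have "isCont f x" for x by (rule has_derivative_continuous)
  then show ?thesis by (simp add: continuous_at_imp_continuous_on)
qed (use assms in simp)

lemma Ck_Suc_imp: "Ck (Suc k) f \<Longrightarrow> Ck k f"
proof (induction k arbitrary: f)
  case 0
  then show ?case using Ck_continuous[OF 0] by simp
next
  case (Suc k)
  obtain D where D: "\<And>x. (f has_derivative (\<lambda>v. D v x)) (at x)" "\<And>v. Ck (Suc k) (D v)"
    using Ck_SucD[OF Suc.prems] by blast
  show ?case by (rule Ck_SucI[OF D(1) Suc.IH[OF D(2)]])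
qed

lemma Ck_mono: "Ck k f \<Longrightarrow> j \<le> k \<Longrightarrow> Ck j f"
proof (induction k)
  case (Suc k)
  then show ?case by (cases "j = Suc k") (auto dest: Ck_Suc_imp)
qed auto

lemma Ck_const: "Ck k (\<lambda>x. c)"
proof (induction k arbitrary: c)
  case (Suc k)
  show ?case by (rule Ck_SucI[OF has_derivative_const Suc])
qed simp

lemma Ck_bounded_linear:
  assumes "bounded_linear f"
  shows "Ck k f"
proof (cases k)
  case (Suc n)
  show ?thesis unfolding Suc
    by (rule Ck_SucI[OF bounded_linear_imp_has_derivative[OF assms] Ck_const])
qed (simp add: assms linear_continuous_on)

lemma Ck_compose_bounded_linear:
  "bounded_linear L \<Longrightarrow> Ck k f \<Longrightarrow> Ck k (\<lambda>x. L (f x))"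
proof (induction k arbitrary: f)
  case 0
  then show ?case by (auto intro: bounded_linear.continuous_on)
next
  case (Suc k)
  obtain D where D: "\<And>x. (f has_derivative (\<lambda>v. D v x)) (at x)" "\<And>v. Ck k (D v)"
    using Ck_SucD[OF Suc.prems(2)] by blast
  show ?case
  proof (rule Ck_SucI)
    show "((\<lambda>x. L (f x)) has_derivative (\<lambda>v. L (D v x))) (at x)" for x
      by (rule bounded_linear.has_derivative[OF Suc.prems(1) D(1)])
    show "Ck k (\<lambda>x. L (D v x))" for v by (rule Suc.IH[OF Suc.prems(1) D(2)])
  qed
qed

lemma Ck_add: "Ck k f \<Longrightarrow> Ck k g \<Longrightarrow> Ck k (\<lambda>x. f x + g x)"
proof (induction k arbitrary: f g)
  case 0
  then show ?case by (auto intro: continuous_intros)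
next
  case (Suc k)
  obtain D where D: "\<And>x. (f has_derivative (\<lambda>v. D v x)) (at x)" "\<And>v. Ck k (D v)"
    using Ck_SucD[OF Suc.prems(1)] by blast
  obtain D' where D': "\<And>x. (g has_derivative (\<lambda>v. D' v x)) (at x)" "\<And>v. Ck k (D' v)"
    using Ck_SucD[OF Suc.prems(2)] by blast
  show ?case
  proof (rule Ck_SucI)
    show "((\<lambda>x. f x + g x) has_derivative (\<lambda>v. D v x + D' v x)) (at x)" for x
      by (rule has_derivative_add[OF D(1) D'(1)])
    show "Ck k (\<lambda>x. D v x + D' v x)" for v by (rule Suc.IH[OF D(2) D'(2)])
  qed
qed

lemma Ck_bilinear:
  assumes "bounded_bilinear b"
  shows "Ck k f \<Longrightarrow> Ck k g \<Longrightarrow> Ck k (\<lambda>x. b (f x) (g x))"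
proof (induction k arbitrary: f g)
  case 0
  then show ?case using assms by (auto intro: bounded_bilinear.continuous_on)
next
  case (Suc k)
  obtain D where D: "\<And>x. (f has_derivative (\<lambda>v. D v x)) (at x)" "\<And>v. Ck k (D v)"
    using Ck_SucD[OF Suc.prems(1)] by blast
  obtain D' where D': "\<And>x. (g has_derivative (\<lambda>v. D' v x)) (at x)" "\<And>v. Ck k (D' v)"
    using Ck_SucD[OF Suc.prems(2)] by blast
  note fg = Ck_Suc_imp[OF Suc.prems(1)] Ck_Suc_imp[OF Suc.prems(2)]
  show ?case
  proof (rule Ck_SucI)
    show "((\<lambda>x. b (f x) (g x)) has_derivative (\<lambda>v. b (f x) (D' v x) + b (D v x) (g x))) (at x)" for x
      by (rule bounded_bilinear.FDERIV[OF assms D(1) D'(1)])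
    show "Ck k (\<lambda>x. b (f x) (D' v x) + b (D v x) (g x))" for v
      by (intro Ck_add Suc.IH fg D(2) D'(2))
  qed
qed

lemmas Ck_mult = Ck_bilinear[OF bounded_bilinear_mult]
lemmas Ck_scaleR = Ck_bilinear[OF bounded_bilinear_scaleR]
lemmas Ck_inner = Ck_bilinear[OF bounded_bilinear_inner]
lemmas Ck_of_real = Ck_compose_bounded_linear[OF bounded_linear_of_real]

lemma Ck_diff: "Ck k f \<Longrightarrow> Ck k g \<Longrightarrow> Ck k (\<lambda>x. f x - g x)"
  using Ck_add[of k f "\<lambda>x. - g x"]
    Ck_compose_bounded_linear[OF bounded_linear_minus[OF bounded_linear_ident], of k g]
  by simp

lemma Ck_id: "Ck k (\<lambda>x. x)"
  by (rule Ck_bounded_linear) (rule bounded_linear_ident)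

text \<open>The derivative -(1/g) Dg (1/g) contains the inverse only with the smoothness that the
  induction hypothesis already gives. \<open>Ck_sqrt\<close> and \<open>Ck_exp\<close> run on the
  same self-reference.\<close>

lemma Ck_inverse:
  fixes g :: "'a::euclidean_space \<Rightarrow> real"
  assumes "\<And>x. g x \<noteq> 0"
  shows "Ck k g \<Longrightarrow> Ck k (\<lambda>x. inverse (g x))"
proof (induction k)
  case 0
  then show ?case using assms by (auto intro: continuous_intros)
next
  case (Suc k)
  obtain D where D: "\<And>x. (g has_derivative (\<lambda>v. D v x)) (at x)" "\<And>v. Ck k (D v)"
    using Ck_SucD[OF Suc.prems] by blast
  note g = Suc.IH[OF Ck_Suc_imp[OF Suc.prems]]
  show ?case
  proof (rule Ck_SucI[where D = "\<lambda>v x. (-1) * (inverse (g x) * D v x * inverse (g x))"])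
    show "((\<lambda>x. inverse (g x)) has_derivative (\<lambda>v. (-1) * (inverse (g x) * D v x * inverse (g x)))) (at x)" for x
      using Deriv.has_derivative_inverse[OF assms D(1), of x] by simp
    show "Ck k (\<lambda>x. (-1) * (inverse (g x) * D v x * inverse (g x)))" for v
      by (intro Ck_mult Ck_const g D(2))
  qed
qed

lemma Ck_sqrt:
  fixes g :: "'a::euclidean_space \<Rightarrow> real"
  assumes "\<And>x. g x > 0"
  shows "Ck k g \<Longrightarrow> Ck k (\<lambda>x. sqrt (g x))"
proof (induction k)
  case 0
  then show ?case using assms by (auto intro: continuous_intros)
next
  case (Suc k)
  obtain D where D: "\<And>x. (g has_derivative (\<lambda>v. D v x)) (at x)" "\<And>v. Ck k (D v)"
    using Ck_SucD[OF Suc.prems] by blast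
  have nz: "sqrt (g x) \<noteq> 0" for x using assms[of x] by simp
  note g = Ck_inverse[OF nz Suc.IH[OF Ck_Suc_imp[OF Suc.prems]]]
  show ?case
  proof (rule Ck_SucI[where D = "\<lambda>v x. D v x * ((1/2) * inverse (sqrt (g x)))"])
    show "((\<lambda>x. sqrt (g x)) has_derivative (\<lambda>v. D v x * ((1/2) * inverse (sqrt (g x))))) (at x)" for x
      using has_derivative_real_sqrt[OF assms D(1)] by (simp add: field_simps)
    show "Ck k (\<lambda>x. D v x * ((1/2) * inverse (sqrt (g x))))" for v
      by (intro Ck_mult Ck_const g D(2))
  qed
qed

lemma Ck_exp:
  fixes g :: "'a::euclidean_space \<Rightarrow> complex"
  shows "Ck k g \<Longrightarrow> Ck k (\<lambda>x. exp (g x))"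
proof (induction k)
  case 0
  then show ?case by (auto intro: continuous_intros)
next
  case (Suc k)
  obtain D where D: "\<And>x. (g has_derivative (\<lambda>v. D v x)) (at x)" "\<And>v. Ck k (D v)"
    using Ck_SucD[OF Suc.prems] by blast
  note g = Suc.IH[OF Ck_Suc_imp[OF Suc.prems]]
  show ?case
  proof (rule Ck_SucI)
    show "((\<lambda>x. exp (g x)) has_derivative (\<lambda>v. exp (g x) * D v x)) (at x)" for x
      by (rule has_derivative_compose[OF D(1) DERIV_exp[unfolded has_field_derivative_def]])
    show "Ck k (\<lambda>x. exp (g x) * D v x)" for v by (intro Ck_mult g D(2))
  qed
qed

text \<open>At t = 0 the difference quotient is again a power of \<open>max 0 h\<close> with
  positive exponent, hence tends to 0; this is why the exponent starts at 2.\<close>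

lemma power_max_has_field_derivative:
  "((\<lambda>t::real. max 0 t ^ (Suc (Suc n))) has_field_derivative (real (Suc (Suc n)) * max 0 t ^ Suc n)) (at t)"
proof -
  consider "t > 0" | "t < 0" | "t = 0" by linarith
  then show ?thesis
  proof cases
    case 1
    have "((\<lambda>t::real. t ^ (Suc (Suc n))) has_field_derivative (real (Suc (Suc n)) * max 0 t ^ Suc n)) (at t)"
      using DERIV_pow[of "Suc (Suc n)" t UNIV] 1 by (simp add: max_def)
    then show ?thesis
      by (rule has_field_derivative_transform_within_open[where S = "{0<..}"]) (use 1 in \<open>auto simp: max_def\<close>)
  next
    case 2
    have "((\<lambda>t::real. 0) has_field_derivative (real (Suc (Suc n)) * max 0 t ^ Suc n)) (at t)"
      using 2 by (simp add: max_def)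
    then show ?thesis
      by (rule has_field_derivative_transform_within_open[where S = "{..<0}"]) (use 2 in \<open>auto simp: max_def\<close>)
  next
    case 3
    have "(\<lambda>h::real. max 0 h ^ Suc n) \<midarrow>0\<rightarrow> max 0 0 ^ Suc n"
      by (intro tendsto_power tendsto_max tendsto_const tendsto_ident_at)
    moreover have "max 0 h ^ Suc n = (max 0 (t + h) ^ Suc (Suc n) - max 0 t ^ Suc (Suc n)) / h"
      if "h \<noteq> 0" for h :: real
      using that 3 by (simp add: max_def)
    ultimately have "(\<lambda>h. (max 0 (t + h) ^ Suc (Suc n) - max 0 t ^ Suc (Suc n)) / h) \<midarrow>0\<rightarrow> max 0 0 ^ Suc n"
      by (subst (asm) LIM_cong[OF refl _ refl]) (assumption+)
    then show ?thesis
      unfolding DERIV_def using 3 by simp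
  qed
qed

text \<open>Source of the cutoffs \<open>bump\<close>: with q = 1 - p . p the function has compact
  support and a prescribed finite smoothness. Differentiation lowers the exponent by one, just as it
  lowers the class.\<close>

lemma Ck_power_max:
  fixes q :: "'a::euclidean_space \<Rightarrow> real"
  shows "Ck k q \<Longrightarrow> Ck k (\<lambda>x. max 0 (q x) ^ Suc k)"
proof (induction k)
  case 0
  then show ?case by (auto intro!: continuous_intros)
next
  case (Suc k)
  obtain D where D: "\<And>x. (q has_derivative (\<lambda>v. D v x)) (at x)" "\<And>v. Ck k (D v)"
    using Ck_SucD[OF Suc.prems] by blast
  show ?case
  proof (rule Ck_SucI[where D = "\<lambda>v x. (real (Suc (Suc k)) * max 0 (q x) ^ Suc k) * D v x"])
    show "((\<lambda>x. max 0 (q x) ^ Suc (Suc k)) has_derivative (\<lambda>v. real (Suc (Suc k)) * max 0 (q x) ^ Suc k * D v x)) (at x)" for x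
      by (rule has_derivative_compose[OF D(1) power_max_has_field_derivative[unfolded has_field_derivative_def]])
    show "Ck k (\<lambda>x. (real (Suc (Suc k)) * max 0 (q x) ^ Suc k) * D v x)" for v
      by (intro Ck_mult Ck_const D(2) Suc.IH[OF Ck_Suc_imp[OF Suc.prems]])
  qed
qed

lemma Ck_vec_nth: "Ck k f \<Longrightarrow> Ck k (\<lambda>x. f x $ i)"
  by (rule Ck_compose_bounded_linear[OF bounded_linear_vec_nth])

lemma bounded_linear_axis:
  "bounded_linear (axis i :: 'b::euclidean_space \<Rightarrow> 'b ^ 'n)"
  by (intro linear_conv_bounded_linear[THEN iffD1] linearI) (auto simp: vec_eq_iff axis_def)

section \<open>Compactly supported functions\<close>

text \<open>Finite smoothness makes the cost in derivatives explicit and admits cutoffs that are not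
  smooth. Bounding the support by a radius, instead of asking for a compact closure, passes directly
  to sums, products and derivatives.\<close>

definition CcK :: "nat \<Rightarrow> ('a::euclidean_space \<Rightarrow> 'b::euclidean_space) \<Rightarrow> bool" where
  "CcK k f \<longleftrightarrow> Ck k f \<and> (\<exists>R. \<forall>x. R < norm x \<longrightarrow> f x = 0)"

lemma CcK_mono: "CcK k f \<Longrightarrow> j \<le> k \<Longrightarrow> CcK j f"
  by (auto simp: CcK_def intro: Ck_mono)

lemma CcK_mult:
  fixes g :: "'a::euclidean_space \<Rightarrow> complex"
  shows "Ck k f \<Longrightarrow> CcK k g \<Longrightarrow> CcK k (\<lambda>x. f x * g x)"
  unfolding CcK_def by (intro conjI Ck_mult) auto

lemma CcK_add:
  assumes "CcK k f" "CcK k g"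
  shows "CcK k (\<lambda>x. f x + g x)"
proof -
  from assms obtain R R' where "\<forall>x. R < norm x \<longrightarrow> f x = 0" "\<forall>x. R' < norm x \<longrightarrow> g x = 0"
    unfolding CcK_def by auto
  then have "\<forall>x. max R R' < norm x \<longrightarrow> f x + g x = 0" by auto
  then have "\<exists>R. \<forall>x. R < norm x \<longrightarrow> f x + g x = 0" by (rule exI[of _ "max R R'"])
  with assms show ?thesis unfolding CcK_def by (simp add: Ck_add)
qed

lemma CcK_compose_bounded_linear:
  assumes "bounded_linear L" "CcK k f"
  shows "CcK k (\<lambda>x. L (f x))"
  unfolding CcK_def
proof
  show "Ck k (\<lambda>x. L (f x))"
    using assms(2) by (simp add: CcK_def Ck_compose_bounded_linear[OF assms(1)])
  show "\<exists>R. \<forall>x. R < norm x \<longrightarrow> L (f x) = 0"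
    using assms(2) linear_simps(3)[OF assms(1)] unfolding CcK_def by metis
qed

lemma CcK_cmult: "CcK k (f::_\<Rightarrow>complex) \<Longrightarrow> CcK k (\<lambda>x. c * f x)"
  by (rule CcK_compose_bounded_linear[OF bounded_linear_mult_right])

lemma CcK_zero: "CcK k (\<lambda>x. 0)"
  by (simp add: CcK_def Ck_const)

lemma CcK_sum: "(\<And>i. i \<in> I \<Longrightarrow> CcK k (f i)) \<Longrightarrow> CcK k (\<lambda>x. \<Sum>i\<in>I. f i x)"
  by (induction I rule: infinite_finite_induct) (auto intro: CcK_zero CcK_add)

lemma CcK_vec_lambda:
  fixes f :: "'n::finite \<Rightarrow> 'a::euclidean_space \<Rightarrow> 'b::euclidean_space"
  assumes "\<And>i. CcK k (f i)"
  shows "CcK k (\<lambda>x. \<chi> i. f i x)"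
proof -
  have eq: "(\<chi> i. f i x) = (\<Sum>i\<in>UNIV. axis i (f i x))" for x
    by (simp add: vec_eq_iff axis_def sum.delta)
  show ?thesis unfolding eq
    by (rule CcK_sum, rule CcK_compose_bounded_linear[OF bounded_linear_axis], rule assms)
qed

lemma CcK_SucD:
  assumes "CcK (Suc k) f"
  shows "\<exists>D. (\<forall>x. (f has_derivative (\<lambda>v. D v x)) (at x)) \<and> (\<forall>v. CcK k (D v))"
proof -
  from assms obtain R where R: "\<And>x. R < norm x \<Longrightarrow> f x = 0" unfolding CcK_def by auto
  from assms have "Ck (Suc k) f" by (simp add: CcK_def)
  from Ck_SucD[OF this] obtain D where D: "\<And>x. (f has_derivative (\<lambda>v. D v x)) (at x)" "\<And>v. Ck k (D v)"
    by blast
  have "D v x = 0" if "R < norm x" for v x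
  proof -
    \<comment> \<open>On this open set f agrees with 0, so uniqueness of the derivative forces D to
      vanish there.\<close>
    have "open {x::'a. R < norm x}" by (intro open_Collect_less continuous_intros)
    from has_derivative_transform_within_open[OF D(1) this, of x "\<lambda>_. 0"] R that
    have "((\<lambda>_. 0) has_derivative (\<lambda>v. D v x)) (at x)" by simp
    from has_derivative_unique[OF this has_derivative_const] show ?thesis by metis
  qed
  with D show ?thesis unfolding CcK_def by blast
qed

lemma CcK_continuous: "CcK k f \<Longrightarrow> continuous_on UNIV f"
  by (auto simp: CcK_def intro: Ck_continuous)

lemma CcK_measurable: "CcK k f \<Longrightarrow> f \<in> borel_measurable borel"
  by (rule borel_measurable_continuous_onI[OF CcK_continuous])

lemma CcK_integrable: 
  assumes "CcK k f"
  shows "integrable lborel f"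
proof -
  from assms obtain R where R: "\<And>x. R < norm x \<Longrightarrow> f x = 0" unfolding CcK_def by auto
  have "integrable lborel (\<lambda>x. indicator (cball 0 R) x *\<^sub>R f x)"
    by (rule borel_integrable_compact) (auto intro: continuous_on_subset[OF CcK_continuous[OF assms]])
  also have "(\<lambda>x. indicator (cball 0 R) x *\<^sub>R f x) = f"
    using R by (force simp: indicator_def)
  finally show ?thesis .
qed

lemma CcK_bounded:
  assumes "CcK k f"
  shows "\<exists>B>0. \<forall>x. norm (f x) \<le> B"
proof -
  from assms obtain R where R: "\<And>x. R < norm x \<Longrightarrow> f x = 0" unfolding CcK_def by auto
  have "compact (f ` cball 0 R)"
    by (rule compact_continuous_image) (auto intro: continuous_on_subset[OF CcK_continuous[OF assms]])
  then obtain B where B: "B > 0" "\<And>y. y \<in> f ` cball 0 R \<Longrightarrow> norm y \<le> B"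
    using compact_imp_bounded bounded_pos by metis
  have "norm (f x) \<le> B" for x using B(1) B(2)[of "f x"] R[of x] by (cases "norm x \<le> R") auto
  with B(1) show ?thesis by blast
qed

section \<open>Translation invariance and integrals of derivatives\<close>

lemma lborel_integral_translate:
  fixes f :: "'a::euclidean_space \<Rightarrow> 'b::{banach, second_countable_topology}"
  assumes [measurable]: "f \<in> borel_measurable borel"
  shows "(LINT x|lborel. f (c + x)) = (LINT x|lborel. f x)"
    and "integrable lborel (\<lambda>x. f (c + x)) \<longleftrightarrow> integrable lborel f"
proof -
  have "(LINT x|lborel. f (c + x)) = (LINT x|distr lborel borel ((+) c). f x)"
    by (subst integral_distr) auto
  then show "(LINT x|lborel. f (c + x)) = (LINT x|lborel. f x)" by (simp add: lborel_distr_plus)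
  have "integrable lborel (\<lambda>x. f (c + x)) \<longleftrightarrow> integrable (distr lborel borel ((+) c)) f"
    by (subst integrable_distr_eq) auto
  then show "integrable lborel (\<lambda>x. f (c + x)) \<longleftrightarrow> integrable lborel f" by (simp add: lborel_distr_plus)
qed

text \<open>The divergence theorem without boundary: integrals of difference quotients vanish by
  translation invariance, and dominated convergence passes to the derivative.\<close>

lemma integral_derivative_eq_0:
  fixes f :: "'a::euclidean_space \<Rightarrow> 'b::euclidean_space"
  assumes D: "\<And>x. (f has_derivative (\<lambda>v. D v x)) (at x)" and f: "CcK 0 f" and Dv: "CcK 0 (D v)"
  shows "(LINT x|lborel. D v x) = 0"
proof -
  define q where "q n x = real (Suc n) *\<^sub>R (f ((1 / real (Suc n)) *\<^sub>R v + x) - f x)" for n x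
  note [measurable] = CcK_measurable[OF f] CcK_measurable[OF Dv]
  obtain B where B: "B > 0" "\<And>x. norm (D v x) \<le> B" using CcK_bounded[OF Dv] by blast
  from f obtain R where R: "\<And>x. R < norm x \<Longrightarrow> f x = 0" unfolding CcK_def by auto
  have int0: "(LINT x|lborel. q n x) = 0" for n
  proof -
    have "integrable lborel f" using CcK_integrable[OF f] .
    then show ?thesis unfolding q_def
      by (simp add: lborel_integral_translate Bochner_Integration.integral_diff)
  qed
  have line: "((\<lambda>s. f (s *\<^sub>R v + x)) has_vector_derivative D v (s *\<^sub>R v + x)) (at s)" for s x
  proof -
    have "((\<lambda>s. s *\<^sub>R v + x) has_derivative (\<lambda>h. h *\<^sub>R v)) (at s)"
      by (auto intro!: derivative_eq_intros)
    from has_derivative_compose[OF this D]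
    have *: "((\<lambda>s. f (s *\<^sub>R v + x)) has_derivative (\<lambda>h. D (h *\<^sub>R v) (s *\<^sub>R v + x))) (at s)" .
    have "D (h *\<^sub>R v) y = h *\<^sub>R D v y" for h y
      using has_derivative_bounded_linear[OF D[of y]] linear_simps(5) by blast
    with * show ?thesis by (simp add: has_vector_derivative_def)
  qed
  \<comment> \<open>Within radius R + |v| the mean value estimate along the line bounds the quotient
    by B. Beyond it, x and the shifted point both lie outside the support, since the shift has
    length at most |v|.\<close>
  have bound: "norm (q n x) \<le> B * indicator (cball 0 (R + norm v)) x" for n x
  proof (cases "norm x \<le> R + norm v")
    case True
    have "norm (f ((1 / real (Suc n)) *\<^sub>R v + x) - f (0 *\<^sub>R v + x)) \<le> B * norm (1 / real (Suc n) - 0)"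
    proof (rule differentiable_bound[of UNIV])
      show "((\<lambda>s. f (s *\<^sub>R v + x)) has_derivative (\<lambda>h. h *\<^sub>R D v (s *\<^sub>R v + x))) (at s within UNIV)" for s
        using line[of x s] by (simp add: has_vector_derivative_def)
      show "onorm (\<lambda>h. h *\<^sub>R D v (s *\<^sub>R v + x)) \<le> B" for s
        using onorm_scaleR_left[OF bounded_linear_ident, of "D v (s *\<^sub>R v + x)"] B by (simp add: onorm_id)
    qed auto
    then have "real (Suc n) * norm (f ((1 / real (Suc n)) *\<^sub>R v + x) - f x) \<le> B"
      by (simp add: field_simps del: of_nat_Suc)
    then show ?thesis using True unfolding q_def by (simp del: of_nat_Suc)
  next
    case False
    have "norm v / real (Suc n) \<le> norm v" by (simp add: field_simps)
    moreover have "norm x \<le> norm ((1 / real (Suc n)) *\<^sub>R v + x) + norm ((1 / real (Suc n)) *\<^sub>R v)"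
      using norm_triangle_ineq4[of "(1 / real (Suc n)) *\<^sub>R v + x" "(1 / real (Suc n)) *\<^sub>R v"]
      by (simp del: of_nat_Suc)
    moreover have "norm ((1 / real (Suc n)) *\<^sub>R v) = norm v / real (Suc n)"
      by (simp del: of_nat_Suc)
    ultimately have "R < norm ((1 / real (Suc n)) *\<^sub>R v + x)" "R < norm x"
      using False norm_ge_zero[of v] by linarith+
    then show ?thesis unfolding q_def using R B(1) by (simp add: indicator_def)
  qed
  have "(\<lambda>n. LINT x|lborel. q n x) \<longlonglongrightarrow> (LINT x|lborel. D v x)"
  proof (rule integral_dominated_convergence)
    show "integrable lborel (\<lambda>x. B * indicator (cball 0 (R + norm v)) x)"
      by (intro integrable_mult_right integrable_real_indicator) (auto intro: emeasure_bounded_finite[OF bounded_cball, simplified])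
    show "AE x in lborel. norm (q n x) \<le> B * indicator (cball 0 (R + norm v)) x" for n
      using bound by auto
    show "AE x in lborel. (\<lambda>n. q n x) \<longlonglongrightarrow> D v x"
    proof (rule AE_I2)
      fix x
      have "((\<lambda>h. norm ((f (h *\<^sub>R v + x) - f x - h *\<^sub>R D v x) /\<^sub>R \<bar>h\<bar>)) \<longlongrightarrow> 0) (at 0)"
        using line[of x 0] unfolding has_vector_derivative_def has_derivative_at
        by (simp add: tendsto_norm_zero divide_inverse_commute)
      moreover have "norm ((f (h *\<^sub>R v + x) - f x - h *\<^sub>R D v x) /\<^sub>R \<bar>h\<bar>)
          = norm ((1/h) *\<^sub>R (f (h *\<^sub>R v + x) - f x) - D v x)" if "h \<noteq> 0" for h
      proof -
        have "(1/h) *\<^sub>R (f (h *\<^sub>R v + x) - f x) - D v x = (1/h) *\<^sub>R (f (h *\<^sub>R v + x) - f x - h *\<^sub>R D v x)"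
          using that by (simp add: scaleR_diff_right)
        then show ?thesis by (simp add: divide_inverse)
      qed
      ultimately have "((\<lambda>h. norm ((1/h) *\<^sub>R (f (h *\<^sub>R v + x) - f x) - D v x)) \<longlongrightarrow> 0) (at 0)"
        by (simp cong: LIM_cong)
      then have "((\<lambda>h. (1/h) *\<^sub>R (f (h *\<^sub>R v + x) - f x)) \<longlongrightarrow> D v x) (at 0)"
        by (rule LIM_zero_cancel[OF tendsto_norm_zero_cancel])
      moreover have "filterlim (\<lambda>n. 1 / real (Suc n)) (at 0) sequentially"
        by (simp add: filterlim_at lim_1_over_n LIMSEQ_inverse_real_of_nat inverse_eq_divide[symmetric] del: of_nat_Suc)
      ultimately have "(\<lambda>n. (1/(1 / real (Suc n))) *\<^sub>R (f ((1 / real (Suc n)) *\<^sub>R v + x) - f x)) \<longlonglongrightarrow> D v x"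
        by (rule filterlim_compose)
      then show "(\<lambda>n. q n x) \<longlonglongrightarrow> D v x" by (simp add: q_def del: of_nat_Suc)
    qed
  qed (simp_all add: q_def)
  with int0 have "(\<lambda>n. 0) \<longlonglongrightarrow> (LINT x|lborel. D v x)" by simp
  then show ?thesis by (rule LIMSEQ_unique[OF _ tendsto_const])
qed

section \<open>Oscillatory integrals with the relativistic phase\<close>

definition energy :: "real \<Rightarrow> 'a::euclidean_space \<Rightarrow> real" where
  "energy m p = sqrt (m\<^sup>2 + p \<bullet> p)"

text \<open>Both energy branches are covered: the phase p . x - t E is the value at -t, and the
  decay estimates restrict only the absolute value of t.\<close>

definition osc :: "real \<Rightarrow> real \<Rightarrow> ('a::euclidean_space \<Rightarrow> complex) \<Rightarrow> 'a \<Rightarrow> complex" where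
  "osc m t g x = (LINT p|lborel. exp (\<i> * complex_of_real (p \<bullet> x + t * energy m p)) * g p)"

lemma energy_pos: "m > 0 \<Longrightarrow> energy m p > 0"
  by (simp add: energy_def add_pos_nonneg)

lemma energy_sq: "energy m p * energy m p = m\<^sup>2 + p \<bullet> p"
  by (simp add: energy_def)

lemma Ck_inner_self: "Ck k (\<lambda>p. p \<bullet> p)"
  by (intro Ck_inner Ck_id)

lemma Ck_inner_const: "Ck k (\<lambda>p. p \<bullet> v)"
  by (rule Ck_bounded_linear) (rule bounded_linear_inner_left)

lemma Ck_energy: "m > 0 \<Longrightarrow> Ck k (energy m)"
  unfolding energy_def by (intro Ck_sqrt Ck_add Ck_const Ck_inner_self) (simp add: add_pos_nonneg)

lemma Ck_inverse_energy: "m > 0 \<Longrightarrow> Ck k (\<lambda>p. inverse (energy m p))"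
  by (rule Ck_inverse[OF _ Ck_energy]) (metis energy_pos less_irrefl)

lemma energy_has_derivative:
  assumes "m > 0"
  shows "(energy m has_derivative (\<lambda>v. (p \<bullet> v) / energy m p)) (at p)"
proof -
  have "((\<lambda>p. sqrt (m\<^sup>2 + p \<bullet> p)) has_derivative (\<lambda>v. (p \<bullet> v) / energy m p)) (at p)"
    using energy_pos[OF assms, of p] assms
    by (auto intro!: derivative_eq_intros simp: energy_def add_pos_nonneg inner_commute field_simps)
  then show ?thesis by (simp add: energy_def[abs_def])
qed

lemma Ck_phase: "m > 0 \<Longrightarrow> Ck k (\<lambda>p. exp (\<i> * complex_of_real (p \<bullet> x + t * energy m p)))"
  by (intro Ck_exp Ck_mult Ck_const Ck_of_real Ck_add Ck_inner_const Ck_energy)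

lemma CcK_phase:
  "m > 0 \<Longrightarrow> CcK k g \<Longrightarrow> CcK k (\<lambda>p. exp (\<i> * complex_of_real (p \<bullet> x + t * energy m p)) * g p)"
  by (intro CcK_mult Ck_phase)

lemma osc_integrable:
  "m > 0 \<Longrightarrow> CcK k g \<Longrightarrow> integrable lborel (\<lambda>p. exp (\<i> * complex_of_real (p \<bullet> x + t * energy m p)) * g p)"
  by (intro CcK_integrable[OF CcK_phase])

lemma osc_cmult: "osc m t (\<lambda>p. c * g p) x = c * osc m t g x"
  by (simp add: osc_def mult.left_commute[of _ c])

lemma osc_add:
  assumes "m > 0" "CcK k f" "CcK k g"
  shows "osc m t (\<lambda>p. f p + g p) x = osc m t f x + osc m t g x"
  using osc_integrable[OF assms(1,2)] osc_integrable[OF assms(1,3)]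
  by (simp add: osc_def distrib_left)

lemma osc_sum:
  assumes "m > 0" "finite I" "\<And>i. i \<in> I \<Longrightarrow> CcK k (f i)"
  shows "osc m t (\<lambda>p. \<Sum>i\<in>I. f i p) x = (\<Sum>i\<in>I. osc m t (f i) x)"
  using assms(2,3)
proof (induction I rule: finite_induct)
  case empty
  then show ?case by (simp add: osc_def)
next
  case (insert i I)
  then show ?case using osc_add[OF assms(1), of k "f i" "\<lambda>p. \<Sum>i\<in>I. f i p"] CcK_sum[of I k f] by simp
qed

lemma osc_bound: "norm (osc m t g x) \<le> (LINT p|lborel. norm (g p))"
  unfolding osc_def by (rule order_trans[OF integral_norm_bound]) (simp add: norm_mult)

lemma osc_by_parts:
  fixes g :: "'a::euclidean_space \<Rightarrow> complex"
  assumes m: "m > 0" and D: "\<And>p. (g has_derivative (\<lambda>v. D v p)) (at p)"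
    and g: "CcK 0 g" and Dv: "CcK 0 (D v)"
  shows "complex_of_real (x \<bullet> v) * osc m t g x
    + complex_of_real t * osc m t (\<lambda>p. complex_of_real (p \<bullet> v * inverse (energy m p)) * g p) x
    = \<i> * osc m t (D v) x"
proof -
  define e where "e p = exp (\<i> * complex_of_real (p \<bullet> x + t * energy m p))" for p
  define g' where "g' p = complex_of_real (p \<bullet> v * inverse (energy m p)) * g p" for p
  have g': "CcK 0 g'" unfolding g'_def
    by (intro CcK_mult g Ck_of_real Ck_mult Ck_inner_const Ck_inverse_energy m)
  have F: "((\<lambda>p. e p * g p) has_derivative
     (\<lambda>v. e p * D v p + (e p * (\<i> * complex_of_real (v \<bullet> x + t * (p \<bullet> v / energy m p)))) * g p)) (at p)" for p
  proof (rule has_derivative_mult[OF _ D])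
    have "((\<lambda>p. \<i> * complex_of_real (p \<bullet> x + t * energy m p)) has_derivative
        (\<lambda>v. \<i> * complex_of_real (v \<bullet> x + t * (p \<bullet> v / energy m p)))) (at p)"
      by (intro has_derivative_mult_right has_derivative_of_real has_derivative_add
          has_derivative_inner_left has_derivative_ident energy_has_derivative m)
    from has_derivative_compose[OF this DERIV_exp[unfolded has_field_derivative_def]]
    show "(e has_derivative (\<lambda>v. e p * (\<i> * complex_of_real (v \<bullet> x + t * (p \<bullet> v / energy m p))))) (at p)"
      by (simp only: e_def[abs_def])
  qed
  let ?D = "\<lambda>p. e p * D v p + (e p * (\<i> * complex_of_real (v \<bullet> x + t * (p \<bullet> v / energy m p)))) * g p"
  have eq: "?D p = e p * D v p + (\<i> * complex_of_real (x \<bullet> v) * (e p * g p) + \<i> * complex_of_real t * (e p * g' p))" for p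
    by (simp add: g'_def algebra_simps divide_inverse inner_commute)
  note C = CcK_phase[OF m g, of x t, folded e_def] CcK_phase[OF m g', of x t, folded e_def] CcK_phase[OF m Dv, of x t, folded e_def]
  note I = C[THEN CcK_integrable]
  have "(LINT p|lborel. ?D p) = 0"
  proof (rule integral_derivative_eq_0[OF F C(1)])
    show "CcK 0 ?D" unfolding eq by (intro CcK_add CcK_cmult C)
  qed
  also have "(LINT p|lborel. ?D p) = osc m t (D v) x
     + (\<i> * complex_of_real (x \<bullet> v) * osc m t g x + \<i> * complex_of_real t * osc m t g' x)"
    unfolding eq osc_def e_def[symmetric] using I by simp
  finally have "\<i> * (osc m t (D v) x + (\<i> * complex_of_real (x \<bullet> v) * osc m t g x + \<i> * complex_of_real t * osc m t g' x)) = 0"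
    by simp
  then show ?thesis unfolding g'_def[symmetric] by (simp add: algebra_simps)
qed

text \<open>
  With \<open>\<sigma> = 1 - t\<^sup>2/|x|\<^sup>2 \<in> [0, 1]\<close>, the weight \<open>m\<^sup>2 + \<sigma> |p|\<^sup>2 = E\<^sup>2 - (t/|x|)\<^sup>2 |p|\<^sup>2\<close> is bounded
  below by \<open>m\<^sup>2\<close>: this is the quantitative form of the phase being non-stationary for \<open>|t| \<le> |x|\<close>.
\<close>

definition weight :: "real \<Rightarrow> real \<Rightarrow> 'a::euclidean_space \<Rightarrow> real" where
  "weight m \<sigma> p = m\<^sup>2 + \<sigma> * (p \<bullet> p)"

text \<open>The parameter \<open>\<sigma>\<close> will depend on t and x. Confining it to powers of
  the inverse weight leaves an amplitude \<open>a\<close> independent of t and x, so that its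
  constants are uniform.\<close>

definition wosc :: "real \<Rightarrow> real \<Rightarrow> nat \<Rightarrow> ('a::euclidean_space \<Rightarrow> complex) \<Rightarrow> real \<Rightarrow> 'a \<Rightarrow> complex" where
  "wosc m \<sigma> n a t x = osc m t (\<lambda>p. complex_of_real (inverse (weight m \<sigma> p) ^ n) * a p) x"

context
  fixes m \<sigma> :: real
  assumes m: "m > 0" and \<sigma>: "0 \<le> \<sigma>"
begin

lemma weight_ge: "weight m \<sigma> p \<ge> m\<^sup>2"
  using \<sigma> by (simp add: weight_def)

lemma weight_pos: "weight m \<sigma> p > 0"
  using weight_ge[of p] m by (meson less_le_trans zero_less_power)

lemma Ck_inverse_weight: "Ck k (\<lambda>p :: 'a::euclidean_space. inverse (weight m \<sigma> p))"
proof (rule Ck_inverse)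
  show "weight m \<sigma> x \<noteq> 0" for x :: 'a using weight_pos[of x] by simp
  show "Ck k (weight m \<sigma> :: 'a \<Rightarrow> real)"
    unfolding weight_def[abs_def] by (intro Ck_add Ck_const Ck_mult Ck_inner_self)
qed

lemma Ck_inverse_weight_power: "Ck k (\<lambda>p. inverse (weight m \<sigma> p) ^ n)"
  by (induction n) (auto intro: Ck_const Ck_mult Ck_inverse_weight)

lemma CcK_weight: "CcK k a \<Longrightarrow> CcK k (\<lambda>p. complex_of_real (inverse (weight m \<sigma> p) ^ n) * a p)"
  by (intro CcK_mult Ck_of_real Ck_inverse_weight_power)

text \<open>Differentiation yields the next power times a linear function of p and a scalar, so no
  new kind of denominator arises.\<close>

lemma inverse_weight_power_has_derivative:
  "((\<lambda>p. inverse (weight m \<sigma> p) ^ n) has_derivative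
      (\<lambda>v. - (2 * real n * \<sigma>) * (p \<bullet> v) * inverse (weight m \<sigma> p) ^ Suc n)) (at p)"
proof -
  have "((\<lambda>p. inverse (weight m \<sigma> p) ^ n) has_derivative
      (\<lambda>v. real n * - (inverse (weight m \<sigma> p) * (\<sigma> * (2 * (p \<bullet> v))) * inverse (weight m \<sigma> p)) * inverse (weight m \<sigma> p) ^ (n - 1))) (at p)"
    using weight_pos[of p] unfolding weight_def
    by (auto intro!: derivative_eq_intros simp: inner_commute)
  moreover have "real n * - (inverse (weight m \<sigma> p) * (\<sigma> * (2 * (p \<bullet> v))) * inverse (weight m \<sigma> p)) * inverse (weight m \<sigma> p) ^ (n - 1)
     = - (2 * real n * \<sigma>) * (p \<bullet> v) * inverse (weight m \<sigma> p) ^ Suc n" for v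
    \<comment> \<open>For n = 0 the exponent n - 1 is truncated to 0, but the factor n makes both
      sides vanish.\<close>
    by (cases n) auto
  ultimately show ?thesis by (simp only:)
qed

lemma wosc_cmult: "wosc m \<sigma> n (\<lambda>p. c * a p) t x = c * wosc m \<sigma> n a t x"
  by (simp add: wosc_def osc_cmult mult.left_commute[of _ c])

lemma wosc_add:
  assumes "CcK k a" "CcK k b"
  shows "wosc m \<sigma> n (\<lambda>p. a p + b p) t x = wosc m \<sigma> n a t x + wosc m \<sigma> n b t x"
  using osc_add[OF m CcK_weight[OF assms(1)] CcK_weight[OF assms(2)]]
  by (simp add: wosc_def distrib_left)

lemma wosc_sum:
  assumes "finite I" "\<And>i. i \<in> I \<Longrightarrow> CcK k (a i)"
  shows "wosc m \<sigma> n (\<lambda>p. \<Sum>i\<in>I. a i p) t x = (\<Sum>i\<in>I. wosc m \<sigma> n (a i) t x)"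
  using osc_sum[OF m assms(1) CcK_weight[OF assms(2)]]
  by (simp add: wosc_def sum_distrib_left)

text \<open>The derivative falls either on the amplitude, keeping the exponent, or on the weight,
  raising it by one. In both cases the new amplitude is free of x and t; \<open>\<sigma>\<close>
  comes out as a scalar.\<close>

lemma wosc_by_parts:
  fixes c :: "'a::euclidean_space \<Rightarrow> complex"
  assumes D: "\<And>p. (c has_derivative (\<lambda>v. D v p)) (at p)"
    and c: "CcK 0 c" and Dv: "CcK 0 (D v)"
  shows "complex_of_real (x \<bullet> v) * wosc m \<sigma> n c t x
    + complex_of_real t * wosc m \<sigma> n (\<lambda>p. complex_of_real (p \<bullet> v * inverse (energy m p)) * c p) t x
    = \<i> * (wosc m \<sigma> n (D v) t x
       - complex_of_real (2 * real n * \<sigma>) * wosc m \<sigma> (Suc n) (\<lambda>p. complex_of_real (p \<bullet> v) * c p) t x)"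
proof -
  let ?D = "\<lambda>v p. complex_of_real (inverse (weight m \<sigma> p) ^ n) * D v p
     + complex_of_real (- (2 * real n * \<sigma>) * (p \<bullet> v) * inverse (weight m \<sigma> p) ^ Suc n) * c p"
  have deriv: "((\<lambda>p. complex_of_real (inverse (weight m \<sigma> p) ^ n) * c p) has_derivative (\<lambda>v. ?D v p)) (at p)" for p
    by (rule has_derivative_mult[OF has_derivative_of_real[OF inverse_weight_power_has_derivative] D])
  have eq: "?D v = (\<lambda>p. complex_of_real (inverse (weight m \<sigma> p) ^ n) * D v p
     + complex_of_real (- (2 * real n * \<sigma>)) * (complex_of_real (inverse (weight m \<sigma> p) ^ Suc n) * (complex_of_real (p \<bullet> v) * c p)))"
    by (rule ext) (simp add: mult_ac)
  have pc: "CcK 0 (\<lambda>p. complex_of_real (p \<bullet> v) * c p)"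
    by (rule CcK_mult[OF Ck_of_real[OF Ck_inner_const] c])
  note C = CcK_weight[OF Dv, of n] CcK_cmult[OF CcK_weight[OF pc, of "Suc n"], of "complex_of_real (- (2 * real n * \<sigma>))"]
  have "CcK 0 (?D v)" unfolding eq by (rule CcK_add[OF C])
  from osc_by_parts[OF m deriv CcK_weight[OF c] this, of x t]
  show ?thesis unfolding eq osc_add[OF m C] osc_cmult wosc_def
    by (simp add: mult.left_commute)
qed

lemma wosc_bound:
  assumes "CcK k a"
  shows "norm (wosc m \<sigma> n a t x) \<le> inverse (m\<^sup>2) ^ n * (LINT p|lborel. norm (a p))"
proof -
  have "norm (wosc m \<sigma> n a t x)
    \<le> (LINT p|lborel. norm (complex_of_real (inverse (weight m \<sigma> p) ^ n) * a p))"
    unfolding wosc_def by (rule osc_bound)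
  also have "\<dots> \<le> (LINT p|lborel. inverse (m\<^sup>2) ^ n * norm (a p))"
  proof (rule integral_mono)
    show "integrable lborel (\<lambda>p. norm (complex_of_real (inverse (weight m \<sigma> p) ^ n) * a p))"
      by (intro integrable_norm CcK_integrable[OF CcK_weight[OF assms]])
    show "integrable lborel (\<lambda>p. inverse (m\<^sup>2) ^ n * norm (a p))"
      by (intro integrable_mult_right integrable_norm CcK_integrable[OF assms])
    fix p :: 'a
    have "inverse (weight m \<sigma> p) ^ n \<le> inverse (m\<^sup>2) ^ n"
      using weight_ge[of p] weight_pos[of p] m by (intro power_mono le_imp_inverse_le) auto
    moreover have "norm (complex_of_real (inverse (weight m \<sigma> p) ^ n)) = inverse (weight m \<sigma> p) ^ n"
      using weight_pos[of p] by (simp only: norm_of_real) simp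
    ultimately show "norm (complex_of_real (inverse (weight m \<sigma> p) ^ n) * a p) \<le> inverse (m\<^sup>2) ^ n * norm (a p)"
      by (simp only: norm_mult mult_right_mono norm_ge_zero)
  qed
  finally show ?thesis by simp
qed

lemma wosc_weight: "wosc m \<sigma> (Suc n) (\<lambda>p. complex_of_real (weight m \<sigma> p) * a p) t x = wosc m \<sigma> n a t x"
proof -
  have "inverse (weight m \<sigma> p) ^ Suc n * weight m \<sigma> p = inverse (weight m \<sigma> p) ^ n" for p :: 'a
    using weight_pos[of p] by simp
  then have "complex_of_real (inverse (weight m \<sigma> p) ^ Suc n) * (complex_of_real (weight m \<sigma> p) * a p)
    = complex_of_real (inverse (weight m \<sigma> p) ^ n) * a p" for p
    by (simp only: mult.assoc[symmetric] of_real_mult[symmetric])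
  then show ?thesis by (simp only: wosc_def)
qed

text \<open>With \<open>c\<close> = E^2 a and \<open>c' b\<close> = (p . b) E a, two divisions by E
  leave no denominator: p_b c / E is \<open>c' b\<close>, and p_b (\<open>c' b\<close>) / E is p_b^2
  a. Summing x_b times the identity for \<open>c\<close> and subtracting t times the identities for
  \<open>c'\<close> cancels the cross terms. What remains is the amplitude |x|^2 c - t^2 |p|^2 a,
  which is |x|^2 times the weight times a.\<close>

lemma wosc_recursion:
  fixes a :: "'a::euclidean_space \<Rightarrow> complex"
  defines "c \<equiv> \<lambda>p. complex_of_real (m\<^sup>2 + p \<bullet> p) * a p"
    and "c' \<equiv> \<lambda>b p. complex_of_real (p \<bullet> b * energy m p) * a p"
  assumes a: "CcK 0 a"
    and Dc: "\<And>p. (c has_derivative (\<lambda>v. Dc v p)) (at p)" "\<And>b. CcK 0 (Dc b)"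
    and Dc': "\<And>b p. (c' b has_derivative (\<lambda>v. Dc' b v p)) (at p)" "\<And>b v. CcK 0 (Dc' b v)"
    and t: "\<sigma> * (norm x)\<^sup>2 = (norm x)\<^sup>2 - t\<^sup>2"
  shows "complex_of_real ((norm x)\<^sup>2) * wosc m \<sigma> n a t x =
     \<i> * (\<Sum>b\<in>Basis. complex_of_real (x \<bullet> b) * (wosc m \<sigma> (Suc n) (Dc b) t x
       - complex_of_real (2 * real (Suc n) * \<sigma>) * wosc m \<sigma> (Suc (Suc n)) (\<lambda>p. complex_of_real (p \<bullet> b) * c p) t x))
     - \<i> * complex_of_real t * (\<Sum>b\<in>Basis. (wosc m \<sigma> (Suc n) (Dc' b b) t x
       - complex_of_real (2 * real (Suc n) * \<sigma>) * wosc m \<sigma> (Suc (Suc n)) (\<lambda>p. complex_of_real (p \<bullet> b) * c' b p) t x))"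
    (is "_ = \<i> * (\<Sum>b\<in>Basis. _ * ?X b) - _ * (\<Sum>b\<in>Basis. ?Y b)")
proof -
  let ?W = "\<lambda>a. wosc m \<sigma> (Suc n) a t x"
  have c: "CcK 0 c" unfolding c_def by (intro CcK_mult a Ck_of_real Ck_add Ck_const Ck_inner_self)
  have c': "CcK 0 (c' b)" for b
    unfolding c'_def by (intro CcK_mult a Ck_of_real Ck_mult Ck_inner_const Ck_energy m)
  have E: "energy m p \<noteq> 0" for p :: 'a using energy_pos[OF m, of p] by simp
  have "complex_of_real (p \<bullet> b * inverse (energy m p)) * c p = c' b p" for p b
    unfolding c_def c'_def energy_sq[symmetric] using E[of p] by (simp add: field_simps)
  then have A: "complex_of_real (x \<bullet> b) * ?W c + complex_of_real t * ?W (c' b) = \<i> * ?X b" for b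
    using wosc_by_parts[OF Dc(1) c Dc(2), where x = x and v = b and n = "Suc n" and t = t] by (simp only:)
  have "complex_of_real (p \<bullet> b * inverse (energy m p)) * c' b p = complex_of_real ((p \<bullet> b)\<^sup>2) * a p" for p b
    unfolding c'_def using E[of p] by (simp add: field_simps power2_eq_square)
  then have B: "complex_of_real (x \<bullet> b) * ?W (c' b) + complex_of_real t * ?W (\<lambda>p. complex_of_real ((p \<bullet> b)\<^sup>2) * a p)
      = \<i> * ?Y b" for b
    using wosc_by_parts[OF Dc'(1)[of b] c'[of b] Dc'(2)[of b b], where x = x and n = "Suc n" and t = t] by (simp only:)
  have pb: "CcK 0 (\<lambda>p. complex_of_real ((p \<bullet> b)\<^sup>2) * a p)" for b
    unfolding power2_eq_square by (intro CcK_mult a Ck_of_real Ck_mult Ck_inner_const)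
  have pp: "CcK 0 (\<lambda>p. complex_of_real (p \<bullet> p) * a p)"
    by (intro CcK_mult a Ck_of_real Ck_inner_self)
  have "(\<Sum>b\<in>Basis. ?W (\<lambda>p. complex_of_real ((p \<bullet> b)\<^sup>2) * a p)) = ?W (\<lambda>p. \<Sum>b\<in>Basis. complex_of_real ((p \<bullet> b)\<^sup>2) * a p)"
    by (rule wosc_sum[symmetric, OF finite_Basis pb])
  also have "(\<lambda>p. \<Sum>b\<in>Basis. complex_of_real ((p \<bullet> b)\<^sup>2) * a p) = (\<lambda>p. complex_of_real (p \<bullet> p) * a p)"
    unfolding sum_distrib_right[symmetric] of_real_sum[symmetric]
    unfolding power2_eq_square euclidean_inner[symmetric] ..
  finally have S: "(\<Sum>b\<in>Basis. ?W (\<lambda>p. complex_of_real ((p \<bullet> b)\<^sup>2) * a p)) = ?W (\<lambda>p. complex_of_real (p \<bullet> p) * a p)" .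
  have SB: "(\<Sum>b\<in>Basis. complex_of_real (x \<bullet> b) * ?W (c' b)) + complex_of_real t * ?W (\<lambda>p. complex_of_real (p \<bullet> p) * a p)
     = \<i> * (\<Sum>b\<in>Basis. ?Y b)"
    unfolding S[symmetric] sum_distrib_left sum.distrib[symmetric] by (simp only: B)
  have nx: "(\<Sum>b\<in>Basis. complex_of_real (x \<bullet> b) * complex_of_real (x \<bullet> b)) = complex_of_real ((norm x)\<^sup>2)"
    unfolding of_real_mult[symmetric] of_real_sum[symmetric] euclidean_inner[symmetric] power2_norm_eq_inner ..
  have SA: "complex_of_real ((norm x)\<^sup>2) * ?W c + complex_of_real t * (\<Sum>b\<in>Basis. complex_of_real (x \<bullet> b) * ?W (c' b))
     = \<i> * (\<Sum>b\<in>Basis. complex_of_real (x \<bullet> b) * ?X b)"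
  proof -
    have "\<i> * (\<Sum>b\<in>Basis. complex_of_real (x \<bullet> b) * ?X b)
      = (\<Sum>b\<in>Basis. complex_of_real (x \<bullet> b) * (\<i> * ?X b))" by (simp add: sum_distrib_left mult.left_commute)
    also have "\<dots> = (\<Sum>b\<in>Basis. complex_of_real (x \<bullet> b) * complex_of_real (x \<bullet> b) * ?W c
        + complex_of_real t * (complex_of_real (x \<bullet> b) * ?W (c' b)))"
      unfolding A[symmetric] by (simp add: algebra_simps)
    finally show ?thesis
      by (simp only: sum.distrib sum_distrib_left[symmetric] sum_distrib_right[symmetric] nx)
  qed
  \<comment> \<open>A factor of the weight is inserted at the price of one more inverse power; hence
    the right-hand side starts at \<open>Suc n\<close>.\<close>
  have "complex_of_real ((norm x)\<^sup>2) * wosc m \<sigma> n a t x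
    = ?W (\<lambda>p. complex_of_real ((norm x)\<^sup>2) * (complex_of_real (weight m \<sigma> p) * a p))"
    by (simp only: wosc_cmult wosc_weight)
  also have "(\<lambda>p. complex_of_real ((norm x)\<^sup>2) * (complex_of_real (weight m \<sigma> p) * a p))
    = (\<lambda>p. complex_of_real ((norm x)\<^sup>2) * c p + complex_of_real (- t\<^sup>2) * (complex_of_real (p \<bullet> p) * a p))"
  proof
    fix p :: 'a
    have "(norm x)\<^sup>2 * weight m \<sigma> p = (norm x)\<^sup>2 * m\<^sup>2 + (\<sigma> * (norm x)\<^sup>2) * (p \<bullet> p)"
      by (simp add: weight_def algebra_simps)
    also have "\<dots> = (norm x)\<^sup>2 * (m\<^sup>2 + p \<bullet> p) + (- t\<^sup>2) * (p \<bullet> p)"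
      unfolding t by (simp add: algebra_simps)
    finally show "complex_of_real ((norm x)\<^sup>2) * (complex_of_real (weight m \<sigma> p) * a p)
       = complex_of_real ((norm x)\<^sup>2) * c p + complex_of_real (- t\<^sup>2) * (complex_of_real (p \<bullet> p) * a p)"
      unfolding c_def by (simp only: mult.assoc[symmetric] of_real_mult[symmetric] distrib_right[symmetric] of_real_add[symmetric])
  qed
  also have "?W \<dots> = complex_of_real ((norm x)\<^sup>2) * ?W c - (complex_of_real t)\<^sup>2 * ?W (\<lambda>p. complex_of_real (p \<bullet> p) * a p)"
    unfolding wosc_add[OF CcK_cmult[OF c] CcK_cmult[OF pp]] wosc_cmult by simp
  also have "\<dots> = \<i> * (\<Sum>b\<in>Basis. complex_of_real (x \<bullet> b) * ?X b) - \<i> * complex_of_real t * (\<Sum>b\<in>Basis. ?Y b)"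
  proof -
    have "complex_of_real t * (\<i> * (\<Sum>b\<in>Basis. ?Y b)) = complex_of_real t * ((\<Sum>b\<in>Basis. complex_of_real (x \<bullet> b) * ?W (c' b))
        + complex_of_real t * ?W (\<lambda>p. complex_of_real (p \<bullet> p) * a p))" by (simp only: SB)
    with SA show ?thesis by (simp add: algebra_simps power2_eq_square)
  qed
  finally show ?thesis .
qed

end

text \<open>
  For \<open>\<bar>t\<bar> \<le> \<bar>x\<bar>\<close> and $\sigma = 1 - t^2/|x|^2 \in [0,1]$ the weight $m^2 + \sigma |p|^2 = E(p)^2 - (t/|x|)^2 |p|^2$
  is at least $m^2$: this expresses that the phase is not stationary.
\<close>

lemma wosc_decay:
  fixes a :: "'a::euclidean_space \<Rightarrow> complex"
  assumes m: "m > 0"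
  shows "CcK N a \<Longrightarrow> \<exists>C. \<forall>t x. \<bar>t\<bar> \<le> norm x \<longrightarrow>
    norm (wosc m (1 - t\<^sup>2 / (norm x)\<^sup>2) n a t x) * (1 + norm x) ^ N \<le> C"
proof (induction N arbitrary: a n)
  case 0
  \<comment> \<open>The parameter is nonnegative because |t| is at most |x|; at x = 0 also t = 0,
    the quotient 0/0 is 0, and the parameter is 1.\<close>
  have "norm (wosc m (1 - t\<^sup>2 / (norm x)\<^sup>2) n a t x) \<le> inverse (m\<^sup>2) ^ n * (LINT p|lborel. norm (a p))"
    if "\<bar>t\<bar> \<le> norm x" for t and x :: 'a
    by (rule wosc_bound[OF m _ 0]) (use that power_mono[OF that, of 2] in \<open>simp add: divide_le_eq_1\<close>)
  then show ?case by auto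
next
  case (Suc N)
  define c where "c = (\<lambda>p. complex_of_real (m\<^sup>2 + p \<bullet> p) * a p)"
  define c' where "c' = (\<lambda>b p. complex_of_real (p \<bullet> b * energy m p) * a p)"
  have a: "CcK 0 a" by (rule CcK_mono[OF Suc.prems]) simp
  have cS: "CcK (Suc N) c"
    unfolding c_def by (intro CcK_mult Suc.prems Ck_of_real Ck_add Ck_const Ck_inner_self)
  have c'S: "CcK (Suc N) (c' b)" for b
    unfolding c'_def by (intro CcK_mult Suc.prems Ck_of_real Ck_mult Ck_inner_const Ck_energy m)
  obtain Dc where Dc: "\<And>p. (c has_derivative (\<lambda>v. Dc v p)) (at p)" "\<And>v. CcK N (Dc v)"
    using CcK_SucD[OF cS] by blast
  have "\<forall>b. \<exists>D. (\<forall>p. (c' b has_derivative (\<lambda>v. D v p)) (at p)) \<and> (\<forall>v. CcK N (D v))"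
    using CcK_SucD[OF c'S] by blast
  then obtain Dc' where Dc': "\<And>b p. (c' b has_derivative (\<lambda>v. Dc' b v p)) (at p)" "\<And>b v. CcK N (Dc' b v)"
    by metis
  have pc: "CcK N (\<lambda>p. complex_of_real (p \<bullet> b) * c p)" for b
    by (intro CcK_mult Ck_of_real Ck_inner_const CcK_mono[OF cS]) simp
  have pc': "CcK N (\<lambda>p. complex_of_real (p \<bullet> b) * c' b p)" for b
    by (intro CcK_mult Ck_of_real Ck_inner_const CcK_mono[OF c'S]) simp
  \<comment> \<open>The induction hypothesis holds for all amplitudes and exponents, with the
    parameter varying with t and x inside it; so the constants for each b are uniform in t and
    x.\<close>
  obtain C1 where C1: "\<And>b t x. \<bar>t\<bar> \<le> norm x \<Longrightarrow>
    norm (wosc m (1 - t\<^sup>2 / (norm x)\<^sup>2) (Suc n) (Dc b) t x) * (1 + norm x) ^ N \<le> C1 b"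
    using Suc.IH[OF Dc(2), where n = "Suc n"] by metis
  obtain C2 where C2: "\<And>b t x. \<bar>t\<bar> \<le> norm x \<Longrightarrow>
    norm (wosc m (1 - t\<^sup>2 / (norm x)\<^sup>2) (Suc (Suc n)) (\<lambda>p. complex_of_real (p \<bullet> b) * c p) t x) * (1 + norm x) ^ N \<le> C2 b"
    using Suc.IH[OF pc, where n = "Suc (Suc n)"] by metis
  obtain C3 where C3: "\<And>b t x. \<bar>t\<bar> \<le> norm x \<Longrightarrow>
    norm (wosc m (1 - t\<^sup>2 / (norm x)\<^sup>2) (Suc n) (Dc' b b) t x) * (1 + norm x) ^ N \<le> C3 b"
  proof -
    have "\<forall>b. \<exists>C. \<forall>t x. \<bar>t\<bar> \<le> norm x \<longrightarrow>
      norm (wosc m (1 - t\<^sup>2 / (norm x)\<^sup>2) (Suc n) (Dc' b b) t x) * (1 + norm x) ^ N \<le> C"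
      using Suc.IH[OF Dc'(2)] by blast
    from choice[OF this] show thesis using that by blast
  qed
  obtain C4 where C4: "\<And>b t x. \<bar>t\<bar> \<le> norm x \<Longrightarrow>
    norm (wosc m (1 - t\<^sup>2 / (norm x)\<^sup>2) (Suc (Suc n)) (\<lambda>p. complex_of_real (p \<bullet> b) * c' b p) t x) * (1 + norm x) ^ N \<le> C4 b"
    using Suc.IH[OF pc', where n = "Suc (Suc n)"] by metis
  define C where "C = (\<Sum>b\<in>Basis. C1 b + 2 * real (Suc n) * C2 b) + (\<Sum>b\<in>Basis. C3 b + 2 * real (Suc n) * C4 b)"
  define I where "I = inverse (m\<^sup>2) ^ n * (LINT p|lborel. norm (a p))"
  \<comment> \<open>The first bound is for |x| at least 1, where 1 + |x| is at most 2 |x|; the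
    second for |x| < 1, where the trivial estimate by I is enough.\<close>
  have "norm (wosc m (1 - t\<^sup>2 / (norm x)\<^sup>2) n a t x) * (1 + norm x) ^ Suc N \<le> max (2 * C) (I * 2 ^ Suc N)"
    if tx: "\<bar>t\<bar> \<le> norm x" for t and x :: 'a
  proof -
    define \<sigma> where "\<sigma> = 1 - t\<^sup>2 / (norm x)\<^sup>2"
    define w where "w = norm (wosc m \<sigma> n a t x)"
    have \<sigma>: "0 \<le> \<sigma>" "\<sigma> \<le> 1"
      unfolding \<sigma>_def using power_mono[OF tx, of 2] by (simp_all add: divide_le_eq_1)
    have wI: "w \<le> I" unfolding w_def I_def by (rule wosc_bound[OF m \<sigma>(1) a])
    show ?thesis
    proof (cases "norm x \<ge> 1")
      case False
      have "w * (1 + norm x) ^ Suc N \<le> I * 2 ^ Suc N"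
        by (rule mult_mono[OF wI power_mono]) (use False wI w_def norm_ge_zero order_trans in \<open>auto simp: I_def\<close>)
      then show ?thesis unfolding w_def \<sigma>_def by linarith
    next
      case True
      then have x0: "norm x > 0" by linarith
      let ?X = "\<lambda>b. wosc m \<sigma> (Suc n) (Dc b) t x
       - complex_of_real (2 * real (Suc n) * \<sigma>) * wosc m \<sigma> (Suc (Suc n)) (\<lambda>p. complex_of_real (p \<bullet> b) * c p) t x"
      let ?Y = "\<lambda>b. wosc m \<sigma> (Suc n) (Dc' b b) t x
       - complex_of_real (2 * real (Suc n) * \<sigma>) * wosc m \<sigma> (Suc (Suc n)) (\<lambda>p. complex_of_real (p \<bullet> b) * c' b p) t x"
      let ?r = "(1 + norm x) ^ N"
      have r: "?r \<ge> 0" by simp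
      have diff_bound: "norm (u - complex_of_real (2 * real (Suc n) * \<sigma>) * v) * ?r \<le> B1 + 2 * real (Suc n) * B2"
        if "norm u * ?r \<le> B1" "norm v * ?r \<le> B2" for u v B1 B2
      proof -
        have "norm (complex_of_real (2 * real (Suc n) * \<sigma>) * v) * ?r = \<sigma> * (2 * real (Suc n) * (norm v * ?r))"
          using \<sigma> by (simp only: norm_mult norm_of_real abs_mult) simp
        also have "\<dots> \<le> 1 * (2 * real (Suc n) * (norm v * ?r))"
          by (rule mult_right_mono[OF \<sigma>(2)]) simp
        also have "\<dots> \<le> 2 * real (Suc n) * B2"
          using mult_left_mono[OF that(2), of "2 * real (Suc n)"] by simp
        finally have "norm (complex_of_real (2 * real (Suc n) * \<sigma>) * v) * ?r \<le> 2 * real (Suc n) * B2" .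
        moreover have "norm (u - complex_of_real (2 * real (Suc n) * \<sigma>) * v) * ?r
          \<le> (norm u + norm (complex_of_real (2 * real (Suc n) * \<sigma>) * v)) * ?r"
          by (rule mult_right_mono[OF norm_triangle_ineq4 r])
        ultimately show ?thesis using that(1) by (simp only: distrib_right)
      qed
      have X: "norm (?X b) * ?r \<le> C1 b + 2 * real (Suc n) * C2 b" for b
        by (rule diff_bound[OF C1[OF tx, folded \<sigma>_def] C2[OF tx, folded \<sigma>_def]])
      have Y: "norm (?Y b) * ?r \<le> C3 b + 2 * real (Suc n) * C4 b" for b
        by (rule diff_bound[OF C3[OF tx, folded \<sigma>_def] C4[OF tx, folded \<sigma>_def]])
      have \<sigma>x: "\<sigma> * (norm x)\<^sup>2 = (norm x)\<^sup>2 - t\<^sup>2"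
        unfolding \<sigma>_def using x0 by (simp add: field_simps)
      have rec: "complex_of_real ((norm x)\<^sup>2) * wosc m \<sigma> n a t x
        = \<i> * (\<Sum>b\<in>Basis. complex_of_real (x \<bullet> b) * ?X b) - \<i> * complex_of_real t * (\<Sum>b\<in>Basis. ?Y b)"
        unfolding c_def c'_def
        by (rule wosc_recursion[OF m \<sigma>(1) a Dc(1)[unfolded c_def] CcK_mono[OF Dc(2)]
              Dc'(1)[unfolded c'_def] CcK_mono[OF Dc'(2)] \<sigma>x]) simp_all
      have "(norm x)\<^sup>2 * w = norm (complex_of_real ((norm x)\<^sup>2) * wosc m \<sigma> n a t x)"
        by (simp add: w_def norm_mult norm_power)
      also have "\<dots> \<le> norm (\<Sum>b\<in>Basis. complex_of_real (x \<bullet> b) * ?X b) + \<bar>t\<bar> * norm (\<Sum>b\<in>Basis. ?Y b)"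
        unfolding rec by (rule order_trans[OF norm_triangle_ineq4]) (simp add: norm_mult)
      \<comment> \<open>The cone condition replaces the factor |t| of the second sum by |x|. Against
        |x|^2 on the left, one power of |x| is gained.\<close>
      also have "\<dots> \<le> (\<Sum>b\<in>Basis. norm x * norm (?X b)) + norm x * (\<Sum>b\<in>Basis. norm (?Y b))"
      proof (intro add_mono mult_mono tx sum_norm_le)
        show "norm (complex_of_real (x \<bullet> b) * ?X b) \<le> norm x * norm (?X b)" if "b \<in> Basis" for b
          unfolding norm_mult norm_of_real by (rule mult_right_mono[OF Basis_le_norm[OF that] norm_ge_zero])
      qed (auto intro: sum_nonneg)
      also have "\<dots> = norm x * ((\<Sum>b\<in>Basis. norm (?X b)) + (\<Sum>b\<in>Basis. norm (?Y b)))"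
        by (simp only: sum_distrib_left distrib_left)
      finally have "(norm x)\<^sup>2 * w * ?r \<le> norm x * ((\<Sum>b\<in>Basis. norm (?X b)) + (\<Sum>b\<in>Basis. norm (?Y b))) * ?r"
        by (rule mult_right_mono[OF _ r])
      also have "\<dots> = norm x * ((\<Sum>b\<in>Basis. norm (?X b) * ?r) + (\<Sum>b\<in>Basis. norm (?Y b) * ?r))"
        by (simp only: sum_distrib_right distrib_right mult.assoc)
      also have "\<dots> \<le> norm x * C"
        unfolding C_def by (intro mult_left_mono add_mono sum_mono X Y norm_ge_zero)
      finally have "norm x * (norm x * (w * ?r)) \<le> norm x * C" by (simp add: power2_eq_square mult.assoc)
      then have *: "norm x * (w * ?r) \<le> C" using x0 by simp
      have "w * (1 + norm x) ^ Suc N = (1 + norm x) * (w * ?r)" by simp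
      also have "\<dots> \<le> (2 * norm x) * (w * ?r)"
        using True by (intro mult_right_mono) (auto simp: w_def)
      also have "\<dots> \<le> 2 * C" using * by simp
      finally show ?thesis unfolding w_def \<sigma>_def by linarith
    qed
  qed
  then show ?case by blast
qed

lemma osc_decay:
  fixes a :: "'a::euclidean_space \<Rightarrow> complex"
  assumes "m > 0" "CcK N a"
  shows "\<exists>C. \<forall>t x. \<bar>t\<bar> \<le> norm x \<longrightarrow> norm (osc m t a x) * (1 + norm x) ^ N \<le> C"
  using wosc_decay[OF assms, of 0] by (simp add: wosc_def)

section \<open>Fourier inversion\<close>

text \<open>\<open>lborel\<close> is the image of the product measure over \<open>Basis\<close>
  under reassembly from coordinates, which reduces the claim to finite products.\<close>

lemma lborel_prod_integral:
  fixes f :: "'a::euclidean_space \<Rightarrow> real \<Rightarrow> 'b::{real_normed_field,banach,second_countable_topology}"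
  assumes "\<And>b. b \<in> Basis \<Longrightarrow> integrable lborel (f b)"
  shows "integrable lborel (\<lambda>x. \<Prod>b\<in>Basis. f b (x \<bullet> b))"
    and "(LINT x|lborel. (\<Prod>b\<in>Basis. f b (x \<bullet> b))) = (\<Prod>b\<in>Basis. (LINT y|lborel. f b y))"
proof -
  interpret product_sigma_finite "\<lambda>_::'a. lborel :: real measure" ..
  let ?T = "\<lambda>g::'a \<Rightarrow> real. \<Sum>b\<in>Basis. g b *\<^sub>R b"
  have [measurable]: "?T \<in> measurable (\<Pi>\<^sub>M b\<in>Basis. lborel) borel" by measurable
  have [measurable]: "f b \<in> borel_measurable borel" if "b \<in> Basis" for b
    using assms[OF that] by auto
  have [measurable]: "(\<lambda>x. \<Prod>b\<in>Basis. f b (x \<bullet> b)) \<in> borel_measurable borel" by measurable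
  have T: "(\<Prod>b\<in>Basis. f b (?T g \<bullet> b)) = (\<Prod>b\<in>Basis. f b (g b))" for g
    by (intro prod.cong refl) simp
  show "integrable lborel (\<lambda>x. \<Prod>b\<in>Basis. f b (x \<bullet> b))"
    by (subst lborel_eq) (simp add: integrable_distr_eq T product_integrable_prod assms)
  show "(LINT x|lborel. (\<Prod>b\<in>Basis. f b (x \<bullet> b))) = (\<Prod>b\<in>Basis. (LINT y|lborel. f b y))"
    by (subst lborel_eq) (simp add: integral_distr T product_integral_prod assms)
qed

text \<open>The exponent is not optimal. Twice the dimension is convenient because 1 + y^2 is at
  most (1 + |x|)^2 for every coordinate y, so a product of integrable functions of one variable
  dominates. In R^3 this is the 6 of \<open>CcK 6\<close>.\<close>

lemma integrable_inverse_norm_power: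
  "integrable lborel (\<lambda>x::'a::euclidean_space. inverse ((1 + norm x) ^ (2 * DIM('a))))"
proof (rule Bochner_Integration.integrable_bound)
  have "integrable lborel (\<lambda>y::real. inverse (1 + y\<^sup>2))"
    using integrable_inverse_1_plus_square by (simp add: set_integrable_def)
  then show "integrable lborel (\<lambda>x::'a. \<Prod>b\<in>Basis. inverse (1 + (x \<bullet> b)\<^sup>2))"
    by (rule lborel_prod_integral)
  have "inverse ((1 + norm x) ^ (2 * DIM('a))) \<le> (\<Prod>b\<in>Basis. inverse (1 + (x \<bullet> b)\<^sup>2))" for x :: 'a
  proof -
    have "inverse ((1 + norm x) ^ (2 * DIM('a))) = (\<Prod>b\<in>(Basis::'a set). inverse ((1 + norm x)\<^sup>2))"
      by (simp add: power_mult power_inverse)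
    also have "\<dots> \<le> (\<Prod>b\<in>Basis. inverse (1 + (x \<bullet> b)\<^sup>2))"
    proof (intro prod_mono conjI le_imp_inverse_le)
      fix b :: 'a assume "b \<in> Basis"
      then have "(x \<bullet> b)\<^sup>2 \<le> (norm x)\<^sup>2"
        using power_mono[OF Basis_le_norm, of b x 2] by simp
      then show "1 + (x \<bullet> b)\<^sup>2 \<le> (1 + norm x)\<^sup>2" by (simp add: power2_sum add_increasing2)
    qed (auto intro: add_pos_nonneg)
    finally show ?thesis .
  qed
  then show "AE x in lborel. norm (inverse ((1 + norm x) ^ (2 * DIM('a)))) \<le> norm (\<Prod>b\<in>(Basis::'a set). inverse (1 + (x \<bullet> b)\<^sup>2))"
    by (intro AE_I2) (simp add: order_trans[OF _ abs_ge_self])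
qed simp

lemma lborel_integral_affine:
  fixes f :: "'a::euclidean_space \<Rightarrow> 'b::{banach, second_countable_topology}"
  assumes [measurable]: "f \<in> borel_measurable borel" and c: "c \<noteq> 0"
  shows "(LINT x|lborel. f x) = \<bar>c\<bar> ^ DIM('a) *\<^sub>R (LINT x|lborel. f (t + c *\<^sub>R x))"
  by (subst lborel_affine[OF c, of t]) (simp add: integral_density integral_distr)

text \<open>The inverse Fourier integral without normalisation; the forward transform is its value
  at the reflected point.\<close>

definition IF :: "('a::euclidean_space \<Rightarrow> complex) \<Rightarrow> 'a \<Rightarrow> complex" where
  "IF g x = (LINT p|lborel. exp (\<i> * complex_of_real (p \<bullet> x)) * g p)"

section \<open>Gaussians and their transforms\<close>

lemma gaussian_integrable: "integrable lborel (\<lambda>y::real. complex_of_real (exp (- y\<^sup>2 / 2)))"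
proof -
  have "integrable lborel std_normal_density" by (rule integrable_normal_density) simp
  then have "integrable lborel (\<lambda>y. complex_of_real (sqrt (2 * pi) * std_normal_density y))" by simp
  then show ?thesis by (simp add: std_normal_density_def)
qed

text \<open>This is the characteristic function of the standard normal distribution, rescaled by the
  normalising factor of its density.\<close>

lemma gaussian_IF:
  "(LINT y|lborel. exp (\<i> * complex_of_real (y * s)) * complex_of_real (exp (- y\<^sup>2 / 2)))
   = complex_of_real (sqrt (2 * pi) * exp (- s\<^sup>2 / 2))"
proof -
  have "complex_of_real (exp (- s\<^sup>2 / 2)) = (LINT x|density lborel std_normal_density. iexp (s * x))"
    using char_std_normal_distribution by (simp add: char_def fun_eq_iff)
  also have "\<dots> = (LINT x|lborel. std_normal_density x *\<^sub>R iexp (s * x))"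
    by (subst integral_density) auto
  also have "complex_of_real (sqrt (2 * pi)) * \<dots> = (LINT x|lborel. complex_of_real (sqrt (2 * pi)) * (std_normal_density x *\<^sub>R iexp (s * x)))"
    by (rule integral_mult_right_zero[symmetric])
  also have "(\<lambda>x. complex_of_real (sqrt (2 * pi)) * (std_normal_density x *\<^sub>R iexp (s * x)))
    = (\<lambda>y. exp (\<i> * complex_of_real (y * s)) * complex_of_real (exp (- y\<^sup>2 / 2)))"
    by (simp add: fun_eq_iff std_normal_density_def scaleR_conv_of_real mult_ac)
  finally show ?thesis by simp
qed

definition gauss :: "'a::euclidean_space \<Rightarrow> complex" where
  "gauss x = complex_of_real (exp (- (norm x)\<^sup>2 / 2))"

lemma gauss_prod: "gauss x = (\<Prod>b\<in>Basis. complex_of_real (exp (- (x \<bullet> b)\<^sup>2 / 2)))"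
proof -
  have "- (norm x)\<^sup>2 / 2 = (\<Sum>b\<in>Basis. - (x \<bullet> b)\<^sup>2 / 2)"
    unfolding power2_norm_eq_inner euclidean_inner[of x x]
    by (simp add: sum_negf sum_divide_distrib[symmetric] power2_eq_square)
  then show ?thesis by (simp add: gauss_def exp_sum)
qed

lemma integrable_gauss: "integrable lborel gauss"
  unfolding gauss_prod[abs_def] by (rule lborel_prod_integral(1)) (rule gaussian_integrable)

lemma IF_gauss:
  "IF gauss (x::'a::euclidean_space) = complex_of_real (sqrt (2 * pi) ^ DIM('a)) * gauss x"
proof -
  let ?f = "\<lambda>b y. exp (\<i> * complex_of_real (y * (x \<bullet> b))) * complex_of_real (exp (- y\<^sup>2 / 2))"
  have "exp (\<i> * complex_of_real (p \<bullet> x)) * gauss p = (\<Prod>b\<in>Basis. ?f b (p \<bullet> b))" for p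
    unfolding gauss_prod euclidean_inner[of p x]
    by (simp add: prod.distrib sum_distrib_left exp_sum)
  then have "IF gauss x = (LINT p|lborel. (\<Prod>b\<in>Basis. ?f b (p \<bullet> b)))" by (simp add: IF_def)
  also have "\<dots> = (\<Prod>b\<in>Basis. (LINT y|lborel. ?f b y))"
    by (rule lborel_prod_integral(2), rule Bochner_Integration.integrable_bound[OF gaussian_integrable])
       (auto simp: norm_mult)
  also have "\<dots> = complex_of_real (sqrt (2 * pi) ^ DIM('a)) * gauss x"
    unfolding gaussian_IF gauss_prod by (simp add: prod.distrib)
  finally show ?thesis .
qed

text \<open>The common core of duality, the adjoint formula and the convolution formula: a kernel
  bounded by 1 times two integrable functions is absolutely integrable on the product.\<close>

lemma Fubini_exchange:
  fixes f :: "'a::euclidean_space \<Rightarrow> complex" and g :: "'b::euclidean_space \<Rightarrow> complex"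
  assumes f: "integrable lborel f" and g: "integrable lborel g"
    and k[measurable]: "(\<lambda>z. k (fst z) (snd z)) \<in> borel_measurable borel"
    and k1: "\<And>x y. norm (k x y) \<le> 1"
  shows "(LINT x|lborel. f x * (LINT y|lborel. k x y * g y)) = (LINT y|lborel. (LINT x|lborel. k x y * f x) * g y)"
proof -
  have [measurable]: "f \<in> borel_measurable borel" "g \<in> borel_measurable borel"
    using f g by auto
  have kp[measurable]: "(\<lambda>(x, y). k x y) \<in> borel_measurable (lborel \<Otimes>\<^sub>M lborel)"
    unfolding lborel_prod using k by (simp add: case_prod_unfold)
  have [measurable]: "k x \<in> borel_measurable borel" for x
  proof -
    have "(\<lambda>y. (\<lambda>z. k (fst z) (snd z)) (x, y)) \<in> borel_measurable borel" by measurable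
    then show ?thesis by simp
  qed
  have bnd: "norm (f x * (k x y * g y)) \<le> norm (f x) * norm (g y)" for x y
    using mult_right_mono[OF k1[of x y], of "norm (g y)"] by (simp add: norm_mult mult_left_mono)
  have int_y: "integrable lborel (\<lambda>y. f x * (k x y * g y))" for x
    by (rule Bochner_Integration.integrable_bound[where f = "\<lambda>y. norm (f x) * norm (g y)"])
       (use g bnd in \<open>auto intro!: integrable_mult_right integrable_norm AE_I2\<close>)
  have "integrable (lborel \<Otimes>\<^sub>M lborel) (\<lambda>(x, y). f x * (k x y * g y))"
  proof (rule lborel_pair.Fubini_integrable)
    show "(\<lambda>(x, y). f x * (k x y * g y)) \<in> borel_measurable (lborel \<Otimes>\<^sub>M lborel)"
      using kp by measurable
    show "integrable lborel (\<lambda>x. LINT y|lborel. norm (case (x, y) of (x, y) \<Rightarrow> f x * (k x y * g y)))"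
    proof (rule Bochner_Integration.integrable_bound[where f = "\<lambda>x. norm (f x) * (LINT y|lborel. norm (g y))"])
      show "integrable lborel (\<lambda>x. norm (f x) * (LINT y|lborel. norm (g y)))"
        using f by (intro integrable_mult_left integrable_norm)
      show "(\<lambda>x. LINT y|lborel. norm (case (x, y) of (x, y) \<Rightarrow> f x * (k x y * g y))) \<in> borel_measurable lborel"
        using kp by measurable
      have "(LINT y|lborel. norm (f x * (k x y * g y))) \<le> norm (f x) * (LINT y|lborel. norm (g y))" for x
        using integral_mono[of lborel "\<lambda>y. norm (f x * (k x y * g y))" "\<lambda>y. norm (f x) * norm (g y)"] bnd int_y g
        by simp
      then show "AE x in lborel. norm (LINT y|lborel. norm (case (x, y) of (x, y) \<Rightarrow> f x * (k x y * g y)))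
          \<le> norm (norm (f x) * (LINT y|lborel. norm (g y)))"
        by (intro AE_I2) (simp add: integral_nonneg_AE order_trans[OF _ abs_ge_self])
    qed
  qed (use int_y in simp)
  from lborel_pair.Fubini_integral[OF this]
  have "(LINT y|lborel. LINT x|lborel. f x * (k x y * g y)) = (LINT x|lborel. LINT y|lborel. f x * (k x y * g y))" .
  moreover have "(LINT x|lborel. f x * (k x y * g y)) = (LINT x|lborel. k x y * f x) * g y" for y
    by (subst integral_mult_left_zero[symmetric]) (simp add: mult_ac)
  ultimately show ?thesis by simp
qed

lemma IF_duality:
  fixes f g :: "'a::euclidean_space \<Rightarrow> complex"
  assumes "integrable lborel f" "integrable lborel g"
  shows "(LINT x|lborel. f x * IF g x) = (LINT p|lborel. IF f p * g p)"
proof -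
  have "(LINT x|lborel. f x * (LINT p|lborel. exp (\<i> * complex_of_real (p \<bullet> x)) * g p))
    = (LINT p|lborel. (LINT x|lborel. exp (\<i> * complex_of_real (p \<bullet> x)) * f x) * g p)"
    by (rule Fubini_exchange[OF assms]) (auto intro!: borel_measurable_continuous_onI continuous_intros)
  then show ?thesis by (simp add: IF_def inner_commute)
qed

lemma IF_measurable:
  fixes g :: "'a::euclidean_space \<Rightarrow> complex"
  assumes [measurable]: "g \<in> borel_measurable borel"
  shows "IF g \<in> borel_measurable borel"
proof -
  have "(\<lambda>(x::'a, p::'a). exp (\<i> * complex_of_real (p \<bullet> x)) * g p) \<in> borel_measurable (borel \<Otimes>\<^sub>M lborel)"
    unfolding case_prod_unfold by measurable
  then show ?thesis unfolding IF_def[abs_def] by measurable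
qed

lemma IF_bound: "norm (IF g x) \<le> (LINT p|lborel. norm (g p))"
  unfolding IF_def by (rule order_trans[OF integral_norm_bound]) (simp add: norm_mult)

text \<open>Gaussian summation: \<open>h n\<close> is a damped exponential, and duality turns its
  integral against \<open>IF g\<close> into a Gaussian average of g around q of width
  \<open>e n\<close>. Dominated convergence evaluates both sides as \<open>e n\<close> tends to 0.
  The constant is c^2: one c from the transform of the Gaussian, one from its total mass.\<close>

lemma Fourier_inversion:
  fixes g :: "'a::euclidean_space \<Rightarrow> complex"
  assumes g: "CcK 0 g" and int: "integrable lborel (IF g)"
  shows "IF (IF g) (- q) = complex_of_real ((2 * pi) ^ DIM('a)) * g q"
proof -
  let ?n = "DIM('a)"
  define c where "c = sqrt (2 * pi) ^ ?n"
  note [measurable] = CcK_measurable[OF g] borel_measurable_integrable[OF int, simplified] 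
    borel_measurable_integrable[OF integrable_gauss, simplified]
  obtain B where B: "B > 0" "\<And>x. norm (g x) \<le> B" using CcK_bounded[OF g] by blast
  define e where "e n = 1 / real (Suc n)" for n
  have e: "e n > 0" for n by (simp add: e_def)
  have e0: "e \<longlonglongrightarrow> 0" unfolding e_def using LIMSEQ_inverse_real_of_nat by (simp add: inverse_eq_divide)
  have gauss_le: "norm (gauss x) \<le> 1" for x :: 'a by (simp add: gauss_def)
  define h where "h n x = exp (\<i> * complex_of_real (x \<bullet> (- q))) * gauss (e n *\<^sub>R x)" for n and x :: 'a
  have scale_int: "integrable lborel (\<lambda>x::'a. gauss (e n *\<^sub>R x))" for n
  proof -
    have "integrable (distr lborel borel (\<lambda>x::'a. 0 + e n *\<^sub>R x)) (\<lambda>x::'a. gauss x)"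
    proof -
      have "integrable (density (distr lborel borel (\<lambda>x::'a. 0 + e n *\<^sub>R x)) (\<lambda>_. \<bar>e n\<bar> ^ ?n)) (gauss :: 'a \<Rightarrow> _)"
        using integrable_gauss lborel_affine[of "e n" "0::'a"] e[of n] by simp
      then have "integrable (distr lborel borel (\<lambda>x::'a. 0 + e n *\<^sub>R x)) (\<lambda>x::'a. (e n ^ ?n) *\<^sub>R gauss x)"
        using e[of n] by (subst (asm) integrable_density) auto
      from integrable_scaleR_right[OF this, of "inverse (e n ^ ?n)"] show ?thesis
        using e[of n] by simp
    qed
    then show ?thesis by (subst (asm) integrable_distr_eq) auto
  qed
  have h: "integrable lborel (h n)" for n
    unfolding h_def by (rule Bochner_Integration.integrable_bound[OF scale_int[of n]]) (auto simp: norm_mult)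
  have IFh: "IF (h n) p = complex_of_real (inverse (e n) ^ ?n * c) * gauss (inverse (e n) *\<^sub>R (p - q))" for n p
  proof -
    have "IF (h n) p = (LINT x|lborel. exp (\<i> * complex_of_real (x \<bullet> (p - q))) * gauss (e n *\<^sub>R x))"
      unfolding IF_def h_def
      by (simp only: mult.assoc[symmetric] exp_add[symmetric] distrib_left[symmetric]
          of_real_add[symmetric] inner_add_right[symmetric] add_uminus_conv_diff)
    also have "\<dots> = (inverse (e n)) ^ ?n *\<^sub>R (LINT x|lborel. exp (\<i> * complex_of_real ((inverse (e n) *\<^sub>R x) \<bullet> (p - q))) * gauss x)"
      using e[of n] by (subst lborel_integral_affine[of _ "inverse (e n)" 0]) auto
    also have "(LINT x|lborel. exp (\<i> * complex_of_real ((inverse (e n) *\<^sub>R x) \<bullet> (p - q))) * gauss x)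
       = IF gauss (inverse (e n) *\<^sub>R (p - q))"
      by (simp add: IF_def)
    finally show ?thesis by (simp add: IF_gauss c_def scaleR_conv_of_real)
  qed
  have eq: "(LINT x|lborel. h n x * IF g x) = complex_of_real c * (LINT y|lborel. gauss y * g (q + e n *\<^sub>R y))" for n
  proof -
    have "(LINT x|lborel. h n x * IF g x) = (LINT p|lborel. IF (h n) p * g p)"
      by (rule IF_duality[OF h CcK_integrable[OF g]])
    also have "\<dots> = e n ^ ?n *\<^sub>R (LINT y|lborel. IF (h n) (q + e n *\<^sub>R y) * g (q + e n *\<^sub>R y))"
      using e[of n] IF_measurable[of "h n"] h[of n] by (subst lborel_integral_affine[of _ "e n" q]) auto
    also have "\<dots> = e n ^ ?n *\<^sub>R (LINT y|lborel. complex_of_real (inverse (e n) ^ ?n * c) * (gauss y * g (q + e n *\<^sub>R y)))"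
      using e[of n] by (simp add: IFh mult.assoc)
    also have "\<dots> = complex_of_real (e n ^ ?n * (inverse (e n) ^ ?n * c)) * (LINT y|lborel. gauss y * g (q + e n *\<^sub>R y))"
      by (simp add: scaleR_conv_of_real)
    also have "e n ^ ?n * (inverse (e n) ^ ?n * c) = c"
      using e[of n] by (simp add: power_mult_distrib[symmetric] mult.assoc[symmetric])
    finally show ?thesis .
  qed
  have "(\<lambda>n. LINT y|lborel. gauss y * g (q + e n *\<^sub>R y)) \<longlonglongrightarrow> (LINT y::'a|lborel. gauss y * g q)"
  proof (rule integral_dominated_convergence)
    show "integrable lborel (\<lambda>y::'a. B * norm (gauss y))"
      by (intro integrable_mult_right integrable_norm integrable_gauss)
    show "AE y in lborel. norm (gauss y * g (q + e n *\<^sub>R y)) \<le> B * norm (gauss y)" for n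
      unfolding norm_mult mult.commute[of B] by (intro AE_I2 mult_left_mono B norm_ge_zero)
    show "AE y in lborel. (\<lambda>n. gauss y * g (q + e n *\<^sub>R y)) \<longlonglongrightarrow> gauss y * g q"
    proof (intro AE_I2 tendsto_mult tendsto_const)
      fix y
      have "(\<lambda>n. q + e n *\<^sub>R y) \<longlonglongrightarrow> q + 0 *\<^sub>R y" by (intro tendsto_intros e0)
      then show "(\<lambda>n. g (q + e n *\<^sub>R y)) \<longlonglongrightarrow> g q"
        using CcK_continuous[OF g] by (intro isCont_tendsto_compose[of q g]) (auto simp: continuous_on_eq_continuous_at)
    qed
  qed measurable
  moreover have "(LINT y::'a|lborel. gauss y * g q) = complex_of_real c * g q"
  proof -
    have "(LINT y::'a|lborel. gauss y) = IF gauss (0::'a)" by (simp add: IF_def)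
    then show ?thesis by (simp add: IF_gauss c_def gauss_def)
  qed
  ultimately have R: "(\<lambda>n. LINT x|lborel. h n x * IF g x) \<longlonglongrightarrow> complex_of_real c * (complex_of_real c * g q)"
    unfolding eq by (auto intro!: tendsto_intros)
  have "(\<lambda>n. LINT x|lborel. h n x * IF g x) \<longlonglongrightarrow> (LINT x|lborel. exp (\<i> * complex_of_real (x \<bullet> (- q))) * IF g x)"
  proof (rule integral_dominated_convergence)
    show "integrable lborel (\<lambda>x. norm (IF g x))" by (intro integrable_norm int)
    show "AE x in lborel. norm (h n x * IF g x) \<le> norm (IF g x)" for n
      using gauss_le by (intro AE_I2) (simp add: h_def norm_mult mult_left_le_one_le)
    show "AE x in lborel. (\<lambda>n. h n x * IF g x) \<longlonglongrightarrow> exp (\<i> * complex_of_real (x \<bullet> (- q))) * IF g x"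
    proof (intro AE_I2 tendsto_mult tendsto_const)
      fix x :: 'a
      have "(\<lambda>n. exp (\<i> * complex_of_real (x \<bullet> (- q))) * complex_of_real (exp (- (norm (e n *\<^sub>R x))\<^sup>2 / 2)))
        \<longlonglongrightarrow> exp (\<i> * complex_of_real (x \<bullet> (- q))) * complex_of_real (exp (- (norm (0 *\<^sub>R x))\<^sup>2 / 2))"
        by (intro tendsto_intros e0) simp
      then show "(\<lambda>n. h n x) \<longlonglongrightarrow> exp (\<i> * complex_of_real (x \<bullet> (- q)))"
        by (simp add: h_def gauss_def)
    qed
    show "(\<lambda>x. h n x * IF g x) \<in> borel_measurable lborel" for n using h[of n] by measurable
  qed measurable
  from LIMSEQ_unique[OF this R] have "IF (IF g) (- q) = complex_of_real (c * c) * g q"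
    by (simp add: IF_def)
  also have "c * c = (2 * pi) ^ ?n" unfolding c_def power_mult_distrib[symmetric] by simp
  finally show ?thesis .
qed

section \<open>The space $L^2$\<close>

lemma norm_vec_sq: "(norm (v :: complex ^ 'n))\<^sup>2 = (\<Sum>i\<in>UNIV. (norm (v $ i))\<^sup>2)"
  by (simp add: norm_vec_def L2_set_def sum_nonneg)

lemma norm_smult: "norm (a *s (v :: complex ^ 'n)) = norm a * norm v"
proof -
  have "(norm (a *s v))\<^sup>2 = (norm a * norm v)\<^sup>2"
    by (simp add: norm_vec_sq power_mult_distrib norm_mult sum_distrib_left)
  then show ?thesis by (simp add: power2_eq_iff_nonneg)
qed

lemma bounded_linear_smult: "bounded_linear (\<lambda>v :: complex ^ 'n. a *s v)"
  by (rule linear_conv_bounded_linear[THEN iffD1], rule linearI)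
     (auto simp: vec_eq_iff algebra_simps)

lemma in_L2_measurable: "in_L2 f \<Longrightarrow> f \<in> borel_measurable borel"
  by (simp add: in_L2_def)

lemma in_L2_integrable: "in_L2 f \<Longrightarrow> integrable lborel (\<lambda>x. (norm (f x))\<^sup>2)"
  by (simp add: in_L2_def)

lemma in_L2_bound:
  assumes [measurable]: "f \<in> borel_measurable borel" and g: "integrable lborel g"
    and "\<And>x. (norm (f x))\<^sup>2 \<le> g x"
  shows "in_L2 f"
  unfolding in_L2_def
proof
  show "integrable lborel (\<lambda>x. (norm (f x))\<^sup>2)"
    by (rule Bochner_Integration.integrable_bound[OF g])
       (use assms(3) in \<open>auto intro!: AE_I2 order_trans[OF _ abs_ge_self]\<close>)
qed simp

lemma in_L2_add:
  assumes "in_L2 f" "in_L2 g"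
  shows "in_L2 (\<lambda>x. f x + g x)"
proof (rule in_L2_bound)
  note [measurable] = in_L2_measurable[OF assms(1)] in_L2_measurable[OF assms(2)]
  show "(\<lambda>x. f x + g x) \<in> borel_measurable borel" by measurable
  show "integrable lborel (\<lambda>x. 2 * (norm (f x))\<^sup>2 + 2 * (norm (g x))\<^sup>2)"
    using assms by (simp add: in_L2_def)
  fix x
  have "(norm (f x + g x))\<^sup>2 \<le> (norm (f x) + norm (g x))\<^sup>2"
    by (intro power_mono norm_triangle_ineq norm_ge_zero)
  also have "\<dots> \<le> 2 * (norm (f x))\<^sup>2 + 2 * (norm (g x))\<^sup>2"
    using zero_le_power2[of "norm (f x) - norm (g x)"] by (simp add: power2_eq_square algebra_simps)
  finally show "(norm (f x + g x))\<^sup>2 \<le> 2 * (norm (f x))\<^sup>2 + 2 * (norm (g x))\<^sup>2" .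
qed

lemma in_L2_smult:
  assumes "in_L2 f"
  shows "in_L2 (\<lambda>x. a *s f x)"
proof (rule in_L2_bound)
  have "f \<in> borel_measurable borel" by (rule in_L2_measurable[OF assms])
  then show "(\<lambda>x. a *s f x) \<in> borel_measurable borel"
    by (rule measurable_compose)
       (intro borel_measurable_continuous_onI linear_continuous_on bounded_linear_smult)
  show "integrable lborel (\<lambda>x. (norm a)\<^sup>2 * (norm (f x))\<^sup>2)"
    using assms by (simp add: in_L2_def)
qed (simp add: norm_smult power_mult_distrib)

lemma in_L2_minus: "in_L2 f \<Longrightarrow> in_L2 (\<lambda>x. - f x)"
  by (simp add: in_L2_def)

lemma in_L2_diff: "in_L2 f \<Longrightarrow> in_L2 g \<Longrightarrow> in_L2 (\<lambda>x. f x - g x)"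
  using in_L2_add[OF _ in_L2_minus, of f g] by simp

lemma in_L2_scaleR: "in_L2 f \<Longrightarrow> in_L2 (\<lambda>x. r *\<^sub>R f x)"
  by (auto simp: in_L2_def power_mult_distrib)

lemma in_L2_indicator:
  assumes "in_L2 f" "S \<in> sets borel"
  shows "in_L2 (\<lambda>x. indicator S x *\<^sub>R f x)"
  by (rule in_L2_bound[OF _ in_L2_integrable[OF assms(1)]])
     (use assms in \<open>auto simp: in_L2_def indicator_def\<close>)

lemma in_L2_CcK: 
  assumes "CcK k f"
  shows "in_L2 f"
proof -
  obtain B where B: "B > 0" "\<And>x. norm (f x) \<le> B" using CcK_bounded[OF assms] by blast
  have "integrable lborel (\<lambda>x. B * norm (f x))"
    by (intro integrable_mult_right integrable_norm CcK_integrable[OF assms])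
  from in_L2_bound[OF CcK_measurable[OF assms] this] show ?thesis
    using B(2) by (simp add: power2_eq_square mult_right_mono)
qed

lemma L2_norm_nonneg: "L2_norm f \<ge> 0"
  by (simp add: L2_norm_def integral_nonneg_AE)

lemma L2_norm_sq: "(L2_norm f)\<^sup>2 = (LINT x|lborel. (norm (f x))\<^sup>2)"
  by (simp add: L2_norm_def integral_nonneg_AE)

lemma L2_norm_minus_commute: "L2_norm (\<lambda>x. f x - g x) = L2_norm (\<lambda>x. g x - f x)"
  by (simp add: L2_norm_def norm_minus_commute)

lemma L2_norm_scaleR: "L2_norm (\<lambda>x. r *\<^sub>R f x) = \<bar>r\<bar> * L2_norm f"
  by (simp add: L2_norm_def power_mult_distrib real_sqrt_mult)

lemma L2_norm_mono:
  assumes "in_L2 f" "in_L2 g" "\<And>x. norm (f x) \<le> norm (g x)"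
  shows "L2_norm f \<le> L2_norm g"
  unfolding L2_norm_def
  using assms by (intro real_sqrt_le_mono integral_mono in_L2_integrable power_mono) auto

lemma L2_norm_cong_AE:
  assumes "in_L2 f" "in_L2 g" "AE x in lborel. f x = g x"
  shows "L2_norm f = L2_norm g"
proof -
  note [measurable] = in_L2_measurable[OF assms(1)] in_L2_measurable[OF assms(2)]
  have "(LINT x|lborel. (norm (f x))\<^sup>2) = (LINT x|lborel. (norm (g x))\<^sup>2)"
    by (rule integral_cong_AE) (use assms(3) in auto)
  then show ?thesis by (simp add: L2_norm_def)
qed

lemma L2_norm_eq_0D:
  assumes "in_L2 f" "L2_norm f = 0"
  shows "AE x in lborel. f x = 0"
proof -
  have "(LINT x|lborel. (norm (f x))\<^sup>2) = 0" using assms(2) L2_norm_sq[of f] by simp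
  then have "AE x in lborel. (norm (f x))\<^sup>2 = 0"
    using integral_nonneg_eq_0_iff_AE[OF in_L2_integrable[OF assms(1)]] by simp
  then show ?thesis by simp
qed

text \<open>Integrate $|u + v|^2 \le (1 + \lambda) |u|^2 + (1 + 1/\lambda) |v|^2$ with the optimal $\lambda$.\<close>

lemma L2_norm_triangle:
  assumes f: "in_L2 f" and g: "in_L2 g"
  shows "L2_norm (\<lambda>x. f x + g x) \<le> L2_norm f + L2_norm g"
proof (rule field_le_epsilon)
  fix e :: real assume e: "e > 0"
  \<comment> \<open>The offset keeps a and b positive, so that \<open>\<lambda>\<close> = b / a is
    defined even when a norm vanishes.\<close>
  define a where "a = L2_norm f + e / 2"
  define b where "b = L2_norm g + e / 2"
  have ab: "a > 0" "b > 0" using e L2_norm_nonneg[of f] L2_norm_nonneg[of g] by (auto simp: a_def b_def)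
  have fa: "(LINT x|lborel. (norm (f x))\<^sup>2) \<le> a\<^sup>2" unfolding L2_norm_sq[symmetric] a_def
    using e L2_norm_nonneg[of f] by (intro power_mono) auto
  have gb: "(LINT x|lborel. (norm (g x))\<^sup>2) \<le> b\<^sup>2" unfolding L2_norm_sq[symmetric] b_def
    using e L2_norm_nonneg[of g] by (intro power_mono) auto
  have "(L2_norm (\<lambda>x. f x + g x))\<^sup>2 = (LINT x|lborel. (norm (f x + g x))\<^sup>2)" by (rule L2_norm_sq)
  also have "\<dots> \<le> (LINT x|lborel. (1 + b / a) * (norm (f x))\<^sup>2 + (1 + a / b) * (norm (g x))\<^sup>2)"
  proof (rule integral_mono)
    show "integrable lborel (\<lambda>x. (norm (f x + g x))\<^sup>2)" by (rule in_L2_integrable[OF in_L2_add[OF f g]])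
    show "integrable lborel (\<lambda>x. (1 + b / a) * (norm (f x))\<^sup>2 + (1 + a / b) * (norm (g x))\<^sup>2)"
      using in_L2_integrable[OF f] in_L2_integrable[OF g] by simp
    fix x
    let ?u = "norm (f x)" and ?v = "norm (g x)"
    have "(norm (f x + g x))\<^sup>2 \<le> (?u + ?v)\<^sup>2" by (intro power_mono norm_triangle_ineq norm_ge_zero)
    also have "\<dots> \<le> (?u + ?v)\<^sup>2 + (b * ?u - a * ?v)\<^sup>2 / (a * b)" using ab by simp
    also have "\<dots> = (1 + b / a) * ?u\<^sup>2 + (1 + a / b) * ?v\<^sup>2"
      using ab by (simp add: field_simps power2_eq_square)
    finally show "(norm (f x + g x))\<^sup>2 \<le> (1 + b / a) * ?u\<^sup>2 + (1 + a / b) * ?v\<^sup>2" .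
  qed
  also have "\<dots> = (1 + b / a) * (LINT x|lborel. (norm (f x))\<^sup>2) + (1 + a / b) * (LINT x|lborel. (norm (g x))\<^sup>2)"
    using in_L2_integrable[OF f] in_L2_integrable[OF g] by simp
  also have "\<dots> \<le> (1 + b / a) * a\<^sup>2 + (1 + a / b) * b\<^sup>2"
    using ab by (intro add_mono mult_left_mono fa gb) auto
  also have "\<dots> = (a + b)\<^sup>2" using ab by (simp add: field_simps power2_eq_square)
  finally have "L2_norm (\<lambda>x. f x + g x) \<le> a + b" 
    by (rule power2_le_imp_le) (use ab in linarith)
  then show "L2_norm (\<lambda>x. f x + g x) \<le> L2_norm f + L2_norm g + e" by (simp add: a_def b_def)
qed

lemma L2_norm_triangle_diff:
  assumes "in_L2 f" "in_L2 g" "in_L2 h"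
  shows "L2_norm (\<lambda>x. f x - h x) \<le> L2_norm (\<lambda>x. f x - g x) + L2_norm (\<lambda>x. g x - h x)"
  using L2_norm_triangle[OF in_L2_diff[OF assms(1,2)] in_L2_diff[OF assms(2,3)]] by simp

lemma L2_inner_integrable:
  assumes f: "in_L2 f" and g: "in_L2 g"
  shows "integrable lborel (\<lambda>x. f x \<bullet> g x)"
proof (rule Bochner_Integration.integrable_bound)
  note [measurable] = in_L2_measurable[OF f] in_L2_measurable[OF g]
  show "integrable lborel (\<lambda>x. (norm (f x))\<^sup>2 + (norm (g x))\<^sup>2)"
    using in_L2_integrable[OF f] in_L2_integrable[OF g] by simp
  show "(\<lambda>x. f x \<bullet> g x) \<in> borel_measurable lborel" by measurable
  have "\<bar>f x \<bullet> g x\<bar> \<le> (norm (f x))\<^sup>2 + (norm (g x))\<^sup>2" for x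
    using Cauchy_Schwarz_ineq2[of "f x" "g x"] zero_le_power2[of "norm (f x) - norm (g x)"]
      mult_nonneg_nonneg[OF norm_ge_zero[of "f x"] norm_ge_zero[of "g x"]]
    unfolding power2_diff by linarith
  then show "AE x in lborel. norm (f x \<bullet> g x) \<le> norm ((norm (f x))\<^sup>2 + (norm (g x))\<^sup>2)"
    by (intro AE_I2) simp
qed

text \<open>Integrates u v \<le> (b / 2a) u^2 + (a / 2b) v^2 with a, b the norms, enlarged by e to
  exclude division by zero; then e tends to 0.\<close>

lemma L2_Cauchy_Schwarz:
  assumes f: "in_L2 f" and g: "in_L2 g"
  shows "\<bar>LINT x|lborel. f x \<bullet> g x\<bar> \<le> L2_norm f * L2_norm g"
proof -
  let ?I = "\<bar>LINT x|lborel. f x \<bullet> g x\<bar>"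
  have "?I \<le> (L2_norm f + e) * (L2_norm g + e)" if e: "e > 0" for e
  proof -
    define a where "a = L2_norm f + e"
    define b where "b = L2_norm g + e"
    have ab: "a > 0" "b > 0" using e L2_norm_nonneg[of f] L2_norm_nonneg[of g] by (auto simp: a_def b_def)
    have fa: "(LINT x|lborel. (norm (f x))\<^sup>2) \<le> a\<^sup>2" unfolding L2_norm_sq[symmetric] a_def
      using e L2_norm_nonneg[of f] by (intro power_mono) auto
    have gb: "(LINT x|lborel. (norm (g x))\<^sup>2) \<le> b\<^sup>2" unfolding L2_norm_sq[symmetric] b_def
      using e L2_norm_nonneg[of g] by (intro power_mono) auto
    have "?I \<le> (LINT x|lborel. \<bar>f x \<bullet> g x\<bar>)" by (rule integral_abs_bound)
    also have "\<dots> \<le> (LINT x|lborel. b / (2 * a) * (norm (f x))\<^sup>2 + a / (2 * b) * (norm (g x))\<^sup>2)"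
    proof (rule integral_mono)
      show "integrable lborel (\<lambda>x. \<bar>f x \<bullet> g x\<bar>)" using L2_inner_integrable[OF f g] by simp
      show "integrable lborel (\<lambda>x. b / (2 * a) * (norm (f x))\<^sup>2 + a / (2 * b) * (norm (g x))\<^sup>2)"
        using in_L2_integrable[OF f] in_L2_integrable[OF g] by simp
      fix x
      let ?u = "norm (f x)" and ?v = "norm (g x)"
      have "\<bar>f x \<bullet> g x\<bar> \<le> ?u * ?v" by (rule Cauchy_Schwarz_ineq2)
      also have "\<dots> \<le> ?u * ?v + (b * ?u - a * ?v)\<^sup>2 / (2 * a * b)" using ab by simp
      also have "\<dots> = b / (2 * a) * ?u\<^sup>2 + a / (2 * b) * ?v\<^sup>2"
        using ab by (simp add: field_simps power2_eq_square)
      finally show "\<bar>f x \<bullet> g x\<bar> \<le> b / (2 * a) * ?u\<^sup>2 + a / (2 * b) * ?v\<^sup>2" .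
    qed
    also have "\<dots> = b / (2 * a) * (LINT x|lborel. (norm (f x))\<^sup>2) + a / (2 * b) * (LINT x|lborel. (norm (g x))\<^sup>2)"
      using in_L2_integrable[OF f] in_L2_integrable[OF g] by simp
    also have "\<dots> \<le> b / (2 * a) * a\<^sup>2 + a / (2 * b) * b\<^sup>2"
      using ab by (intro add_mono mult_left_mono fa gb) auto
    also have "\<dots> = a * b" using ab by (simp add: field_simps power2_eq_square)
    finally show ?thesis by (simp add: a_def b_def)
  qed
  moreover have "((\<lambda>e. (L2_norm f + e) * (L2_norm g + e)) \<longlongrightarrow> (L2_norm f + 0) * (L2_norm g + 0)) (at_right 0)"
    by (intro tendsto_intros)
  ultimately have "?I \<le> (L2_norm f + 0) * (L2_norm g + 0)"
    by (intro tendsto_lowerbound[where F = "at_right (0::real)"])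
       (auto intro: eventually_mono[OF eventually_at_right_less[of 0]])
  then show ?thesis by simp
qed

section \<open>Inverse Fourier transforms of compactly supported functions\<close>

text \<open>\<open>G\<close> is the unitarily normalised version of the inverse Fourier integral \<open>IF\<close>.\<close>

definition G :: "spinor_field \<Rightarrow> spinor_field" where
  "G \<phi> x = ((2 * pi) powr (- 3 / 2)) *\<^sub>R (\<chi> i. IF (\<lambda>p. \<phi> p $ i) x)"

lemma two_pi_powr: "((2 * pi) powr (- 3 / 2)) * ((2 * pi) powr (- 3 / 2)) * (2 * pi) ^ 3 = 1"
proof -
  have "((2 * pi) powr (- 3 / 2)) * ((2 * pi) powr (- 3 / 2)) = (2 * pi) powr (- 3)"
    by (simp add: powr_add[symmetric])
  moreover have "(2 * pi) ^ 3 = (2 * pi) powr 3" by (subst powr_realpow[symmetric]) auto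
  ultimately have "((2 * pi) powr (- 3 / 2)) * ((2 * pi) powr (- 3 / 2)) * (2 * pi) ^ 3 = (2 * pi) powr (- 3 + 3)"
    unfolding powr_add by (simp only:)
  then show ?thesis by simp
qed

lemma G_nth: "G \<phi> x $ i = complex_of_real ((2 * pi) powr (- 3 / 2)) * IF (\<lambda>p. \<phi> p $ i) x"
  unfolding G_def vector_scaleR_component vec_lambda_beta by (rule scaleR_conv_of_real)

lemma IF_cmult: "IF (\<lambda>p. c * g p) x = c * IF g x"
  by (simp add: IF_def mult.left_commute[of _ c])

lemma IF_cnj: "cnj (IF g x) = IF (\<lambda>p. cnj (g p)) (- x)"
proof -
  have "cnj (exp (\<i> * complex_of_real (p \<bullet> x)) * g p) = exp (\<i> * complex_of_real (p \<bullet> - x)) * cnj (g p)" for p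
    by (simp add: exp_cnj)
  then show ?thesis by (simp only: IF_def Bochner_Integration.integral_cnj[symmetric])
qed

lemma CcK_vec_nth: "CcK k \<phi> \<Longrightarrow> CcK k (\<lambda>p. \<phi> p $ i)"
  by (rule CcK_compose_bounded_linear[OF bounded_linear_vec_nth])

lemma IF_eq_osc: "IF g = osc m 0 g"
  by (simp add: fun_eq_iff IF_def osc_def)

text \<open>At t = 0 every x satisfies the cone condition, so the estimate becomes decay everywhere.
  The mass has left the phase and is set to 1.\<close>

lemma IF_decay:
  assumes "CcK N g"
  obtains C where "C \<ge> 0" "\<And>x. norm (IF g x) \<le> C * inverse ((1 + norm x) ^ N)"
proof -
  obtain C where "\<forall>t x. \<bar>t\<bar> \<le> norm x \<longrightarrow> norm (osc 1 t g x) * (1 + norm x) ^ N \<le> C"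
    using osc_decay[OF zero_less_one assms] by blast
  then have C: "norm (IF g x) * (1 + norm x) ^ N \<le> C" for x
    using IF_eq_osc[of g 1] by simp
  show thesis
  proof
    show "C \<ge> 0" using order_trans[OF mult_nonneg_nonneg C[of 0]] by simp
    show "norm (IF g x) \<le> C * inverse ((1 + norm x) ^ N)" for x
      using C[of x] by (simp add: field_simps add_pos_nonneg)
  qed
qed

lemma integrable_decay:
  fixes f :: "'a::euclidean_space \<Rightarrow> 'b::{banach, second_countable_topology}"
  assumes [measurable]: "f \<in> borel_measurable borel"
    and "\<And>x. norm (f x) \<le> C * inverse ((1 + norm x) ^ (2 * DIM('a)))"
  shows "integrable lborel f"
proof (rule Bochner_Integration.integrable_bound)
  show "integrable lborel (\<lambda>x::'a. C * inverse ((1 + norm x) ^ (2 * DIM('a))))"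
    by (intro integrable_mult_right integrable_inverse_norm_power)
  show "AE x in lborel. norm (f x) \<le> norm (C * inverse ((1 + norm x) ^ (2 * DIM('a))))"
    unfolding real_norm_def using order_trans[OF assms(2) abs_ge_self] by (intro AE_I2)
qed simp

lemma integrable_IF:
  fixes g :: "'a::euclidean_space \<Rightarrow> complex"
  assumes "CcK (2 * DIM('a)) g"
  shows "integrable lborel (IF g)"
proof -
  obtain C where "\<And>x. norm (IF g x) \<le> C * inverse ((1 + norm x) ^ (2 * DIM('a)))"
    using IF_decay[OF assms] by blast
  then show ?thesis using CcK_measurable[OF assms] by (intro integrable_decay IF_measurable)
qed

lemma integrable_vec_nth:
  fixes f :: "'a::euclidean_space \<Rightarrow> complex ^ 'n"
  shows "integrable lborel f \<longleftrightarrow> (\<forall>i. integrable lborel (\<lambda>x. f x $ i))"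
proof
  assume "integrable lborel f"
  then show "\<forall>i. integrable lborel (\<lambda>x. f x $ i)"
    by (intro allI integrable_bounded_linear[OF bounded_linear_vec_nth])
next
  assume *: "\<forall>i. integrable lborel (\<lambda>x. f x $ i)"
  have "f = (\<lambda>x. \<Sum>i\<in>UNIV. axis i (f x $ i))"
    by (simp add: fun_eq_iff vec_eq_iff axis_def sum.delta)
  moreover have "integrable lborel (\<lambda>x. \<Sum>i\<in>UNIV. axis i (f x $ i))"
    using * by (intro Bochner_Integration.integrable_sum integrable_bounded_linear[OF bounded_linear_axis]) simp
  ultimately show "integrable lborel f" by simp
qed

lemma fourier_integral_nth:
  assumes "integrable lborel f"
  shows "fourier_integral f p $ i = ((2 * pi) powr (- 3 / 2)) *\<^sub>R IF (\<lambda>x. f x $ i) (- p)"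
proof -
  have fi: "integrable lborel (\<lambda>x. f x $ i)" for i
    using assms unfolding integrable_vec_nth by simp
  have "integrable lborel (\<lambda>x. exp (- \<i> * complex_of_real (p \<bullet> x)) *s f x)"
    unfolding integrable_vec_nth
  proof
    fix i
    have "integrable lborel (\<lambda>x. exp (- \<i> * complex_of_real (p \<bullet> x)) * f x $ i)"
      by (rule Bochner_Integration.integrable_bound[OF fi[of i]])
         (use fi[of i] in \<open>auto simp: norm_mult\<close>)
    then show "integrable lborel (\<lambda>x. (exp (- \<i> * complex_of_real (p \<bullet> x)) *s f x) $ i)" by simp
  qed
  from integral_bounded_linear[OF bounded_linear_vec_nth this, of i]
  have "(LINT x|lborel. exp (- \<i> * complex_of_real (p \<bullet> x)) *s f x) $ i
     = (LINT x|lborel. exp (- \<i> * complex_of_real (p \<bullet> x)) * f x $ i)" by simp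
  then show ?thesis by (simp add: fourier_integral_def IF_def inner_commute)
qed

text \<open>Six derivatives give decay with exponent twice the dimension of R^3.\<close>

lemma integrable_G:
  assumes "CcK 6 \<phi>"
  shows "integrable lborel (G \<phi>)"
  unfolding integrable_vec_nth using integrable_IF[where g = "\<lambda>p. \<phi> p $ i" for i] CcK_vec_nth[OF assms]
  by (simp add: G_def)

lemma G_bounded:
  assumes "CcK 0 \<phi>"
  obtains B where "\<And>x. norm (G \<phi> x) \<le> B"
proof
  fix x
  have "norm (G \<phi> x) \<le> (2 * pi) powr (- 3 / 2) * (\<Sum>i\<in>UNIV. norm (IF (\<lambda>p. \<phi> p $ i) x))"
  proof -
    have "norm (\<chi> i. IF (\<lambda>p. \<phi> p $ i) x) \<le> (\<Sum>i\<in>UNIV. norm (IF (\<lambda>p. \<phi> p $ i) x))"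
      unfolding norm_vec_def by (rule order_trans[OF L2_set_le_sum]) simp_all
    then show ?thesis by (simp add: G_def)
  qed
  also have "\<dots> \<le> (2 * pi) powr (- 3 / 2) * (\<Sum>i\<in>UNIV. (LINT p|lborel. norm (\<phi> p $ i)))"
    by (intro mult_left_mono sum_mono IF_bound) simp
  finally show "norm (G \<phi> x) \<le> (2 * pi) powr (- 3 / 2) * (\<Sum>i\<in>UNIV. (LINT p|lborel. norm (\<phi> p $ i)))" .
qed

lemma in_L2_G:
  assumes "CcK 6 \<phi>"
  shows "in_L2 (G \<phi>)"
proof -
  obtain B where B: "\<And>x. norm (G \<phi> x) \<le> B" using G_bounded[OF CcK_mono[OF assms]] by blast
  have "integrable lborel (\<lambda>x. B * norm (G \<phi> x))"
    by (intro integrable_mult_right integrable_norm integrable_G[OF assms])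
  from in_L2_bound[OF borel_measurable_integrable[OF integrable_G[OF assms], simplified] this] show ?thesis
    using B by (simp add: power2_eq_square mult_right_mono)
qed

lemma fourier_integral_G:
  assumes "CcK 6 \<phi>"
  shows "fourier_integral (G \<phi>) = \<phi>"
proof
  fix p
  have "fourier_integral (G \<phi>) p $ i = \<phi> p $ i" for i
  proof -
    have \<phi>: "CcK 6 (\<lambda>p. \<phi> p $ i)" by (rule CcK_vec_nth[OF assms])
    have "IF (\<lambda>x. G \<phi> x $ i) (- p) = complex_of_real ((2 * pi) powr (- 3 / 2)) * IF (IF (\<lambda>p. \<phi> p $ i)) (- p)"
      by (simp only: G_nth IF_cmult)
    also have "IF (IF (\<lambda>p. \<phi> p $ i)) (- p) = complex_of_real ((2 * pi) ^ 3) * \<phi> p $ i"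
      using Fourier_inversion[OF CcK_mono[OF \<phi>] integrable_IF] \<phi> by simp
    finally have "fourier_integral (G \<phi>) p $ i = complex_of_real (((2 * pi) powr (- 3 / 2)) * ((2 * pi) powr (- 3 / 2)) * (2 * pi) ^ 3) * \<phi> p $ i"
      by (simp only: fourier_integral_nth[OF integrable_G[OF assms]] scaleR_conv_of_real of_real_mult mult.assoc)
    then show ?thesis by (simp only: two_pi_powr) simp
  qed
  then show "fourier_integral (G \<phi>) p = \<phi> p" by (simp add: vec_eq_iff)
qed

lemma inner_vec_complex: "(u :: complex ^ 'n) \<bullet> v = (\<Sum>i\<in>UNIV. Re (u $ i * cnj (v $ i)))"
  by (simp add: inner_vec_def inner_complex_def)

text \<open>Parseval as duality. Only integrability of \<open>w\<close> is assumed, so it applies to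
  the approximating sequences of \<open>has_fourier\<close>; with \<open>w\<close> =
  \<open>G \<phi>\<close> it gives the isometry \<open>L2_norm_G\<close>. The inner product is the
  real part of the Hermitian one, hence the conjugates.\<close>

lemma fourier_integral_adjoint:
  assumes w: "integrable lborel w" and \<phi>: "CcK 6 \<phi>"
  shows "(LINT x|lborel. w x \<bullet> G \<phi> x) = (LINT p|lborel. fourier_integral w p \<bullet> \<phi> p)"
proof -
  let ?c = "(2 * pi) powr (- 3 / 2)"
  have wi: "integrable lborel (\<lambda>x. w x $ i)" for i using w unfolding integrable_vec_nth by simp
  have \<phi>i: "CcK 6 (\<lambda>p. cnj (\<phi> p $ i))" for i
    by (rule CcK_compose_bounded_linear[OF bounded_linear_cnj CcK_vec_nth[OF \<phi>]])
  note \<phi>int = CcK_integrable[OF \<phi>i]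
  have cG: "cnj (G \<phi> x $ i) = ?c *\<^sub>R IF (\<lambda>p. cnj (\<phi> p $ i)) (- x)" for x i
    by (simp only: G_nth complex_cnj_mult complex_cnj_complex_of_real IF_cnj scaleR_conv_of_real)
  have 1: "(LINT x|lborel. w x $ i * cnj (G \<phi> x $ i)) = (LINT p|lborel. fourier_integral w p $ i * cnj (\<phi> p $ i))" for i
  proof -
    have "(LINT x|lborel. w x $ i * (LINT p|lborel. exp (\<i> * complex_of_real (p \<bullet> (- x))) * cnj (\<phi> p $ i)))
      = (LINT p|lborel. (LINT x|lborel. exp (\<i> * complex_of_real (p \<bullet> (- x))) * w x $ i) * cnj (\<phi> p $ i))"
      by (rule Fubini_exchange[OF wi \<phi>int]) (auto intro!: borel_measurable_continuous_onI continuous_intros)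
    then have "(LINT x|lborel. w x $ i * IF (\<lambda>p. cnj (\<phi> p $ i)) (- x)) = (LINT p|lborel. IF (\<lambda>x. w x $ i) (- p) * cnj (\<phi> p $ i))"
      by (simp add: IF_def inner_commute)
    then show ?thesis by (simp add: cG fourier_integral_nth[OF w])
  qed
  have int1: "integrable lborel (\<lambda>x. w x $ i * cnj (G \<phi> x $ i))" for i
  proof -
    obtain B where B: "\<And>x. norm (G \<phi> x) \<le> B" using G_bounded[OF CcK_mono[OF \<phi>]] by blast
    have "integrable lborel (\<lambda>x. G \<phi> x $ i)"
      using integrable_G[OF \<phi>] unfolding integrable_vec_nth by simp
    note [measurable] = borel_measurable_integrable[OF this, simplified]
      borel_measurable_integrable[OF wi, simplified]
    have [measurable]: "cnj \<in> borel_measurable borel"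
      by (intro borel_measurable_continuous_onI continuous_intros)
    have "norm (w x $ i * cnj (G \<phi> x $ i)) \<le> norm (B * norm (w x $ i))" for x
      using mult_right_mono[OF order_trans[OF Finite_Cartesian_Product.norm_nth_le[of "G \<phi> x" i] B], of "norm (w x $ i)"]
      by (simp add: norm_mult mult.commute order_trans[OF _ abs_ge_self])
    then show ?thesis
      by (intro Bochner_Integration.integrable_bound[OF integrable_mult_right[OF integrable_norm[OF wi[of i]], of B]]) auto
  qed
  have int2: "integrable lborel (\<lambda>p. fourier_integral w p $ i * cnj (\<phi> p $ i))" for i
  proof -
    let ?B = "?c * (LINT x|lborel. norm (w x $ i))"
    note [measurable] = CcK_measurable[OF CcK_vec_nth[OF \<phi>]]
    have [measurable]: "cnj \<in> borel_measurable borel"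
      by (intro borel_measurable_continuous_onI continuous_intros)
    have [measurable]: "(\<lambda>p. fourier_integral w p $ i) \<in> borel_measurable borel"
      unfolding fourier_integral_nth[OF w]
      using measurable_compose[OF borel_measurable_uminus[OF measurable_ident] IF_measurable[of "\<lambda>x. w x $ i"]] wi[of i] by simp
    have "norm (fourier_integral w p $ i * cnj (\<phi> p $ i)) \<le> norm (?B * norm (cnj (\<phi> p $ i)))" for p
      unfolding fourier_integral_nth[OF w]
      using mult_right_mono[OF mult_left_mono[OF IF_bound[of "\<lambda>x. w x $ i" "- p"], of ?c], of "norm (\<phi> p $ i)"]
      by (simp add: norm_mult order_trans[OF _ abs_ge_self])
    then show ?thesis
      by (intro Bochner_Integration.integrable_bound[OF integrable_mult_right[OF integrable_norm[OF \<phi>int[of i]], of ?B]])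
         auto
  qed
  show ?thesis
    unfolding inner_vec_complex
    by (simp only: Bochner_Integration.integral_sum[OF integrable_Re[OF int1]]
        Bochner_Integration.integral_sum[OF integrable_Re[OF int2]] integral_Re[OF int1] integral_Re[OF int2] 1)
qed

lemma L2_norm_G:
  assumes "CcK 6 \<phi>"
  shows "L2_norm (G \<phi>) = L2_norm \<phi>"
proof -
  have "(LINT x|lborel. G \<phi> x \<bullet> G \<phi> x) = (LINT p|lborel. \<phi> p \<bullet> \<phi> p)"
    using fourier_integral_adjoint[OF integrable_G[OF assms] assms] by (simp add: fourier_integral_G[OF assms])
  then show ?thesis by (simp add: L2_norm_def power2_norm_eq_inner)
qed

lemma G_diff:
  assumes "CcK 0 \<phi>" "CcK 0 \<xi>"
  shows "G (\<lambda>p. \<phi> p - \<xi> p) x = G \<phi> x - G \<xi> x"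
proof -
  have "IF (\<lambda>p. \<phi> p $ i - \<xi> p $ i) x = IF (\<lambda>p. \<phi> p $ i) x - IF (\<lambda>p. \<xi> p $ i) x" for i
    using osc_integrable[OF zero_less_one CcK_vec_nth[OF assms(1), of i], of x 0]
      osc_integrable[OF zero_less_one CcK_vec_nth[OF assms(2), of i], of x 0]
    by (simp add: IF_def right_diff_distrib)
  then show ?thesis by (simp add: G_def vec_eq_iff scaleR_diff_right)
qed

lemma G_smult: "G (\<lambda>p. a *s \<phi> p) x = a *s G \<phi> x"
  by (simp add: G_def vec_eq_iff IF_def mult.left_commute[of _ a])

text \<open>\<open>G \<phi>\<close> is itself integrable, so the approximating sequence may be
  constant.\<close>

lemma has_fourier_G:
  assumes "CcK 6 \<phi>"
  shows "has_fourier (G \<phi>) \<phi>"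
  unfolding has_fourier_def
  by (rule exI[of _ "\<lambda>_. G \<phi>"])
     (simp add: integrable_G[OF assms] L2_tendsto_def in_L2_G[OF assms] in_L2_CcK[OF assms]
        fourier_integral_G[OF assms] L2_norm_def)

section \<open>Density of the inverse Fourier transforms\<close>

lemma Ck_compose_linear:
  assumes "bounded_linear L"
  shows "Ck k f \<Longrightarrow> Ck k (\<lambda>x. f (L x))"
proof (induction k arbitrary: f)
  case 0
  then show ?case
    using continuous_on_compose2[of UNIV f UNIV L] linear_continuous_on[OF assms] by simp
next
  case (Suc k)
  obtain D where D: "\<And>x. (f has_derivative (\<lambda>v. D v x)) (at x)" "\<And>v. Ck k (D v)"
    using Ck_SucD[OF Suc.prems] by blast
  show ?case
  proof (rule Ck_SucI)
    show "((\<lambda>x. f (L x)) has_derivative (\<lambda>v. D (L v) (L x))) (at x)" for x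
      by (rule has_derivative_compose[OF bounded_linear_imp_has_derivative[OF assms] D(1)])
    show "Ck k (\<lambda>x. D (L v) (L x))" for v by (rule Suc.IH[OF D(2)])
  qed
qed

lemma IF_add:
  assumes "CcK 0 f" "CcK 0 g"
  shows "IF (\<lambda>p. f p + g p) x = IF f x + IF g x"
  using osc_add[OF zero_less_one assms] by (simp add: IF_eq_osc[of _ 1])

lemma CcK_inner_mult: "CcK k f \<Longrightarrow> CcK k (\<lambda>p. \<i> * complex_of_real (p \<bullet> v) * f p)"
  by (intro CcK_mult Ck_mult Ck_const Ck_of_real Ck_inner_const)

text \<open>Differentiation under the integral with an explicit remainder: |exp(i theta) - 1 - i
  theta| is at most theta^2 for theta = p . (y - x), and compact support makes |p|^2 |f|
  integrable.\<close>

lemma IF_has_derivative: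
  fixes f :: "'a::euclidean_space \<Rightarrow> complex"
  assumes f: "CcK 0 f"
  shows "(IF f has_derivative (\<lambda>v. IF (\<lambda>p. \<i> * complex_of_real (p \<bullet> v) * f p) x)) (at x)"
proof (rule has_derivativeI_sandwich[of 1])
  let ?D = "\<lambda>v. IF (\<lambda>p. \<i> * complex_of_real (p \<bullet> v) * f p) x"
  have nf: "CcK 0 (\<lambda>p. norm p *\<^sub>R f p)"
    using f unfolding CcK_def by (auto intro!: continuous_intros)
  show "bounded_linear ?D"
  proof (rule bounded_linear_intro)
    show "?D (u + v) = ?D u + ?D v" for u v
      using IF_add[OF CcK_inner_mult[OF f, of u] CcK_inner_mult[OF f, of v], of x]
      by (simp add: inner_add_right distrib_left distrib_right)
    show "?D (r *\<^sub>R v) = r *\<^sub>R ?D v" for r v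
      using IF_cmult[of "complex_of_real r" "\<lambda>p. \<i> * complex_of_real (p \<bullet> v) * f p" x]
      by (simp add: scaleR_conv_of_real mult.left_commute mult.assoc)
    show "norm (?D v) \<le> norm v * (LINT p|lborel. norm (norm p *\<^sub>R f p))" for v
    proof -
      have "norm (?D v) \<le> (LINT p|lborel. norm (\<i> * complex_of_real (p \<bullet> v) * f p))" by (rule IF_bound)
      also have "\<dots> \<le> (LINT p|lborel. norm v * norm (norm p *\<^sub>R f p))"
      proof (rule integral_mono)
        show "norm (\<i> * complex_of_real (p \<bullet> v) * f p) \<le> norm v * norm (norm p *\<^sub>R f p)" for p
          using mult_right_mono[OF Cauchy_Schwarz_ineq2[of p v], of "norm (f p)"]
          by (simp add: norm_mult mult_ac)
      qed (intro integrable_norm integrable_mult_right CcK_integrable[OF CcK_inner_mult[OF f]] CcK_integrable[OF nf])+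
      finally show ?thesis by simp
    qed
  qed
  let ?M = "LINT p|lborel. norm ((norm p)\<^sup>2 *\<^sub>R f p)"
  have nf2: "CcK 0 (\<lambda>p. (norm p)\<^sup>2 *\<^sub>R f p)"
    using f unfolding CcK_def by (auto intro!: continuous_intros)
  show "norm (IF f y - IF f x - ?D (y - x)) / norm (y - x) \<le> ?M * norm (y - x)" if "y \<noteq> x" for y
  proof -
    let ?r = "\<lambda>p. exp (\<i> * complex_of_real (p \<bullet> y)) * f p - exp (\<i> * complex_of_real (p \<bullet> x)) * f p
         - exp (\<i> * complex_of_real (p \<bullet> x)) * (\<i> * complex_of_real (p \<bullet> (y - x)) * f p)"
    have i: "integrable lborel (\<lambda>p. exp (\<i> * complex_of_real (p \<bullet> z)) * g p)" if "CcK 0 g" for z and g :: "'a \<Rightarrow> complex"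
      using osc_integrable[OF zero_less_one that, of z 0] by simp
    have ri: "integrable lborel ?r"
      by (intro Bochner_Integration.integrable_diff i f CcK_inner_mult)
    have eq: "IF f y - IF f x - ?D (y - x) = (LINT p|lborel. ?r p)"
      unfolding IF_def
      by (simp only: Bochner_Integration.integral_diff[OF i[OF f] i[OF f]]
          Bochner_Integration.integral_diff[OF Bochner_Integration.integrable_diff[OF i[OF f] i[OF f]] i[OF CcK_inner_mult[OF f]]])
    have "norm (LINT p|lborel. ?r p) \<le> (LINT p|lborel. norm (?r p))" by (rule integral_norm_bound)
    also have "\<dots> \<le> (LINT p|lborel. (norm (y - x))\<^sup>2 * norm ((norm p)\<^sup>2 *\<^sub>R f p))"
    proof (rule integral_mono)
      fix p
      let ?\<theta> = "p \<bullet> (y - x)"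
      have E: "exp (\<i> * complex_of_real (p \<bullet> y)) = exp (\<i> * complex_of_real (p \<bullet> x)) * iexp ?\<theta>"
      proof -
        have "\<i> * complex_of_real (p \<bullet> y) = \<i> * complex_of_real (p \<bullet> x) + \<i> * complex_of_real ?\<theta>"
          by (simp add: inner_diff_right right_diff_distrib)
        then show ?thesis by (simp only: exp_add)
      qed
      have alg: "a * b * f p - a * f p - a * (c * f p) = a * (b - (1 + c)) * f p" for a b c
        by (simp add: algebra_simps)
      have "?r p = exp (\<i> * complex_of_real (p \<bullet> x)) * (iexp ?\<theta> - (1 + \<i> * complex_of_real ?\<theta>)) * f p"
        unfolding E by (rule alg)
      then have "norm (?r p) = norm (iexp ?\<theta> - (1 + \<i> * complex_of_real ?\<theta>)) * norm (f p)"
        by (simp add: norm_mult)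
      also have "\<dots> \<le> (norm p * norm (y - x))\<^sup>2 * norm (f p)"
      proof (rule mult_right_mono)
        have "norm (iexp ?\<theta> - (1 + \<i> * complex_of_real ?\<theta>)) \<le> \<bar>?\<theta>\<bar>\<^sup>2 / 2"
          using iexp_approx1[of ?\<theta> 1] by (simp add: power2_eq_square)
        also have "\<dots> \<le> \<bar>?\<theta>\<bar>\<^sup>2" by simp
        also have "\<dots> \<le> (norm p * norm (y - x))\<^sup>2"
          by (intro power_mono Cauchy_Schwarz_ineq2) simp
        finally show "norm (iexp ?\<theta> - (1 + \<i> * complex_of_real ?\<theta>)) \<le> (norm p * norm (y - x))\<^sup>2" .
      qed simp
      finally show "norm (?r p) \<le> (norm (y - x))\<^sup>2 * norm ((norm p)\<^sup>2 *\<^sub>R f p)"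
        by (simp add: mult_right_mono power_mult_distrib mult_ac)
    qed (intro integrable_norm integrable_mult_right ri CcK_integrable[OF nf2])+
    finally have "norm (IF f y - IF f x - ?D (y - x)) \<le> (norm (y - x))\<^sup>2 * ?M"
      unfolding eq by simp
    then show ?thesis using that by (simp add: divide_le_eq power2_eq_square mult_ac)
  qed
  show "((\<lambda>y. ?M * norm (y - x)) \<longlongrightarrow> 0) (at x)"
    by (rule tendsto_eq_intros refl tendsto_ident_at)+ simp
qed auto

text \<open>A derivative of \<open>IF f\<close> is \<open>IF\<close> of i (p . v) f, again
  continuous with compact support; so a merely continuous f yields every order of
  smoothness.\<close>

lemma Ck_IF: "CcK 0 f \<Longrightarrow> Ck k (IF f)"
proof (induction k arbitrary: f)
  case 0
  then show ?case
    using has_derivative_continuous[OF IF_has_derivative[OF 0]]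
    by (simp add: continuous_at_imp_continuous_on)
next
  case (Suc k)
  show ?case
    by (rule Ck_SucI[OF IF_has_derivative[OF Suc.prems] Suc.IH[OF CcK_inner_mult[OF Suc.prems]]])
qed

section \<open>Mollification by a cutoff in Fourier space\<close>

definition bump :: "nat \<Rightarrow> 'a::euclidean_space \<Rightarrow> complex" where
  "bump k p = complex_of_real (max 0 (1 - p \<bullet> p) ^ Suc k)"

lemma Ck_bump: "Ck k (bump k)"
  unfolding bump_def[abs_def] by (intro Ck_of_real Ck_power_max Ck_diff Ck_const Ck_inner_self)

lemma bump_support: "norm p > 1 \<Longrightarrow> bump k p = 0"
  using power_strict_mono[of 1 "norm p" 2] by (simp add: bump_def power2_norm_eq_inner)

lemma CcK_bump: "CcK k (bump k)"
  unfolding CcK_def using Ck_bump bump_support by blast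

lemma bump_0: "bump k 0 = 1"
  by (simp add: bump_def)

text \<open>A function on the Fourier side: the transform of f cut off at |p| =
  1/\<open>\<epsilon>\<close>, with the inversion constant. Its \<open>IF\<close> is the
  mollification of f, which is thereby exhibited as the transform of a compactly supported
  function.\<close>

definition mollified :: "nat \<Rightarrow> ('a::euclidean_space \<Rightarrow> complex) \<Rightarrow> real \<Rightarrow> 'a \<Rightarrow> complex" where
  "mollified k f \<epsilon> p = complex_of_real (1 / (2 * pi) ^ DIM('a)) * (IF f (- p) * bump k (\<epsilon> *\<^sub>R p))"

text \<open>The kernel is not claimed to be nonnegative or compactly supported; integral 1 and
  polynomial decay are what convergence uses.\<close>

definition mollifier :: "nat \<Rightarrow> 'a::euclidean_space \<Rightarrow> complex" where
  "mollifier k z = complex_of_real (1 / (2 * pi) ^ DIM('a)) * IF (bump k) z"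

lemma CcK_bump_scaled:
  assumes "\<epsilon> > 0"
  shows "CcK k (\<lambda>p. bump k (\<epsilon> *\<^sub>R p))"
  unfolding CcK_def
proof
  show "Ck k (\<lambda>p. bump k (\<epsilon> *\<^sub>R p))"
    by (rule Ck_compose_linear[OF bounded_linear_scaleR_right Ck_bump])
  show "\<exists>R. \<forall>p. R < norm p \<longrightarrow> bump k (\<epsilon> *\<^sub>R p) = 0"
    using assms by (intro exI[of _ "1 / \<epsilon>"]) (auto intro!: bump_support simp: field_simps)
qed

lemma CcK_mollified:
  assumes "CcK 0 f" "\<epsilon> > 0"
  shows "CcK k (mollified k f \<epsilon>)"
  unfolding mollified_def[abs_def]
  by (intro CcK_cmult CcK_mult CcK_bump_scaled assms
      Ck_compose_linear[OF bounded_linear_minus[OF bounded_linear_ident] Ck_IF])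

text \<open>The convolution formula: the product on the Fourier side becomes an average against the
  rescaled kernel, after the substitution y = x - \<open>\<epsilon>\<close> z.\<close>

lemma IF_mollified:
  fixes f :: "'a::euclidean_space \<Rightarrow> complex"
  assumes f: "CcK 0 f" and \<epsilon>: "\<epsilon> > 0"
  shows "IF (mollified k f \<epsilon>) x = (LINT z|lborel. f (x - \<epsilon> *\<^sub>R z) * mollifier k z)"
proof -
  let ?n = "DIM('a)"
  let ?c = "complex_of_real (1 / (2 * pi) ^ ?n)"
  note [measurable] = CcK_measurable[OF f] IF_measurable[OF CcK_measurable[OF CcK_bump]] CcK_measurable[OF CcK_bump]
  define g where "g p = ?c * bump k (\<epsilon> *\<^sub>R p)" for p :: 'a
  have g: "CcK k g" unfolding g_def[abs_def] by (intro CcK_cmult CcK_bump_scaled \<epsilon>)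
  have eq: "exp (\<i> * complex_of_real (p \<bullet> x)) * mollified k f \<epsilon> p
      = (LINT y|lborel. exp (\<i> * complex_of_real (p \<bullet> (x - y))) * f y) * g p" for p
  proof -
    have "exp (\<i> * complex_of_real (p \<bullet> x)) * IF f (- p)
       = (LINT y|lborel. exp (\<i> * complex_of_real (p \<bullet> x)) * (exp (\<i> * complex_of_real (y \<bullet> - p)) * f y))"
      unfolding IF_def by (rule integral_mult_right_zero[symmetric])
    also have "(\<lambda>y. exp (\<i> * complex_of_real (p \<bullet> x)) * (exp (\<i> * complex_of_real (y \<bullet> - p)) * f y))
       = (\<lambda>y. exp (\<i> * complex_of_real (p \<bullet> (x - y))) * f y)"
      by (simp only: mult.assoc[symmetric] exp_add[symmetric] distrib_left[symmetric]
          of_real_add[symmetric] inner_minus_right inner_diff_right inner_commute[of _ p] add_uminus_conv_diff)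
    finally have H: "exp (\<i> * complex_of_real (p \<bullet> x)) * IF f (- p)
       = (LINT y|lborel. exp (\<i> * complex_of_real (p \<bullet> (x - y))) * f y)" .
    show ?thesis unfolding mollified_def g_def H[symmetric] by (simp only: mult_ac)
  qed
  have gz: "IF g z = complex_of_real (inverse \<epsilon> ^ ?n) * mollifier k (inverse \<epsilon> *\<^sub>R z)" for z
  proof -
    have "IF g z = ?c * (LINT p|lborel. exp (\<i> * complex_of_real (p \<bullet> z)) * bump k (\<epsilon> *\<^sub>R p))"
      unfolding g_def IF_cmult by (simp add: IF_def)
    also have "(LINT p|lborel. exp (\<i> * complex_of_real (p \<bullet> z)) * bump k (\<epsilon> *\<^sub>R p))
      = inverse \<epsilon> ^ ?n *\<^sub>R (LINT p|lborel. exp (\<i> * complex_of_real ((inverse \<epsilon> *\<^sub>R p) \<bullet> z)) * bump k p)"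
      using \<epsilon> by (subst lborel_integral_affine[of _ "inverse \<epsilon>" 0]) auto
    also have "(LINT p|lborel. exp (\<i> * complex_of_real ((inverse \<epsilon> *\<^sub>R p) \<bullet> z)) * bump k p) = IF (bump k) (inverse \<epsilon> *\<^sub>R z)"
      by (simp add: IF_def)
    finally show ?thesis by (simp add: mollifier_def scaleR_conv_of_real)
  qed
  have "IF (mollified k f \<epsilon>) x = (LINT p|lborel. (LINT y|lborel. exp (\<i> * complex_of_real (p \<bullet> (x - y))) * f y) * g p)"
    unfolding IF_def[of "mollified k f \<epsilon>"] eq ..
  also have "\<dots> = (LINT y|lborel. f y * (LINT p|lborel. exp (\<i> * complex_of_real (p \<bullet> (x - y))) * g p))"
    by (rule Fubini_exchange[OF CcK_integrable[OF f] CcK_integrable[OF g], symmetric])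
       (auto intro!: borel_measurable_continuous_onI continuous_intros)
  also have "\<dots> = (LINT y|lborel. f y * (complex_of_real (inverse \<epsilon> ^ ?n) * mollifier k (inverse \<epsilon> *\<^sub>R (x - y))))"
    unfolding gz[symmetric] by (simp add: IF_def)
  also have "\<dots> = \<epsilon> ^ ?n *\<^sub>R (LINT z|lborel. f (x - \<epsilon> *\<^sub>R z) * (complex_of_real (inverse \<epsilon> ^ ?n) * mollifier k z))"
    using \<epsilon> unfolding mollifier_def by (subst lborel_integral_affine[of _ "- \<epsilon>" x]) auto
  also have "\<dots> = complex_of_real (\<epsilon> ^ ?n * inverse \<epsilon> ^ ?n) * (LINT z|lborel. f (x - \<epsilon> *\<^sub>R z) * mollifier k z)"
    by (simp add: scaleR_conv_of_real mult.left_commute[of _ "inverse (complex_of_real \<epsilon> ^ ?n)"] power_inverse)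
  also have "\<epsilon> ^ ?n * inverse \<epsilon> ^ ?n = 1"
    using \<epsilon> by (simp add: power_inverse)
  finally show ?thesis by simp
qed

text \<open>Inversion at the origin returns \<open>bump k 0\<close>, which is 1; the bound on k
  makes \<open>IF (bump k)\<close> integrable.\<close>

lemma mollifier_integral:
  assumes "k \<ge> 2 * DIM('a::euclidean_space)"
  shows "(LINT z::'a|lborel. mollifier k z) = 1"
proof -
  have "IF (IF (bump k)) (- (0::'a)) = complex_of_real ((2 * pi) ^ DIM('a)) * bump k (0::'a)"
    by (rule Fourier_inversion[OF CcK_mono[OF CcK_bump] integrable_IF[OF CcK_mono[OF CcK_bump assms]]]) simp
  then have "(LINT z::'a|lborel. IF (bump k) z) = complex_of_real ((2 * pi) ^ DIM('a))"
    by (simp add: IF_def[of "IF (bump k)"] bump_0)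
  moreover have "(LINT z::'a|lborel. mollifier k z) = complex_of_real (1 / (2 * pi) ^ DIM('a)) * (LINT z::'a|lborel. IF (bump k) z)"
    unfolding mollifier_def by (rule integral_mult_right_zero)
  ultimately show ?thesis by simp
qed

text \<open>Pointwise convergence is that of an approximate identity; convergence in L^2 needs a
  majorant independent of j. The kernel decays with exponent four times the dimension: half pays for
  decay in x, half for integrability in z. In R^3 this asks for 12 derivatives of the
  cutoff.\<close>

lemma IF_mollified_tendsto:
  fixes f :: "'a::euclidean_space \<Rightarrow> complex"
  assumes f: "CcK 0 f" and k: "k \<ge> 4 * DIM('a)"
    and e: "\<And>j::nat. 0 < e j" "\<And>j. e j \<le> 1" "e \<longlonglongrightarrow> 0"
  shows "(\<lambda>j. LINT x|lborel. (norm (f x - IF (mollified k f (e j)) x))\<^sup>2) \<longlonglongrightarrow> 0"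
proof -
  let ?n = "DIM('a)"
  note [measurable] = CcK_measurable[OF f] IF_measurable[OF CcK_measurable[OF CcK_bump]]
    IF_measurable[OF CcK_measurable[OF CcK_mollified[OF f e(1)]]]
  have [measurable]: "mollifier k \<in> borel_measurable borel" unfolding mollifier_def[abs_def] by measurable
  obtain B where B: "B > 0" "\<And>x. norm (f x) \<le> B" using CcK_bounded[OF f] by blast
  obtain R0 where R0: "\<And>x. R0 < norm x \<Longrightarrow> f x = 0" using f unfolding CcK_def by auto
  define R where "R = max 0 R0"
  have R: "R \<ge> 0" "\<And>x. R < norm x \<Longrightarrow> f x = 0" using R0 by (auto simp: R_def)
  obtain C0 where C0: "C0 \<ge> 0" "\<And>z::'a. norm (IF (bump k) z) \<le> C0 * inverse ((1 + norm z) ^ (4 * ?n))"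
    using IF_decay[OF CcK_mono[OF CcK_bump k]] by blast
  define C where "C = C0 / (2 * pi) ^ ?n"
  have C: "C \<ge> 0" using C0 by (simp add: C_def)
  have moll: "norm (mollifier k z) \<le> C * inverse ((1 + norm z) ^ (4 * ?n))" for z :: 'a
    using divide_right_mono[OF C0(2)[of z], of "(2 * pi) ^ ?n"]
    by (simp add: mollifier_def C_def norm_mult norm_divide norm_power field_simps)
  have intmoll: "integrable lborel (mollifier k :: 'a \<Rightarrow> complex)"
    unfolding mollifier_def[abs_def]
    by (intro integrable_mult_right integrable_IF CcK_mono[OF CcK_bump]) (use k in simp)
  define I where "I = (LINT z::'a|lborel. inverse ((1 + norm z) ^ (2 * ?n)))"
  define A where "A = B * (1 + R) ^ (2 * ?n) * C * I"
  have decay: "norm (IF (mollified k f (e j)) x) \<le> A * inverse ((1 + norm x) ^ (2 * ?n))" for j x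
  proof -
    have "norm (IF (mollified k f (e j)) x) \<le> (LINT z|lborel. norm (f (x - e j *\<^sub>R z) * mollifier k z))"
      unfolding IF_mollified[OF f e(1)] by (rule integral_norm_bound)
    also have "\<dots> \<le> (LINT z::'a|lborel. (B * (1 + R) ^ (2 * ?n) * C * inverse ((1 + norm x) ^ (2 * ?n))) * inverse ((1 + norm z) ^ (2 * ?n)))"
    proof (rule integral_mono)
      show "integrable lborel (\<lambda>z::'a. (B * (1 + R) ^ (2 * ?n) * C * inverse ((1 + norm x) ^ (2 * ?n))) * inverse ((1 + norm z) ^ (2 * ?n)))"
        by (intro integrable_mult_right integrable_inverse_norm_power)
      show "integrable lborel (\<lambda>z. norm (f (x - e j *\<^sub>R z) * mollifier k z))"
      proof (rule integrable_norm, rule Bochner_Integration.integrable_bound)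
        show "integrable lborel (\<lambda>z::'a. B * norm (mollifier k z))"
          by (intro integrable_mult_right integrable_norm intmoll)
        show "AE z in lborel. norm (f (x - e j *\<^sub>R z) * mollifier k z) \<le> norm (B * norm (mollifier k z))"
          using B by (auto simp: norm_mult intro!: mult_right_mono AE_I2)
      qed measurable
      fix z :: 'a
      show "norm (f (x - e j *\<^sub>R z) * mollifier k z)
        \<le> (B * (1 + R) ^ (2 * ?n) * C * inverse ((1 + norm x) ^ (2 * ?n))) * inverse ((1 + norm z) ^ (2 * ?n))"
      proof (cases "norm (x - e j *\<^sub>R z) \<le> R")
        case False
        then show ?thesis using R B C by simp
      next
        \<comment> \<open>Where f may be nonzero, |x| is at most R + |z| because \<open>e j\<close>
          \<le> 1; hence 1 + |x| is at most (1 + R)(1 + |z|), which trades decay in z for decay in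
          x.\<close>
        case True
        have "norm x \<le> norm (x - e j *\<^sub>R z) + norm (e j *\<^sub>R z)"
          using norm_triangle_ineq[of "x - e j *\<^sub>R z" "e j *\<^sub>R z"] by simp
        also have "\<dots> \<le> norm (x - e j *\<^sub>R z) + norm z"
          using e(1)[of j] e(2)[of j] by (simp add: mult_left_le_one_le)
        finally have "norm x \<le> R + norm z" using True by simp
        then have "1 + norm x \<le> 1 + R + norm z" by simp
        also have "\<dots> \<le> (1 + R) * (1 + norm z)" using R by (simp add: algebra_simps)
        finally have "(1 + norm x) ^ (2 * ?n) \<le> ((1 + R) * (1 + norm z)) ^ (2 * ?n)"
          by (intro power_mono) auto
        also have "\<dots> = (1 + R) ^ (2 * ?n) * (1 + norm z) ^ (2 * ?n)" by (rule power_mult_distrib)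
        finally have "(1 + norm x) ^ (2 * ?n) \<le> (1 + R) ^ (2 * ?n) * (1 + norm z) ^ (2 * ?n)" .
        moreover have "(1 + norm x) ^ (2 * ?n) > 0" by (simp add: add_pos_nonneg)
        ultimately have x: "1 \<le> (1 + R) ^ (2 * ?n) * (1 + norm z) ^ (2 * ?n) * inverse ((1 + norm x) ^ (2 * ?n))"
          by (simp only: divide_inverse[symmetric] le_divide_eq_1_pos)
        have "norm (f (x - e j *\<^sub>R z) * mollifier k z) \<le> B * (C * inverse ((1 + norm z) ^ (4 * ?n)))"
          unfolding norm_mult using B C by (intro mult_mono moll) auto
        also have "\<dots> \<le> B * (C * inverse ((1 + norm z) ^ (4 * ?n))) *
            ((1 + R) ^ (2 * ?n) * (1 + norm z) ^ (2 * ?n) * inverse ((1 + norm x) ^ (2 * ?n)))"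
          using mult_left_mono[OF x, of "B * (C * inverse ((1 + norm z) ^ (4 * ?n)))"] B C by simp
        also have "\<dots> = (B * (1 + R) ^ (2 * ?n) * C * inverse ((1 + norm x) ^ (2 * ?n))) *
            ((1 + norm z) ^ (2 * ?n) * inverse ((1 + norm z) ^ (4 * ?n)))"
          by (simp only: mult_ac)
        also have "(1 + norm z) ^ (2 * ?n) * inverse ((1 + norm z) ^ (4 * ?n)) = inverse ((1 + norm z) ^ (2 * ?n))"
        proof -
          have "(1 + norm z) ^ (4 * ?n) = (1 + norm z) ^ (2 * ?n) * (1 + norm z) ^ (2 * ?n)"
            by (simp add: power_add[symmetric])
          moreover have "(1 + norm z) ^ (2 * ?n) > 0"
            by (rule zero_less_power) (simp add: add_pos_nonneg)
          moreover have "b * inverse (b * b) = inverse b" if "b > 0" for b :: real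
            using that by (simp add: field_simps)
          ultimately show ?thesis by (simp only:)
        qed
        finally show ?thesis .
      qed
    qed
    also have "\<dots> = A * inverse ((1 + norm x) ^ (2 * ?n))" by (simp add: A_def I_def mult_ac)
    finally show ?thesis .
  qed
  have A: "A \<ge> 0"
    using order_trans[OF norm_ge_zero decay[of 0 0]] by simp
  have ptw: "(\<lambda>j. IF (mollified k f (e j)) x) \<longlonglongrightarrow> f x" for x
  proof -
    have "(\<lambda>j. LINT z|lborel. f (x - e j *\<^sub>R z) * mollifier k z) \<longlonglongrightarrow> (LINT z::'a|lborel. f x * mollifier k z)"
    proof (rule integral_dominated_convergence)
      show "integrable lborel (\<lambda>z::'a. B * norm (mollifier k z))"
        by (intro integrable_mult_right integrable_norm intmoll)
      show "AE z in lborel. norm (f (x - e j *\<^sub>R z) * mollifier k z) \<le> B * norm (mollifier k z)" for j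
        unfolding norm_mult by (intro AE_I2 mult_right_mono B norm_ge_zero)
      show "AE z in lborel. (\<lambda>j. f (x - e j *\<^sub>R z) * mollifier k z) \<longlonglongrightarrow> f x * mollifier k z"
      proof (intro AE_I2 tendsto_mult tendsto_const)
        fix z
        have "(\<lambda>j. x - e j *\<^sub>R z) \<longlonglongrightarrow> x - 0 *\<^sub>R z" by (intro tendsto_intros e)
        then show "(\<lambda>j. f (x - e j *\<^sub>R z)) \<longlonglongrightarrow> f x"
          using CcK_continuous[OF f] by (intro isCont_tendsto_compose[of x f]) (auto simp: continuous_on_eq_continuous_at)
      qed
    qed measurable
    moreover have "(LINT z::'a|lborel. f x * mollifier k z) = f x"
      using mollifier_integral[of k, where 'a = 'a] k by simp
    ultimately show ?thesis unfolding IF_mollified[OF f e(1)] by (simp only:)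
  qed
  have "(\<lambda>j. LINT x|lborel. (norm (f x - IF (mollified k f (e j)) x))\<^sup>2) \<longlonglongrightarrow> (LINT x::'a|lborel. 0)"
  proof (rule integral_dominated_convergence)
    \<comment> \<open>The majorant comes from (u + v)^2 \<le> 2 u^2 + 2 v^2, one factor of each
      square being replaced by its bound B or A.\<close>
    show "integrable lborel (\<lambda>x. 2 * (B * norm (f x)) + 2 * (A * (A * inverse ((1 + norm x) ^ (2 * ?n)))))"
      by (intro Bochner_Integration.integrable_add integrable_mult_right integrable_norm CcK_integrable[OF f] integrable_inverse_norm_power)
    show "AE x in lborel. norm ((norm (f x - IF (mollified k f (e j)) x))\<^sup>2)
        \<le> 2 * (B * norm (f x)) + 2 * (A * (A * inverse ((1 + norm x) ^ (2 * ?n))))" for j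
    proof (rule AE_I2)
      fix x
      let ?u = "norm (f x)" and ?v = "norm (IF (mollified k f (e j)) x)"
      have "(norm (f x - IF (mollified k f (e j)) x))\<^sup>2 \<le> (?u + ?v)\<^sup>2"
        by (intro power_mono norm_triangle_ineq4 norm_ge_zero)
      also have "\<dots> \<le> 2 * (?u * ?u) + 2 * (?v * ?v)"
        using zero_le_power2[of "?u - ?v"] by (simp add: power2_eq_square algebra_simps)
      also have "\<dots> \<le> 2 * (B * ?u) + 2 * (A * (A * inverse ((1 + norm x) ^ (2 * ?n))))"
      proof (rule add_mono)
        have "?u * ?u \<le> B * ?u" by (rule mult_right_mono[OF B(2) norm_ge_zero])
        then show "2 * (?u * ?u) \<le> 2 * (B * ?u)" by simp
        have "1 \<le> (1 + norm x) ^ (2 * ?n)" by (rule one_le_power) simp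
        then have "inverse ((1 + norm x) ^ (2 * ?n)) \<le> 1" by (simp add: inverse_le_1_iff)
        from order_trans[OF decay[of j x] mult_left_mono[OF this A]] have "?v \<le> A" by simp
        then have "?v * ?v \<le> A * (A * inverse ((1 + norm x) ^ (2 * ?n)))"
          by (rule mult_mono[OF _ decay A norm_ge_zero])
        then show "2 * (?v * ?v) \<le> 2 * (A * (A * inverse ((1 + norm x) ^ (2 * ?n))))" by simp
      qed
      finally show "norm ((norm (f x - IF (mollified k f (e j)) x))\<^sup>2)
        \<le> 2 * (B * norm (f x)) + 2 * (A * (A * inverse ((1 + norm x) ^ (2 * ?n))))" by simp
    qed
    show "AE x in lborel. (\<lambda>j. (norm (f x - IF (mollified k f (e j)) x))\<^sup>2) \<longlonglongrightarrow> 0"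
    proof (rule AE_I2)
      fix x
      have "(\<lambda>j. (norm (f x - IF (mollified k f (e j)) x))\<^sup>2) \<longlonglongrightarrow> (norm (f x - f x))\<^sup>2"
        by (intro tendsto_intros ptw)
      then show "(\<lambda>j. (norm (f x - IF (mollified k f (e j)) x))\<^sup>2) \<longlonglongrightarrow> 0" by simp
    qed
  qed measurable
  then show ?thesis by simp
qed

section \<open>Density in L^2: bounded, then continuous, then transforms of test functions\<close>

lemma L2_norm_tendsto_0:
  assumes "(\<lambda>n. LINT x|lborel. (norm (u n x))\<^sup>2) \<longlonglongrightarrow> 0"
  shows "(\<lambda>n. L2_norm (u n)) \<longlonglongrightarrow> 0"
  using tendsto_real_sqrt[OF assms] by (simp add: L2_norm_def)

lemma L2_approx_bounded:
  assumes f: "in_L2 f" and e: "e > 0"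
  shows "\<exists>g B R. in_L2 g \<and> B > 0 \<and> (\<forall>x. norm (g x) \<le> B) \<and> (\<forall>x. R < norm x \<longrightarrow> g x = 0)
     \<and> L2_norm (\<lambda>x. f x - g x) < e"
proof -
  note [measurable] = in_L2_measurable[OF f]
  define S where "S n = {x. norm x \<le> real n \<and> norm (f x) \<le> real n}" for n
  have S[measurable]: "S n \<in> sets borel" for n unfolding S_def by measurable
  have "(\<lambda>n. LINT x|lborel. (norm (f x - indicator (S n) x *\<^sub>R f x))\<^sup>2) \<longlonglongrightarrow> (LINT x::real^3|lborel. 0)"
  proof (rule integral_dominated_convergence)
    show "integrable lborel (\<lambda>x. (norm (f x))\<^sup>2)" by (rule in_L2_integrable[OF f])
    show "AE x in lborel. norm ((norm (f x - indicator (S n) x *\<^sub>R f x))\<^sup>2) \<le> (norm (f x))\<^sup>2" for n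
      by (intro AE_I2) (simp add: indicator_def)
    show "AE x in lborel. (\<lambda>n. (norm (f x - indicator (S n) x *\<^sub>R f x))\<^sup>2) \<longlonglongrightarrow> 0"
    proof (rule AE_I2)
      fix x
      obtain N where N: "max (norm x) (norm (f x)) \<le> real N" using real_arch_simple by blast
      have "(norm (f x - indicator (S n) x *\<^sub>R f x))\<^sup>2 = 0" if "n \<ge> N" for n
      proof -
        have "real N \<le> real n" using that by simp
        then have "x \<in> S n" using N by (simp add: S_def)
        then show ?thesis by simp
      qed
      then show "(\<lambda>n. (norm (f x - indicator (S n) x *\<^sub>R f x))\<^sup>2) \<longlonglongrightarrow> 0"
        by (intro tendsto_eventually) (auto simp: eventually_sequentially)
    qed
  qed measurable
  then have "(\<lambda>n. LINT x|lborel. (norm (f x - indicator (S n) x *\<^sub>R f x))\<^sup>2) \<longlonglongrightarrow> 0" by simp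
  from order_tendstoD(2)[OF L2_norm_tendsto_0[OF this] e]
  obtain n where n: "L2_norm (\<lambda>x. f x - indicator (S n) x *\<^sub>R f x) < e"
    by (auto simp: eventually_sequentially)
  have "in_L2 (\<lambda>x. indicator (S n) x *\<^sub>R f x)" by (rule in_L2_indicator[OF f S])
  \<comment> \<open>Adding 1 keeps the bound strictly positive when n = 0.\<close>
  moreover have "norm (indicator (S n) x *\<^sub>R f x) \<le> real n + 1" for x
    by (simp add: S_def indicator_def)
  moreover have "indicator (S n) x *\<^sub>R f x = 0" if "real n < norm x" for x
    using that by (simp add: S_def indicator_def)
  ultimately show ?thesis using n
    by (intro exI[of _ "\<lambda>x. indicator (S n) x *\<^sub>R f x"] exI[of _ "real n + 1"] exI[of _ "real n"]) auto
qed

text \<open>A measurable function is an almost everywhere limit of continuous functions, with no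
  control of their size; truncating them makes dominated convergence applicable.\<close>

lemma L2_approx_bounded_continuous:
  assumes f: "in_L2 f" and B: "B > 0" "\<And>x. norm (f x) \<le> B" and R: "\<And>x. R < norm x \<Longrightarrow> f x = 0"
    and e: "e > 0"
  shows "\<exists>g. CcK 0 g \<and> L2_norm (\<lambda>x. f x - g x) < e"
proof -
  note [measurable] = in_L2_measurable[OF f]
  have "f measurable_on UNIV"
    by (intro lebesgue_measurable_imp_measurable_on measurable_completion) auto
  then obtain N F where N: "negligible N" and F: "\<And>n. continuous_on UNIV (F n)"
    and lim: "\<And>x. x \<notin> N \<Longrightarrow> (\<lambda>n. F n x) \<longlonglongrightarrow> f x"
    unfolding measurable_on_def by auto
  \<comment> \<open>Both truncations fix f, so the limit is still f: a radial cutoff that is 1 for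
    |x| up to R, and the retraction of values onto the ball of radius B.\<close>
  define g where "g n x = max 0 (min 1 (R + 1 - norm x)) *\<^sub>R ((B / max B (norm (F n x))) *\<^sub>R F n x)" for n x
  have maxB: "max B r \<noteq> 0" for r using B(1) by linarith
  have g: "CcK 0 (g n)" for n
    unfolding CcK_def
  proof
    show "Ck 0 (g n)" unfolding g_def using F maxB by (auto intro!: continuous_intros)
    show "\<exists>R. \<forall>x. R < norm x \<longrightarrow> g n x = 0" by (intro exI[of _ "R + 1"]) (auto simp: g_def)
  qed
  note [measurable] = CcK_measurable[OF g]
  have gB: "norm (g n x) \<le> B * indicator (cball 0 (R + 1)) x" for n x
  proof (cases "norm x \<le> R + 1")
    case True
    have "norm (g n x) \<le> 1 * norm ((B / max B (norm (F n x))) *\<^sub>R F n x)"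
      unfolding g_def norm_scaleR by (rule mult_right_mono) auto
    also have "\<dots> = B * (norm (F n x) / max B (norm (F n x)))" using B by simp
    also have "\<dots> \<le> B * 1" using B by (intro mult_left_mono) (auto simp: divide_le_eq_1)
    finally show ?thesis using True by simp
  qed (simp add: g_def)
  have fB: "norm (f x) \<le> B * indicator (cball 0 (R + 1)) x" for x
    using B R[of x] by (cases "norm x \<le> R + 1") auto
  have "(\<lambda>n. LINT x|lborel. (norm (f x - g n x))\<^sup>2) \<longlonglongrightarrow> (LINT x::real^3|lborel. 0)"
  proof (rule integral_dominated_convergence)
    show "integrable lborel (\<lambda>x::real^3. (2 * B)\<^sup>2 * indicator (cball 0 (R + 1)) x)"
      by (intro integrable_mult_right integrable_real_indicator)
        (auto intro: emeasure_bounded_finite[OF bounded_cball, simplified])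
    show "AE x in lborel. norm ((norm (f x - g n x))\<^sup>2) \<le> (2 * B)\<^sup>2 * indicator (cball 0 (R + 1)) x" for n
    proof (rule AE_I2)
      fix x :: "real^3"
      let ?i = "indicator (cball 0 (R + 1)) x :: real"
      have "norm (f x - g n x) \<le> 2 * B * ?i"
        using norm_triangle_ineq4[of "f x" "g n x"] fB[of x] gB[of n x] by linarith
      then have "(norm (f x - g n x))\<^sup>2 \<le> (2 * B * ?i)\<^sup>2" by (intro power_mono) auto
      also have "\<dots> = (2 * B)\<^sup>2 * ?i" by (simp add: indicator_def)
      finally show "norm ((norm (f x - g n x))\<^sup>2) \<le> (2 * B)\<^sup>2 * ?i" by simp
    qed
    have "AE x in lebesgue. x \<notin> N"
      using N by (intro AE_not_in) (simp add: negligible_iff_null_sets)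
    then have "AE x in lborel. x \<notin> N" by (simp add: AE_completion_iff)
    then show "AE x in lborel. (\<lambda>n. (norm (f x - g n x))\<^sup>2) \<longlonglongrightarrow> 0"
    proof eventually_elim
      case (elim x)
      have "(\<lambda>n. g n x) \<longlonglongrightarrow> max 0 (min 1 (R + 1 - norm x)) *\<^sub>R ((B / max B (norm (f x))) *\<^sub>R f x)"
        unfolding g_def using maxB by (intro tendsto_intros lim elim)
      also have "max 0 (min 1 (R + 1 - norm x)) *\<^sub>R ((B / max B (norm (f x))) *\<^sub>R f x) = f x"
        using B(1) B(2)[of x] R[of x] by (cases "norm x \<le> R") (auto simp: max_def min_def)
      finally have "(\<lambda>n. (norm (f x - g n x))\<^sup>2) \<longlonglongrightarrow> (norm (f x - f x))\<^sup>2"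
        by (intro tendsto_intros)
      then show ?case by simp
    qed
  qed measurable
  then have "(\<lambda>n. LINT x|lborel. (norm (f x - g n x))\<^sup>2) \<longlonglongrightarrow> 0" by simp
  from order_tendstoD(2)[OF L2_norm_tendsto_0[OF this] e]
  obtain n where n: "L2_norm (\<lambda>x. f x - g n x) < e"
    by (auto simp: eventually_sequentially)
  with g show ?thesis by blast
qed

lemma L2_approx_continuous_G:
  assumes f: "CcK 0 f" and e: "e > 0" and k: "k \<ge> 12"
  shows "\<exists>\<phi>. CcK k \<phi> \<and> L2_norm (\<lambda>x. f x - G \<phi> x) < e"
proof -
  \<comment> \<open>This factor cancels the normalisation of \<open>G\<close>, because mollification
    was done with the unnormalised \<open>IF\<close>.\<close>
  define r where "r = (2 * pi) powr (3 / 2)"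
  have r: "(2 * pi) powr (- 3 / 2) * r = 1" by (simp add: r_def powr_add[symmetric])
  define h where "h j i p = complex_of_real r * mollified k (\<lambda>x. f x $ i) (1 / real (Suc j)) p" for j and i :: 4 and p :: "real^3"
  define \<phi> where "\<phi> j p = (\<chi> i. h j i p)" for j p
  have fi: "CcK 0 (\<lambda>x. f x $ i)" for i by (rule CcK_vec_nth[OF f])
  have h: "CcK k (h j i)" for j i
    unfolding h_def by (intro CcK_cmult CcK_mollified fi) simp
  have \<phi>: "CcK k (\<phi> j)" for j unfolding \<phi>_def by (rule CcK_vec_lambda) (rule h)
  have G: "G (\<phi> j) x $ i = IF (mollified k (\<lambda>x. f x $ i) (1 / real (Suc j))) x" for j x i
  proof -
    have "G (\<phi> j) x $ i = complex_of_real ((2 * pi) powr (- 3 / 2) * r) * IF (mollified k (\<lambda>x. f x $ i) (1 / real (Suc j))) x"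
      unfolding G_nth \<phi>_def vec_lambda_beta h_def IF_cmult of_real_mult by (rule mult.assoc[symmetric])
    then show ?thesis by (simp only: r) simp
  qed
  have d: "in_L2 (\<lambda>x. f x - G (\<phi> j) x)" for j
    by (intro in_L2_diff in_L2_CcK[OF f] in_L2_G CcK_mono[OF \<phi>]) (use k in simp)
  have int: "integrable lborel (\<lambda>x. (norm ((f x - G (\<phi> j) x) $ i))\<^sup>2)" for i j
  proof (rule Bochner_Integration.integrable_bound[OF in_L2_integrable[OF d[of j]]])
    note [measurable] = in_L2_measurable[OF d[of j]]
    have "(\<lambda>x. (f x - G (\<phi> j) x) $ i) \<in> borel_measurable borel"
      by (rule measurable_compose[OF in_L2_measurable[OF d[of j]]])
         (intro borel_measurable_continuous_onI linear_continuous_on bounded_linear_vec_nth)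
    then show "(\<lambda>x. (norm ((f x - G (\<phi> j) x) $ i))\<^sup>2) \<in> borel_measurable lborel" by measurable
    show "AE x in lborel. norm ((norm ((f x - G (\<phi> j) x) $ i))\<^sup>2) \<le> norm ((norm (f x - G (\<phi> j) x))\<^sup>2)"
      by (intro AE_I2) (simp only: real_norm_def abs_power2
          power_mono[OF Finite_Cartesian_Product.norm_nth_le norm_ge_zero])
  qed
  have "(\<lambda>j. \<Sum>i\<in>UNIV. (LINT x|lborel. (norm (f x $ i - IF (mollified k (\<lambda>x. f x $ i) (1 / real (Suc j))) x))\<^sup>2))
     \<longlonglongrightarrow> (\<Sum>i\<in>(UNIV::4 set). 0)"
  proof (rule tendsto_sum, rule IF_mollified_tendsto[OF fi])
    show "(\<lambda>j. 1 / real (Suc j)) \<longlonglongrightarrow> 0"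
      using LIMSEQ_inverse_real_of_nat by (simp add: inverse_eq_divide)
  qed (use k in auto)
  also have "(\<lambda>j. \<Sum>i\<in>UNIV. (LINT x|lborel. (norm (f x $ i - IF (mollified k (\<lambda>x. f x $ i) (1 / real (Suc j))) x))\<^sup>2))
     = (\<lambda>j. LINT x|lborel. (norm (f x - G (\<phi> j) x))\<^sup>2)"
    unfolding norm_vec_sq Bochner_Integration.integral_sum[OF int]
    by (simp only: vector_minus_component G)
  finally have "(\<lambda>j. LINT x|lborel. (norm (f x - G (\<phi> j) x))\<^sup>2) \<longlonglongrightarrow> 0" by simp
  from order_tendstoD(2)[OF L2_norm_tendsto_0[OF this] e]
  obtain j where "L2_norm (\<lambda>x. f x - G (\<phi> j) x) < e"
    by (auto simp: eventually_sequentially)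
  with \<phi> show ?thesis by blast
qed

text \<open>Order 12 is four times the dimension, as mollification requires. Finite smoothness is
  enough here: for mere convergence to 0 some positive rate on the approximants suffices.\<close>

lemma G_dense:
  assumes f: "in_L2 f" and e: "e > 0"
  obtains \<phi> where "CcK 12 \<phi>" "L2_norm (\<lambda>x. f x - G \<phi> x) < e"
proof -
  obtain g B R where g: "in_L2 g" "B > 0" "\<And>x. norm (g x) \<le> B" "\<And>x. R < norm x \<Longrightarrow> g x = 0"
    "L2_norm (\<lambda>x. f x - g x) < e / 3"
    using L2_approx_bounded[OF f, of "e / 3"] e by auto
  obtain h where h: "CcK 0 h" "L2_norm (\<lambda>x. g x - h x) < e / 3"
    using L2_approx_bounded_continuous[OF g(1-4), where e = "e / 3"] e by auto
  obtain \<phi> where \<phi>: "CcK 12 \<phi>" "L2_norm (\<lambda>x. h x - G \<phi> x) < e / 3"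
    using L2_approx_continuous_G[OF h(1), of "e / 3" 12] e by auto
  have G: "in_L2 (G \<phi>)" by (intro in_L2_G CcK_mono[OF \<phi>(1)]) simp
  have "L2_norm (\<lambda>x. f x - G \<phi> x) \<le> L2_norm (\<lambda>x. f x - g x) + L2_norm (\<lambda>x. g x - G \<phi> x)"
    by (rule L2_norm_triangle_diff[OF f g(1) G])
  also have "L2_norm (\<lambda>x. g x - G \<phi> x) \<le> L2_norm (\<lambda>x. g x - h x) + L2_norm (\<lambda>x. h x - G \<phi> x)"
    by (rule L2_norm_triangle_diff[OF g(1) in_L2_CcK[OF h(1)] G])
  finally show thesis using that \<phi> g(5) h(2) by force
qed

section \<open>Uniqueness of the inverse Fourier transform\<close>

lemma L2_inner_tendsto:
  assumes "L2_tendsto u f sequentially" "in_L2 g"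
  shows "(\<lambda>n. LINT x|lborel. u n x \<bullet> g x) \<longlonglongrightarrow> (LINT x|lborel. f x \<bullet> g x)"
proof -
  have u: "in_L2 (u n)" and f: "in_L2 f" and lim: "(\<lambda>n. L2_norm (\<lambda>x. u n x - f x)) \<longlonglongrightarrow> 0" for n
    using assms(1) by (auto simp: L2_tendsto_def)
  have "(\<lambda>n. (LINT x|lborel. u n x \<bullet> g x) - (LINT x|lborel. f x \<bullet> g x)) \<longlonglongrightarrow> 0"
  proof (rule Lim_null_comparison)
    show "(\<lambda>n. L2_norm (\<lambda>x. u n x - f x) * L2_norm g) \<longlonglongrightarrow> 0"
      using tendsto_mult_right[OF lim, of "L2_norm g"] by simp
    have "norm ((LINT x|lborel. u n x \<bullet> g x) - (LINT x|lborel. f x \<bullet> g x)) \<le> L2_norm (\<lambda>x. u n x - f x) * L2_norm g" for n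
      using L2_Cauchy_Schwarz[OF in_L2_diff[OF u f] assms(2), of n]
        L2_inner_integrable[OF u assms(2), of n] L2_inner_integrable[OF f assms(2)]
      by (simp add: inner_diff_left)
    then show "\<forall>\<^sub>F n in sequentially. norm ((LINT x|lborel. u n x \<bullet> g x) - (LINT x|lborel. f x \<bullet> g x)) \<le> L2_norm (\<lambda>x. u n x - f x) * L2_norm g"
      by simp
  qed
  then show ?thesis by (rule LIM_zero_cancel)
qed

text \<open>Pairing with \<open>G \<theta>\<close> identifies \<open>\<psi>\<close>: the adjoint
  formula holds along the approximating sequence and survives both L^2 limits. So
  \<open>\<psi>\<close> - \<open>G \<phi>\<close> is orthogonal to a dense family.\<close>

lemma has_fourier_eq_G:
  assumes four: "has_fourier \<psi> \<phi>" and \<phi>: "CcK 6 \<phi>"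
  shows "AE x in lborel. \<psi> x = G \<phi> x"
proof -
  obtain u where u: "\<And>n. integrable lborel (u n)" "L2_tendsto u \<psi> sequentially"
    "L2_tendsto (\<lambda>n. fourier_integral (u n)) \<phi> sequentially"
    using four unfolding has_fourier_def by blast
  have \<psi>: "in_L2 \<psi>" using u(2) by (simp add: L2_tendsto_def)
  define \<delta> where "\<delta> x = \<psi> x - G \<phi> x" for x
  have \<delta>: "in_L2 \<delta>" unfolding \<delta>_def by (rule in_L2_diff[OF \<psi> in_L2_G[OF \<phi>]])
  have orth: "(LINT x|lborel. \<delta> x \<bullet> G \<theta> x) = 0" if \<theta>: "CcK 6 \<theta>" for \<theta>
  proof -
    have "(\<lambda>n. LINT x|lborel. u n x \<bullet> G \<theta> x) \<longlonglongrightarrow> (LINT p|lborel. \<phi> p \<bullet> \<theta> p)"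
      unfolding fourier_integral_adjoint[OF u(1) \<theta>] by (rule L2_inner_tendsto[OF u(3) in_L2_CcK[OF \<theta>]])
    from LIMSEQ_unique[OF L2_inner_tendsto[OF u(2) in_L2_G[OF \<theta>]] this]
    have "(LINT x|lborel. \<psi> x \<bullet> G \<theta> x) = (LINT p|lborel. \<phi> p \<bullet> \<theta> p)" .
    also have "\<dots> = (LINT x|lborel. G \<phi> x \<bullet> G \<theta> x)"
      by (simp only: fourier_integral_adjoint[OF integrable_G[OF \<phi>] \<theta>] fourier_integral_G[OF \<phi>])
    finally show ?thesis unfolding \<delta>_def inner_diff_left
      by (simp add: L2_inner_integrable in_L2_G \<psi> \<phi> \<theta>)
  qed
  have "L2_norm \<delta> \<le> e" if e: "e > 0" for e
  proof (cases "L2_norm \<delta> = 0")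
    case False
    obtain \<theta> where \<theta>: "CcK 12 \<theta>" "L2_norm (\<lambda>x. \<delta> x - G \<theta> x) < e" by (rule G_dense[OF \<delta> e])
    have \<theta>6: "CcK 6 \<theta>" by (rule CcK_mono[OF \<theta>(1)]) simp
    \<comment> \<open>By orthogonality one factor \<open>\<delta>\<close> may be replaced by the
      small difference \<open>\<delta>\<close> - \<open>G \<theta>\<close>.\<close>
    have "(L2_norm \<delta>)\<^sup>2 = (LINT x|lborel. \<delta> x \<bullet> \<delta> x)" by (simp add: L2_norm_sq power2_norm_eq_inner)
    also have "\<dots> = (LINT x|lborel. \<delta> x \<bullet> (\<delta> x - G \<theta> x))"
      using orth[OF \<theta>6] by (simp add: inner_diff_right L2_inner_integrable \<delta> in_L2_G[OF \<theta>6])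
    also have "\<dots> \<le> L2_norm \<delta> * L2_norm (\<lambda>x. \<delta> x - G \<theta> x)"
      using L2_Cauchy_Schwarz[OF \<delta> in_L2_diff[OF \<delta> in_L2_G[OF \<theta>6]]] by linarith
    also have "\<dots> \<le> L2_norm \<delta> * e" using \<theta>(2) L2_norm_nonneg by (intro mult_left_mono) auto
    finally show ?thesis using False L2_norm_nonneg[of \<delta>] by (simp add: power2_eq_square)
  qed (use e in simp)
  then have "L2_norm \<delta> \<le> 0" by (rule field_le_epsilon[of _ 0, simplified])
  then have "L2_norm \<delta> = 0" using L2_norm_nonneg[of \<delta>] by simp
  from L2_norm_eq_0D[OF \<delta> this] show ?thesis by (simp add: \<delta>_def)
qed

section \<open>The free Dirac evolution\<close>

lemma scaleR_matrix_vector_mult: "(r *\<^sub>R A) *v (v :: complex ^ 'n) = r *\<^sub>R (A *v v)"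
  by (simp add: vec_eq_iff matrix_vector_mult_def scaleR_sum_right)

lemma matrix_vector_mult_scaleR: "A *v (r *\<^sub>R (v :: complex ^ 'n)) = r *\<^sub>R (A *v v)"
  by (simp add: vec_eq_iff matrix_vector_mult_def scaleR_sum_right)

lemma bounded_linear_matrix_vector_mult: "bounded_linear (\<lambda>v :: complex ^ 'n. (A :: complex ^ 'n ^ 'm) *v v)"
  by (rule linear_conv_bounded_linear[THEN iffD1], rule linearI)
     (auto simp: matrix_vector_right_distrib matrix_vector_mult_scaleR)

lemma CcK_scaleR:
  fixes r :: "'a::euclidean_space \<Rightarrow> real" and \<phi> :: "'a \<Rightarrow> 'b::euclidean_space"
  shows "Ck k r \<Longrightarrow> CcK k \<phi> \<Longrightarrow> CcK k (\<lambda>p. r p *\<^sub>R \<phi> p)"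
  unfolding CcK_def by (intro conjI Ck_scaleR) auto

lemma CcK_smult:
  fixes c :: "'a::euclidean_space \<Rightarrow> complex" and \<phi> :: "'a \<Rightarrow> complex ^ 'n"
  assumes "Ck k c" "CcK k \<phi>"
  shows "CcK k (\<lambda>p. c p *s \<phi> p)"
proof -
  have "c p *s \<phi> p = (\<chi> i. c p * \<phi> p $ i)" for p by (simp add: vec_eq_iff)
  then show ?thesis
    using CcK_vec_lambda[of k "\<lambda>i p. c p * \<phi> p $ i"]
      CcK_mult[OF assms(1) CcK_compose_bounded_linear[OF bounded_linear_vec_nth assms(2)]] by simp
qed

lemma norm_iexp_remainder: "norm (exp (\<i> * complex_of_real \<theta>) - 1 - \<i> * complex_of_real \<theta>) \<le> \<theta>\<^sup>2"
proof -
  have "norm (exp (\<i> * complex_of_real \<theta>) - (1 + \<i> * complex_of_real \<theta>)) \<le> \<bar>\<theta>\<bar>\<^sup>2 / 2"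
    using iexp_approx1[of \<theta> 1] by (simp add: power2_eq_square)
  also have "\<dots> \<le> \<theta>\<^sup>2" by simp
  finally show ?thesis by (simp add: diff_diff_eq)
qed

lemma dirac_symbol_mult:
  "dirac_symbol m \<alpha> \<beta> p *v v = (\<Sum>k\<in>UNIV. (p $ k) *\<^sub>R (\<alpha> k *v v)) + m *\<^sub>R (\<beta> *v v)"
proof -
  have "(\<Sum>k\<in>UNIV. A k) *v v = (\<Sum>k\<in>UNIV. A k *v v)" for A :: "3 \<Rightarrow> complex ^ 4 ^ 4"
    by (simp add: sum_3 matrix_vector_mult_add_rdistrib)
  then show ?thesis
    by (simp add: dirac_symbol_def matrix_vector_mult_add_rdistrib scaleR_matrix_vector_mult)
qed

lemma dirac_symbol_square:
  assumes "dirac_matrices \<alpha> \<beta>"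
  shows "dirac_symbol m \<alpha> \<beta> p *v (dirac_symbol m \<alpha> \<beta> p *v v) = (m\<^sup>2 + p \<bullet> p) *\<^sub>R v"
proof -
  have ac: "\<alpha> j *v (\<alpha> k *v w) + \<alpha> k *v (\<alpha> j *v w) = (if j = k then 2 *\<^sub>R w else 0)" for j k w
  proof -
    have "(\<alpha> j ** \<alpha> k + \<alpha> k ** \<alpha> j) *v w = (if j = k then mat 2 else 0) *v w"
      using assms by (simp add: dirac_matrices_def)
    moreover have "mat 2 *v w = 2 *\<^sub>R w"
      by (simp add: vec_eq_iff matrix_vector_mult_def mat_def if_distrib[of "\<lambda>x. x * _"] sum.delta cong: if_cong)
         (simp add: scaleR_conv_of_real)
    ultimately show ?thesis
      by (simp add: matrix_vector_mult_add_rdistrib matrix_vector_mul_assoc split: if_splits)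
  qed
  have sq: "\<alpha> k *v (\<alpha> k *v w) = w" for k w
    using ac[of k k w] by (simp add: scaleR_2[symmetric])
  have anti: "\<alpha> j *v (\<alpha> k *v w) = - (\<alpha> k *v (\<alpha> j *v w))" if "j \<noteq> k" for j k w
    using ac[of j k w] that by (simp add: eq_neg_iff_add_eq_0)
  have ab: "\<beta> *v (\<alpha> k *v w) = - (\<alpha> k *v (\<beta> *v w))" for k w
  proof -
    have "(\<alpha> k ** \<beta> + \<beta> ** \<alpha> k) *v w = 0 *v w"
      using assms by (simp add: dirac_matrices_def)
    then show ?thesis
      by (simp add: matrix_vector_mult_add_rdistrib matrix_vector_mul_assoc eq_neg_iff_add_eq_0 add.commute)
  qed
  have bb: "\<beta> *v (\<beta> *v w) = w" for w
  proof -
    have "(\<beta> ** \<beta>) *v w = w" using assms by (simp add: dirac_matrices_def)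
    then show ?thesis by (simp add: matrix_vector_mul_assoc)
  qed
  have pp: "p \<bullet> p = p $ 1 * p $ 1 + p $ 2 * p $ 2 + p $ 3 * p $ 3"
    by (simp add: inner_vec_def sum_3)
  \<comment> \<open>Only three orientations of anticommutation are used, each moving the smaller
    index to the left; rewriting then sorts the products and the mixed terms cancel.\<close>
  have ne: "(2::3) \<noteq> 1" "(3::3) \<noteq> 1" "(3::3) \<noteq> 2" by simp_all
  show ?thesis
    unfolding dirac_symbol_mult sum_3 pp
    by (simp only: matrix_vector_right_distrib matrix_vector_mult_scaleR scaleR_add_right scaleR_scaleR
          sq bb ab anti[OF ne(1)] anti[OF ne(2)] anti[OF ne(3)])
       (simp add: algebra_simps power2_eq_square)
qed

lemma CcK_dirac_symbol:
  assumes "CcK k \<phi>"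
  shows "CcK k (\<lambda>p. dirac_symbol m \<alpha> \<beta> p *v \<phi> p)"
proof -
  have A: "CcK k (\<lambda>p. A *v \<phi> p)" for A :: "complex ^ 4 ^ 4"
    by (rule CcK_compose_bounded_linear[OF bounded_linear_matrix_vector_mult assms])
  show ?thesis unfolding dirac_symbol_mult
    by (intro CcK_add CcK_sum CcK_scaleR A Ck_const Ck_vec_nth[OF Ck_id])
qed

text \<open>
  For $s = \pm 1$, \<open>proj m \<alpha> \<beta> s \<phi> p\<close> is the component of \<open>\<phi> p\<close> in the eigenspace of $h(p)$ with
  eigenvalue $s E(p)$.  Hence \<open>evol m \<alpha> \<beta> t\<close> is multiplication by $e^{i t h(p)}$.
\<close>

definition proj ::
    "real \<Rightarrow> (3 \<Rightarrow> complex ^ 4 ^ 4) \<Rightarrow> complex ^ 4 ^ 4 \<Rightarrow> real \<Rightarrow> spinor_field \<Rightarrow> spinor_field" where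
  "proj m \<alpha> \<beta> s \<phi> p =
     (1 / 2) *\<^sub>R (\<phi> p + (s * inverse (energy m p)) *\<^sub>R (dirac_symbol m \<alpha> \<beta> p *v \<phi> p))"

definition evol ::
    "real \<Rightarrow> (3 \<Rightarrow> complex ^ 4 ^ 4) \<Rightarrow> complex ^ 4 ^ 4 \<Rightarrow> real \<Rightarrow> spinor_field \<Rightarrow> spinor_field" where
  "evol m \<alpha> \<beta> t \<phi> p =
     exp (\<i> * complex_of_real (t * energy m p)) *s proj m \<alpha> \<beta> 1 \<phi> p
     + exp (\<i> * complex_of_real (- t * energy m p)) *s proj m \<alpha> \<beta> (- 1) \<phi> p"

lemma evol_0: "evol m \<alpha> \<beta> 0 \<phi> = \<phi>"
  by (rule ext) (simp add: evol_def proj_def vec_eq_iff scaleR_add_right[symmetric])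

context
  fixes m :: real and \<alpha> :: "3 \<Rightarrow> complex ^ 4 ^ 4" and \<beta> :: "complex ^ 4 ^ 4"
  assumes m: "m > 0" and dirac: "dirac_matrices \<alpha> \<beta>"
begin

lemma CcK_proj: "CcK k \<phi> \<Longrightarrow> CcK k (proj m \<alpha> \<beta> s \<phi>)"
  unfolding proj_def[abs_def]
  by (intro CcK_scaleR CcK_add CcK_dirac_symbol Ck_const Ck_mult Ck_inverse_energy m)

lemma CcK_evol: "CcK k \<phi> \<Longrightarrow> CcK k (evol m \<alpha> \<beta> t \<phi>)"
  unfolding evol_def[abs_def]
  by (intro CcK_add CcK_smult CcK_proj Ck_exp Ck_mult[OF Ck_const] Ck_of_real Ck_energy m)

text \<open>Applying h to (1 + s h/E)/2 exchanges the two summands up to the factor s E, because h^2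
  = E^2 and s^2 = 1.\<close>

lemma dirac_symbol_proj:
  assumes s: "s * s = 1"
  shows "dirac_symbol m \<alpha> \<beta> p *v proj m \<alpha> \<beta> s \<phi> p = (s * energy m p) *\<^sub>R proj m \<alpha> \<beta> s \<phi> p"
proof -
  have E: "energy m p \<noteq> 0" using energy_pos[OF m, of p] by simp
  have 1: "s * inverse (energy m p) * (m\<^sup>2 + p \<bullet> p) = s * energy m p"
    unfolding energy_sq[symmetric] using E by simp
  have 2: "s * energy m p * (s * inverse (energy m p)) = 1"
  proof -
    have "s * energy m p * (s * inverse (energy m p)) = (s * s) * (energy m p * inverse (energy m p))"
      by (simp only: mult_ac)
    then show ?thesis using E s by simp
  qed
  let ?h = "dirac_symbol m \<alpha> \<beta> p *v \<phi> p"
  have "dirac_symbol m \<alpha> \<beta> p *v proj m \<alpha> \<beta> s \<phi> p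
      = (1 / 2) *\<^sub>R (?h + (s * inverse (energy m p) * (m\<^sup>2 + p \<bullet> p)) *\<^sub>R \<phi> p)"
    by (simp only: proj_def matrix_vector_mult_scaleR matrix_vector_right_distrib
        dirac_symbol_square[OF dirac] scaleR_scaleR)
  also have "\<dots> = (1 / 2) *\<^sub>R ((s * energy m p) *\<^sub>R \<phi> p + (s * energy m p * (s * inverse (energy m p))) *\<^sub>R ?h)"
    unfolding 1 2 scaleR_one by (simp only: add.commute[of ?h])
  also have "\<dots> = (s * energy m p) *\<^sub>R proj m \<alpha> \<beta> s \<phi> p"
    by (simp only: proj_def scaleR_add_right scaleR_scaleR mult.left_commute[of _ "1 / 2"] mult.commute[of _ "1 / 2"])
  finally show ?thesis .
qed

text \<open>On each eigenspace the time step s is multiplication by a phase with second-order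
  remainder at most (s E)^2. The phase accumulated up to t has modulus 1, so the bound does not
  depend on t.\<close>

lemma evol_remainder:
  "norm (evol m \<alpha> \<beta> (t + s) \<phi> p - evol m \<alpha> \<beta> t \<phi> p
      - (\<i> * complex_of_real s) *s (dirac_symbol m \<alpha> \<beta> p *v evol m \<alpha> \<beta> t \<phi> p))
   \<le> s\<^sup>2 * ((m\<^sup>2 + p \<bullet> p) * (norm (proj m \<alpha> \<beta> 1 \<phi> p) + norm (proj m \<alpha> \<beta> (- 1) \<phi> p)))"
proof -
  let ?E = "energy m p" and ?P = "\<lambda>s. proj m \<alpha> \<beta> s \<phi> p"
  let ?e = "\<lambda>\<theta>. exp (\<i> * complex_of_real \<theta>)"
  let ?r = "\<lambda>\<theta>. ?e \<theta> - 1 - \<i> * complex_of_real \<theta>"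
  have add: "?e (a + b) = ?e a * ?e b" for a b by (simp add: exp_add[symmetric] distrib_left)
  have H: "dirac_symbol m \<alpha> \<beta> p *v evol m \<alpha> \<beta> t \<phi> p
     = ?e (t * ?E) *s (?E *\<^sub>R ?P 1) + ?e (- t * ?E) *s ((- ?E) *\<^sub>R ?P (- 1))"
  proof -
    have "dirac_symbol m \<alpha> \<beta> p *v ?P 1 = ?E *\<^sub>R ?P 1"
      "dirac_symbol m \<alpha> \<beta> p *v ?P (- 1) = (- ?E) *\<^sub>R ?P (- 1)"
      using dirac_symbol_proj[of 1 p \<phi>] dirac_symbol_proj[of "- 1" p \<phi>] by simp_all
    then show ?thesis
      by (simp only: evol_def matrix_vector_right_distrib vector_scalar_commute)
  qed
  have "evol m \<alpha> \<beta> (t + s) \<phi> p - evol m \<alpha> \<beta> t \<phi> p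
      - (\<i> * complex_of_real s) *s (dirac_symbol m \<alpha> \<beta> p *v evol m \<alpha> \<beta> t \<phi> p)
     = (?e (t * ?E) * ?r (s * ?E)) *s ?P 1 + (?e (- t * ?E) * ?r (- s * ?E)) *s ?P (- 1)"
    unfolding H unfolding evol_def
    by (simp only: minus_add_distrib distrib_right add minus_mult_left[symmetric])
       (simp add: vec_eq_iff algebra_simps scaleR_conv_of_real[where 'a = complex])
  also have "norm \<dots> \<le> norm (?r (s * ?E)) * norm (?P 1) + norm (?r (- s * ?E)) * norm (?P (- 1))"
    by (rule order_trans[OF norm_triangle_ineq]) (simp only: norm_smult norm_mult norm_exp_i_times mult_1_left order_refl)
  also have "\<dots> \<le> (s * ?E)\<^sup>2 * norm (?P 1) + (- s * ?E)\<^sup>2 * norm (?P (- 1))"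
    by (intro add_mono mult_right_mono norm_iexp_remainder norm_ge_zero)
  also have "\<dots> = s\<^sup>2 * ((?E * ?E) * (norm (?P 1) + norm (?P (- 1))))"
    by (simp add: power2_eq_square algebra_simps)
  finally show ?thesis unfolding energy_sq .
qed

text \<open>\<open>G\<close> is isometric on test functions, so a pointwise estimate of amplitudes
  suffices. The quadratic bound expresses differentiability of the explicit evolution in
  L^2.\<close>

lemma G_evol_remainder:
  assumes \<phi>: "CcK 6 \<phi>"
  shows "\<exists>K. \<forall>t s. L2_norm (\<lambda>x. G (evol m \<alpha> \<beta> (t + s) \<phi>) x - G (evol m \<alpha> \<beta> t \<phi>) x
      - s *\<^sub>R (\<i> *s G (\<lambda>p. dirac_symbol m \<alpha> \<beta> p *v evol m \<alpha> \<beta> t \<phi> p) x)) \<le> s\<^sup>2 * K"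
proof -
  \<comment> \<open>The scalar bound is placed along a unit vector to become a spinor field. It
    contains norms, so only continuity is available.\<close>
  define q where "q p = ((m\<^sup>2 + p \<bullet> p) * (norm (proj m \<alpha> \<beta> 1 \<phi> p) + norm (proj m \<alpha> \<beta> (- 1) \<phi> p))) *\<^sub>R (axis 1 1 :: complex ^ 4)" for p
  have P: "CcK 0 (proj m \<alpha> \<beta> s \<phi>)" for s by (intro CcK_proj CcK_mono[OF \<phi>]) simp
  have q: "CcK 0 q"
  proof -
    obtain R1 where R1: "\<forall>p. R1 < norm p \<longrightarrow> proj m \<alpha> \<beta> 1 \<phi> p = 0" using P[of 1] unfolding CcK_def by auto
    obtain R2 where R2: "\<forall>p. R2 < norm p \<longrightarrow> proj m \<alpha> \<beta> (- 1) \<phi> p = 0" using P[of "- 1"] unfolding CcK_def by auto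
    have "continuous_on UNIV q" unfolding q_def
      by (intro continuous_intros CcK_continuous[OF P])
    moreover have "\<forall>p. max R1 R2 < norm p \<longrightarrow> q p = 0" using R1 R2 by (auto simp: q_def)
    ultimately show ?thesis unfolding CcK_def Ck.simps(1) by blast
  qed
  have qn: "norm (q p) = (m\<^sup>2 + p \<bullet> p) * (norm (proj m \<alpha> \<beta> 1 \<phi> p) + norm (proj m \<alpha> \<beta> (- 1) \<phi> p))" for p
  proof -
    have "(norm (axis 1 1 :: complex ^ 4))\<^sup>2 = 1"
      by (simp add: norm_vec_sq axis_def if_distrib[where f = "\<lambda>z. (norm z)\<^sup>2"] cong: if_cong)
    then have "norm (axis 1 1 :: complex ^ 4) = 1" by (simp add: abs_square_eq_1)
    then show ?thesis by (simp add: q_def)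
  qed
  have "L2_norm (\<lambda>x. G (evol m \<alpha> \<beta> (t + s) \<phi>) x - G (evol m \<alpha> \<beta> t \<phi>) x
      - s *\<^sub>R (\<i> *s G (\<lambda>p. dirac_symbol m \<alpha> \<beta> p *v evol m \<alpha> \<beta> t \<phi> p) x)) \<le> s\<^sup>2 * L2_norm q" for t s
  proof -
    let ?h = "\<lambda>p. dirac_symbol m \<alpha> \<beta> p *v evol m \<alpha> \<beta> t \<phi> p"
    have e: "CcK 6 (evol m \<alpha> \<beta> t \<phi>)" for t by (rule CcK_evol[OF \<phi>])
    have h: "CcK 6 ?h" by (rule CcK_dirac_symbol[OF e])
    have ih: "CcK 6 (\<lambda>p. (\<i> * complex_of_real s) *s ?h p)" by (intro CcK_smult Ck_const h)
    have diff: "CcK 6 (\<lambda>p. f p - g p)" if "CcK 6 f" "CcK 6 g" for f g :: spinor_field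
      using CcK_add[OF that(1) CcK_compose_bounded_linear[OF bounded_linear_minus[OF bounded_linear_ident] that(2)]]
      by simp
    let ?d = "\<lambda>p. evol m \<alpha> \<beta> (t + s) \<phi> p - evol m \<alpha> \<beta> t \<phi> p - (\<i> * complex_of_real s) *s ?h p"
    have d: "CcK 6 ?d" by (intro diff e ih)
    have "G ?d x = G (evol m \<alpha> \<beta> (t + s) \<phi>) x - G (evol m \<alpha> \<beta> t \<phi>) x - s *\<^sub>R (\<i> *s G ?h x)" for x
    proof -
      have "G ?d x = G (evol m \<alpha> \<beta> (t + s) \<phi>) x - G (evol m \<alpha> \<beta> t \<phi>) x - (\<i> * complex_of_real s) *s G ?h x"
        using G_diff[OF CcK_mono[OF diff[OF e e]] CcK_mono[OF ih]] G_diff[OF CcK_mono[OF e] CcK_mono[OF e]]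
        by (simp add: G_smult)
      also have "(\<i> * complex_of_real s) *s G ?h x = s *\<^sub>R (\<i> *s G ?h x)"
        by (simp add: vec_eq_iff scaleR_conv_of_real[where 'a = complex])
      finally show ?thesis .
    qed
    then have "L2_norm (\<lambda>x. G (evol m \<alpha> \<beta> (t + s) \<phi>) x - G (evol m \<alpha> \<beta> t \<phi>) x - s *\<^sub>R (\<i> *s G ?h x)) = L2_norm ?d"
      using L2_norm_G[OF d] by (simp add: fun_eq_iff[symmetric] L2_norm_def)
    also have "\<dots> \<le> L2_norm (\<lambda>p. s\<^sup>2 *\<^sub>R q p)"
    proof (rule L2_norm_mono[OF in_L2_CcK[OF d] in_L2_scaleR[OF in_L2_CcK[OF q]]])
      show "norm (?d p) \<le> norm (s\<^sup>2 *\<^sub>R q p)" for p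
        using evol_remainder[of t s \<phi> p] by (simp add: qn)
    qed
    finally show ?thesis by (simp add: L2_norm_scaleR)
  qed
  then show ?thesis by blast
qed

text \<open>Each component is a sum of two oscillatory integrals, at t for positive and at -t for
  negative energy. The cone condition is even in t, and the projected amplitudes do not depend on
  t.\<close>

lemma G_evol_decay:
  assumes \<phi>: "CcK N \<phi>"
  shows "\<exists>C. \<forall>t x. \<bar>t\<bar> \<le> norm x \<longrightarrow> norm (G (evol m \<alpha> \<beta> t \<phi>) x) * (1 + norm x) ^ N \<le> C"
proof -
  let ?P = "\<lambda>s i p. proj m \<alpha> \<beta> s \<phi> p $ i"
  have P: "CcK N (?P s i)" for s i by (rule CcK_vec_nth[OF CcK_proj[OF \<phi>]])
  have "\<forall>i. \<exists>C. \<forall>t x. \<bar>t\<bar> \<le> norm x \<longrightarrow> norm (osc m t (?P s i) x) * (1 + norm x) ^ N \<le> C" for s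
    using osc_decay[OF m P] by blast
  then obtain C where C: "\<And>s i t x. \<bar>t\<bar> \<le> norm x \<Longrightarrow> norm (osc m t (?P s i) x) * (1 + norm x) ^ N \<le> C s i"
    by metis
  let ?c = "(2 * pi) powr (- 3 / 2)"
  have comp: "G (evol m \<alpha> \<beta> t \<phi>) x $ i
     = complex_of_real ?c * (osc m t (?P 1 i) x + osc m (- t) (?P (- 1) i) x)" for t x i
  proof -
    have "exp (\<i> * complex_of_real (p \<bullet> x)) * evol m \<alpha> \<beta> t \<phi> p $ i
       = exp (\<i> * complex_of_real (p \<bullet> x + t * energy m p)) * ?P 1 i p
       + exp (\<i> * complex_of_real (p \<bullet> x + - t * energy m p)) * ?P (- 1) i p" for p
    proof -
      have "exp (\<i> * complex_of_real (a + b)) = exp (\<i> * complex_of_real a) * exp (\<i> * complex_of_real b)" for a b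
        by (simp add: exp_add[symmetric] distrib_left)
      then show ?thesis
        by (simp only: evol_def vector_add_component vector_smult_component distrib_left mult.assoc)
    qed
    then have "IF (\<lambda>p. evol m \<alpha> \<beta> t \<phi> p $ i) x = osc m t (?P 1 i) x + osc m (- t) (?P (- 1) i) x"
      unfolding IF_def osc_def
      by (simp only: Bochner_Integration.integral_add[OF osc_integrable[OF m P] osc_integrable[OF m P]])
    then show ?thesis unfolding G_nth by (simp only:)
  qed
  have "norm (G (evol m \<alpha> \<beta> t \<phi>) x) * (1 + norm x) ^ N \<le> (\<Sum>i\<in>UNIV. ?c * (C 1 i + C (- 1) i))"
    if tx: "\<bar>t\<bar> \<le> norm x" for t x
  proof -
    let ?r = "(1 + norm x) ^ N"
    have r: "?r \<ge> 0" by simp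
    have i: "norm (G (evol m \<alpha> \<beta> t \<phi>) x $ i) * ?r \<le> ?c * (C 1 i + C (- 1) i)" for i
    proof -
      have "norm (G (evol m \<alpha> \<beta> t \<phi>) x $ i) * ?r
         = ?c * (norm (osc m t (?P 1 i) x + osc m (- t) (?P (- 1) i) x) * ?r)"
        by (simp add: comp norm_mult)
      also have "\<dots> \<le> ?c * ((norm (osc m t (?P 1 i) x) + norm (osc m (- t) (?P (- 1) i) x)) * ?r)"
        by (intro mult_left_mono mult_right_mono norm_triangle_ineq r) simp
      also have "\<dots> = ?c * (norm (osc m t (?P 1 i) x) * ?r + norm (osc m (- t) (?P (- 1) i) x) * ?r)"
        by (simp only: distrib_right)
      also have "\<dots> \<le> ?c * (C 1 i + C (- 1) i)"
        using tx by (intro mult_left_mono add_mono C) auto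
      finally show ?thesis .
    qed
    have "norm (G (evol m \<alpha> \<beta> t \<phi>) x) \<le> (\<Sum>i\<in>UNIV. norm (G (evol m \<alpha> \<beta> t \<phi>) x $ i))"
      unfolding norm_vec_def by (rule L2_set_le_sum) simp
    from mult_right_mono[OF this r]
    have "norm (G (evol m \<alpha> \<beta> t \<phi>) x) * ?r \<le> (\<Sum>i\<in>UNIV. norm (G (evol m \<alpha> \<beta> t \<phi>) x $ i) * ?r)"
      by (simp only: sum_distrib_right)
    also have "\<dots> \<le> (\<Sum>i\<in>UNIV. ?c * (C 1 i + C (- 1) i))" by (intro sum_mono i)
    finally show ?thesis .
  qed
  then show ?thesis by blast
qed

text \<open>Outside the ball |x| > |t|, so n of the n + 6 powers turn into decay in t; the other 6
  provide square integrability in x.\<close>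

lemma G_evol_outside:
  assumes \<phi>: "CcK (n + 6) \<phi>"
  shows "\<exists>C. \<forall>t. L2_norm (\<lambda>x. indicator (- cball 0 \<bar>t\<bar>) x *\<^sub>R G (evol m \<alpha> \<beta> t \<phi>) x) \<le> C * inverse ((1 + \<bar>t\<bar>) ^ n)"
proof -
  obtain C where C: "\<And>t x. \<bar>t\<bar> \<le> norm x \<Longrightarrow> norm (G (evol m \<alpha> \<beta> t \<phi>) x) * (1 + norm x) ^ (n + 6) \<le> C"
    using G_evol_decay[OF \<phi>] by blast
  have C0: "C \<ge> 0" using C[of 0 0] by (rule order_trans[rotated]) auto
  define I where "I = (LINT x::real^3|lborel. inverse ((1 + norm x) ^ 6))"
  have intI: "integrable lborel (\<lambda>x::real^3. inverse ((1 + norm x) ^ 6))"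
    using integrable_inverse_norm_power[where 'a = "real^3"] by simp
  have "L2_norm (\<lambda>x. indicator (- cball 0 \<bar>t\<bar>) x *\<^sub>R G (evol m \<alpha> \<beta> t \<phi>) x) \<le> (C * sqrt I) * inverse ((1 + \<bar>t\<bar>) ^ n)" for t
  proof -
    let ?u = "\<lambda>x. indicator (- cball 0 \<bar>t\<bar>) x *\<^sub>R G (evol m \<alpha> \<beta> t \<phi>) x"
    let ?T = "inverse ((1 + \<bar>t\<bar>) ^ n)"
    have u: "in_L2 ?u"
      by (intro in_L2_indicator in_L2_G CcK_evol CcK_mono[OF \<phi>]) auto
    have bound: "(norm (?u x))\<^sup>2 \<le> (C * ?T)\<^sup>2 * inverse ((1 + norm x) ^ 6)" for x
    proof (cases "\<bar>t\<bar> < norm x")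
      case False
      then show ?thesis by (simp add: indicator_def)
    next
      case True
      let ?y = "1 + norm x"
      have y: "?y \<ge> 1" "?y > 0" by (auto simp: add_pos_nonneg)
      have "norm (?u x) * (?y ^ n * ?y ^ 6) \<le> C"
        using C[of t x] True by (simp add: power_add)
      then have "norm (?u x) \<le> C * inverse (?y ^ n) * inverse (?y ^ 6)"
        using y by (simp add: field_simps)
      also have "\<dots> \<le> C * ?T * inverse (?y ^ 6)"
        using True y C0 by (intro mult_right_mono mult_left_mono le_imp_inverse_le power_mono) auto
      finally have "(norm (?u x))\<^sup>2 \<le> (C * ?T * inverse (?y ^ 6))\<^sup>2" by (intro power_mono) auto
      also have "\<dots> = (C * ?T)\<^sup>2 * (inverse (?y ^ 6) * inverse (?y ^ 6))"
        by (simp only: power_mult_distrib power2_eq_square mult_ac)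
      \<comment> \<open>Squaring produced the inverse sixth power twice; one copy is estimated by 1,
        the other is integrable.\<close>
      also have "\<dots> \<le> (C * ?T)\<^sup>2 * (1 * inverse (?y ^ 6))"
      proof (intro mult_left_mono mult_right_mono)
        have "1 \<le> ?y ^ 6" using y(1) by (rule one_le_power)
        then show "inverse (?y ^ 6) \<le> 1" by (simp add: inverse_le_1_iff)
      qed (use y in auto)
      finally show ?thesis by simp
    qed
    have "(L2_norm ?u)\<^sup>2 = (LINT x|lborel. (norm (?u x))\<^sup>2)" by (rule L2_norm_sq)
    also have "\<dots> \<le> (LINT x::real^3|lborel. (C * ?T)\<^sup>2 * inverse ((1 + norm x) ^ 6))"
      by (rule integral_mono[OF in_L2_integrable[OF u] integrable_mult_right[OF intI] bound])
    also have "\<dots> = (C * ?T)\<^sup>2 * I" by (simp add: I_def)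
    finally have "sqrt ((L2_norm ?u)\<^sup>2) \<le> sqrt ((C * ?T)\<^sup>2 * I)" by (rule real_sqrt_le_mono)
    then show ?thesis using L2_norm_nonneg[of ?u] C0 by (simp add: real_sqrt_mult mult_ac)
  qed
  then show ?thesis by blast
qed

end

section \<open>The abstract unitary group and the explicit evolution\<close>

lemma unitary_group_in_L2: "unitary_group U \<Longrightarrow> in_L2 f \<Longrightarrow> in_L2 (U t f)"
  by (simp add: unitary_group_def)

lemma unitary_group_0: "unitary_group U \<Longrightarrow> in_L2 f \<Longrightarrow> AE x in lborel. U 0 f x = f x"
  by (simp add: unitary_group_def)

lemma unitary_group_add:
  "unitary_group U \<Longrightarrow> in_L2 f \<Longrightarrow> AE x in lborel. U (s + t) f x = U s (U t f) x"
  by (simp add: unitary_group_def)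

lemma unitary_group_diff:
  assumes U: "unitary_group U" and f: "in_L2 f" and g: "in_L2 g"
  shows "L2_norm (\<lambda>x. U t f x - U t g x) = L2_norm (\<lambda>x. f x - g x)"
proof -
  note in_U = unitary_group_in_L2[OF U]
  have "AE x in lborel. U t (\<lambda>y. 1 *s f y + (- 1) *s g y) x = 1 *s U t f x + (- 1) *s U t g x"
    using U f g unfolding unitary_group_def by blast
  then have ae: "AE x in lborel. U t (\<lambda>y. f y - g y) x = U t f x - U t g x" by simp
  have "L2_norm (\<lambda>x. U t f x - U t g x) = L2_norm (U t (\<lambda>y. f y - g y))"
    using L2_norm_cong_AE[OF in_U[OF in_L2_diff[OF f g]] in_L2_diff[OF in_U[OF f] in_U[OF g]] ae] by simp
  also have "\<dots> = L2_norm (\<lambda>x. f x - g x)"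
    using U in_L2_diff[OF f g] by (simp add: unitary_group_def)
  finally show ?thesis .
qed

text \<open>
  Both sides agree at time 0, and the generator property makes their $L^2$ distance
  a function of time with derivative 0.
\<close>

lemma unitary_group_eq_G_evol:
  assumes m: "m > 0" and dirac: "dirac_matrices \<alpha> \<beta>" and exp: "is_exp_i (dirac_op m \<alpha> \<beta>) U"
    and \<phi>: "CcK 6 \<phi>"
  shows "L2_norm (\<lambda>x. U t (G \<phi>) x - G (evol m \<alpha> \<beta> t \<phi>) x) = 0"
proof -
  have U: "unitary_group U" using exp by (simp add: is_exp_i_def)
  note in_U = unitary_group_in_L2[OF U]
  define X where "X t = G (evol m \<alpha> \<beta> t \<phi>)" for t
  define Y where "Y t = G (\<lambda>p. dirac_symbol m \<alpha> \<beta> p *v evol m \<alpha> \<beta> t \<phi> p)" for t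
  have e: "CcK 6 (evol m \<alpha> \<beta> t \<phi>)" for t by (rule CcK_evol[OF m dirac \<phi>])
  have h: "CcK 6 (\<lambda>p. dirac_symbol m \<alpha> \<beta> p *v evol m \<alpha> \<beta> t \<phi> p)" for t by (rule CcK_dirac_symbol[OF e])
  have X: "in_L2 (X t)" for t unfolding X_def by (rule in_L2_G[OF e])
  have Y: "in_L2 (Y t)" for t unfolding Y_def by (rule in_L2_G[OF h])
  have X0: "X 0 = G \<phi>" by (simp add: X_def evol_0)
  obtain K where K: "\<And>t s. L2_norm (\<lambda>x. X (t + s) x - X t x - s *\<^sub>R (\<i> *s Y t x)) \<le> s\<^sup>2 * K"
    using G_evol_remainder[OF m dirac \<phi>] unfolding X_def Y_def by blast
  define d where "d t = L2_norm (\<lambda>x. U t (X 0) x - X t x)" for t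
  have "(d has_field_derivative 0) (at t)" for t
  proof -
    \<comment> \<open>Every \<open>X t\<close> lies in the domain, so the group started at
      \<open>X t\<close> has the same initial derivative as the explicit evolution at time
      t.\<close>
    have "dirac_op m \<alpha> \<beta> (X t) (Y t)"
      unfolding dirac_op_def X_def Y_def using has_fourier_G[OF e] has_fourier_G[OF h] by blast
    then have "L2_tendsto (\<lambda>s x. (1 / s) *\<^sub>R (U s (X t) x - X t x)) (\<lambda>x. \<i> *s Y t x) (at 0)"
      using exp X Y unfolding is_exp_i_def by blast
    then have r0: "((\<lambda>s. L2_norm (\<lambda>x. (1 / s) *\<^sub>R (U s (X t) x - X t x) - \<i> *s Y t x)) \<longlongrightarrow> 0) (at 0)"
      by (simp add: L2_tendsto_def)
    define r where "r s = L2_norm (\<lambda>x. (1 / s) *\<^sub>R (U s (X t) x - X t x) - \<i> *s Y t x)" for s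
    \<comment> \<open>Both motions leave \<open>X t\<close> with the same linear part, so their
      distance after time s is o(s): \<open>r s\<close> tends to 0 by the generator property, the
      other remainder is quadratic.\<close>
    have step: "L2_norm (\<lambda>x. U s (X t) x - X (t + s) x) \<le> \<bar>s\<bar> * r s + s\<^sup>2 * K" if s: "s \<noteq> 0" for s
    proof -
      let ?a = "\<lambda>x. (1 / s) *\<^sub>R (U s (X t) x - X t x) - \<i> *s Y t x"
      let ?b = "\<lambda>x. X (t + s) x - X t x - s *\<^sub>R (\<i> *s Y t x)"
      have a: "in_L2 ?a" by (intro in_L2_diff in_L2_scaleR in_L2_smult in_U X Y)
      have b: "in_L2 ?b" by (intro in_L2_diff in_L2_scaleR in_L2_smult X Y)
      have "U s (X t) x - X (t + s) x = s *\<^sub>R ?a x + (- 1) *\<^sub>R ?b x" for x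
        using s by (simp add: scaleR_diff_right)
      then have "L2_norm (\<lambda>x. U s (X t) x - X (t + s) x) = L2_norm (\<lambda>x. s *\<^sub>R ?a x + (- 1) *\<^sub>R ?b x)"
        by (simp only:)
      also have "\<dots> \<le> L2_norm (\<lambda>x. s *\<^sub>R ?a x) + L2_norm (\<lambda>x. (- 1) *\<^sub>R ?b x)"
        by (rule L2_norm_triangle[OF in_L2_scaleR[OF a] in_L2_scaleR[OF b]])
      also have "\<dots> = \<bar>s\<bar> * r s + L2_norm ?b"
        unfolding L2_norm_scaleR r_def by simp
      finally show ?thesis using K[of t s] by linarith
    qed
    \<comment> \<open>Applying the isometry \<open>U s\<close> rewrites \<open>d t\<close> with the
      same first vector as \<open>d (t + s)\<close>; the triangle inequality then leaves only the
      distance of the second vectors.\<close>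
    have dd: "\<bar>d (t + s) - d t\<bar> \<le> L2_norm (\<lambda>x. U s (X t) x - X (t + s) x)" for s
    proof -
      have UU: "in_L2 (U s (U t (X 0)))" "in_L2 (U s (X t))" "in_L2 (U (t + s) (X 0))"
        by (intro in_U X)+
      have "AE x in lborel. U (s + t) (X 0) x = U s (U t (X 0)) x"
        by (rule unitary_group_add[OF U X])
      then have ae: "AE x in lborel. U (t + s) (X 0) x - X (t + s) x = U s (U t (X 0)) x - X (t + s) x"
        by (simp add: add.commute)
      have ds: "d (t + s) = L2_norm (\<lambda>x. U s (U t (X 0)) x - X (t + s) x)"
        unfolding d_def by (rule L2_norm_cong_AE[OF in_L2_diff[OF UU(3) X] in_L2_diff[OF UU(1) X] ae])
      have dt: "d t = L2_norm (\<lambda>x. U s (U t (X 0)) x - U s (X t) x)"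
        unfolding d_def by (rule unitary_group_diff[OF U in_U[OF X] X, symmetric])
      have "d (t + s) \<le> d t + L2_norm (\<lambda>x. U s (X t) x - X (t + s) x)"
        unfolding ds dt by (rule L2_norm_triangle_diff[OF UU(1,2) X])
      moreover have "d t \<le> d (t + s) + L2_norm (\<lambda>x. X (t + s) x - U s (X t) x)"
        unfolding ds dt by (rule L2_norm_triangle_diff[OF UU(1) X UU(2)])
      ultimately show ?thesis using L2_norm_minus_commute[of "X (t + s)" "U s (X t)"] by linarith
    qed
    have "((\<lambda>s. (d (t + s) - d t) / s) \<longlongrightarrow> 0) (at 0)"
    proof (rule Lim_null_comparison)
      show "((\<lambda>s. r s + \<bar>s\<bar> * K) \<longlongrightarrow> 0) (at 0)"
        using r0 unfolding r_def[symmetric]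
        by (intro tendsto_eq_intros) (auto intro: tendsto_ident_at)
      have "norm ((d (t + s) - d t) / s) \<le> r s + \<bar>s\<bar> * K" if s: "s \<noteq> 0" for s
      proof -
        have "\<bar>d (t + s) - d t\<bar> \<le> \<bar>s\<bar> * r s + s\<^sup>2 * K" using order_trans[OF dd step[OF s]] .
        also have "\<dots> = (r s + \<bar>s\<bar> * K) * \<bar>s\<bar>" by (simp add: algebra_simps power2_eq_square)
        finally show ?thesis using s by (simp add: divide_le_eq)
      qed
      then show "\<forall>\<^sub>F s in at 0. norm ((d (t + s) - d t) / s) \<le> r s + \<bar>s\<bar> * K"
        by (simp add: eventually_at_filter)
    qed
    then show ?thesis by (simp add: DERIV_def)
  qed
  then have "d t = d 0" by (intro DERIV_isconst_all) simp
  also have "d 0 = 0"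
  proof -
    have "AE x in lborel. U 0 (X 0) x = X 0 x" by (rule unitary_group_0[OF U X])
    then have "AE x in lborel. U 0 (X 0) x - X 0 x = 0" by simp
    from L2_norm_cong_AE[OF in_L2_diff[OF in_U[OF X] X] _ this] show ?thesis
      by (simp add: d_def in_L2_def L2_norm_def)
  qed
  finally show ?thesis unfolding d_def X0 unfolding X_def .
qed

section \<open>Decay outside the light cone\<close>

lemma L2_norm_outside_le:
  assumes f: "in_L2 f" and g: "in_L2 g"
  shows "L2_norm (\<lambda>x. indicator (- cball 0 r) x *\<^sub>R f x)
     \<le> L2_norm (\<lambda>x. f x - g x) + L2_norm (\<lambda>x. indicator (- cball 0 r) x *\<^sub>R g x)"
proof -
  let ?i = "indicator (- cball (0::real^3) r) :: real^3 \<Rightarrow> real"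
  have d: "in_L2 (\<lambda>x. f x - g x)" by (rule in_L2_diff[OF f g])
  have id: "in_L2 (\<lambda>x. ?i x *\<^sub>R (f x - g x))" by (rule in_L2_indicator[OF d]) auto
  have ig: "in_L2 (\<lambda>x. ?i x *\<^sub>R g x)" by (rule in_L2_indicator[OF g]) auto
  have "L2_norm (\<lambda>x. ?i x *\<^sub>R f x) = L2_norm (\<lambda>x. ?i x *\<^sub>R (f x - g x) + ?i x *\<^sub>R g x)"
    by (simp add: scaleR_diff_right)
  also have "\<dots> \<le> L2_norm (\<lambda>x. ?i x *\<^sub>R (f x - g x)) + L2_norm (\<lambda>x. ?i x *\<^sub>R g x)"
    by (rule L2_norm_triangle[OF id ig])
  also have "L2_norm (\<lambda>x. ?i x *\<^sub>R (f x - g x)) \<le> L2_norm (\<lambda>x. f x - g x)"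
    by (rule L2_norm_mono[OF id d]) (simp add: indicator_def)
  finally show ?thesis by simp
qed

text \<open>One estimate for both claims: in general density makes the first term small and large
  |t| the second; for \<open>\<psi>\<close> = \<open>G \<phi>\<close> almost everywhere the first
  term is zero. Isometry keeps the approximation error constant in time.\<close>

lemma outside_cone_estimate:
  assumes m: "m > 0" and dirac: "dirac_matrices \<alpha> \<beta>" and exp: "is_exp_i (dirac_op m \<alpha> \<beta>) U"
    and \<psi>: "in_L2 \<psi>" and \<phi>: "CcK (n + 6) \<phi>"
  shows "\<exists>C. \<forall>t. L2_norm (\<lambda>x. indicator (- cball 0 \<bar>t\<bar>) x *\<^sub>R U t \<psi> x)
     \<le> L2_norm (\<lambda>x. \<psi> x - G \<phi> x) + C * inverse ((1 + \<bar>t\<bar>) ^ n)"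
proof -
  have \<phi>6: "CcK 6 \<phi>" by (rule CcK_mono[OF \<phi>]) simp
  have U: "unitary_group U" using exp by (simp add: is_exp_i_def)
  note in_U = unitary_group_in_L2[OF U]
  have G: "in_L2 (G \<phi>)" by (rule in_L2_G[OF \<phi>6])
  have Ge: "in_L2 (G (evol m \<alpha> \<beta> t \<phi>))" for t by (rule in_L2_G[OF CcK_evol[OF m dirac \<phi>6]])
  obtain C where C: "\<And>t. L2_norm (\<lambda>x. indicator (- cball 0 \<bar>t\<bar>) x *\<^sub>R G (evol m \<alpha> \<beta> t \<phi>) x) \<le> C * inverse ((1 + \<bar>t\<bar>) ^ n)"
    using G_evol_outside[OF m dirac \<phi>] by blast
  have "L2_norm (\<lambda>x. indicator (- cball 0 \<bar>t\<bar>) x *\<^sub>R U t \<psi> x)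
     \<le> L2_norm (\<lambda>x. \<psi> x - G \<phi> x) + C * inverse ((1 + \<bar>t\<bar>) ^ n)" for t
  proof -
    have "L2_norm (\<lambda>x. U t \<psi> x - G (evol m \<alpha> \<beta> t \<phi>) x)
       \<le> L2_norm (\<lambda>x. U t \<psi> x - U t (G \<phi>) x) + L2_norm (\<lambda>x. U t (G \<phi>) x - G (evol m \<alpha> \<beta> t \<phi>) x)"
      by (rule L2_norm_triangle_diff[OF in_U[OF \<psi>] in_U[OF G] Ge])
    also have "\<dots> = L2_norm (\<lambda>x. \<psi> x - G \<phi> x)"
      by (simp only: unitary_group_eq_G_evol[OF m dirac exp \<phi>6] unitary_group_diff[OF U \<psi> G] add_0_right)
    finally show ?thesis
      using L2_norm_outside_le[OF in_U[OF \<psi>] Ge, of "\<bar>t\<bar>" t t] C[of t] by linarith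
  qed
  then show ?thesis by blast
qed

theorem mainTheorem5:
  fixes m :: real
    and \<alpha> :: "3 \<Rightarrow> complex ^ 4 ^ 4" and \<beta> :: "complex ^ 4 ^ 4"
    and U :: "real \<Rightarrow> spinor_field \<Rightarrow> spinor_field"
    and \<psi> :: spinor_field
  assumes "m > 0"
    and "dirac_matrices \<alpha> \<beta>"
    and "is_exp_i (dirac_op m \<alpha> \<beta>) U"
    and "in_L2 \<psi>"
  shows "L2_tendsto (\<lambda>t x. indicator (- cball 0 \<bar>t\<bar>) x *\<^sub>R U t \<psi> x) (\<lambda>x. 0) at_infinity \<and>
         ((\<exists>\<phi>. has_fourier \<psi> \<phi> \<and> Cc_infinity \<phi>) \<longrightarrow>
           (\<forall>N::real. N > 0 \<longrightarrow> (\<exists>C::real. \<forall>t::real.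
             L2_norm (\<lambda>x. indicator (- cball 0 \<bar>t\<bar>) x *\<^sub>R U t \<psi> x) \<le> C * (1 + \<bar>t\<bar>) powr (- N))))"
proof (intro conjI impI allI)
  note outside = outside_cone_estimate[OF assms]
  let ?u = "\<lambda>t x. indicator (- cball 0 \<bar>t\<bar>) x *\<^sub>R U t \<psi> x"
  have U: "unitary_group U" using assms(3) by (simp add: is_exp_i_def)
  have u: "in_L2 (?u t)" for t
    by (rule in_L2_indicator[OF unitary_group_in_L2[OF U assms(4)]]) simp
  have "((\<lambda>t. L2_norm (?u t)) \<longlongrightarrow> 0) at_infinity"
  proof (rule tendstoI)
    fix e :: real assume e: "e > 0"
    \<comment> \<open>Since 12 = 6 + 6, \<open>outside\<close> applies with n = 6; only one power of
      the resulting decay is used below.\<close>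
    obtain \<phi> where \<phi>: "CcK 12 \<phi>" "L2_norm (\<lambda>x. \<psi> x - G \<phi> x) < e / 2"
      using G_dense[OF assms(4), of "e / 2"] e by auto
    obtain C where C: "\<And>t. L2_norm (?u t) \<le> L2_norm (\<lambda>x. \<psi> x - G \<phi> x) + C * inverse ((1 + \<bar>t\<bar>) ^ 6)"
      using outside[of 6 \<phi>] \<phi>(1) by auto
    \<comment> \<open>Beyond this threshold |C| / (1 + |t|) is below e / 2; the absolute value
      allows for a negative C.\<close>
    have small: "L2_norm (?u t) < e" if t: "2 * \<bar>C\<bar> / e \<le> \<bar>t\<bar>" for t
    proof -
      have "C * inverse ((1 + \<bar>t\<bar>) ^ 6) \<le> \<bar>C\<bar> * inverse (1 + \<bar>t\<bar>)"
      proof (rule mult_mono)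
        have "(1 + \<bar>t\<bar>) ^ 1 \<le> (1 + \<bar>t\<bar>) ^ 6" by (rule power_increasing) auto
        then show "inverse ((1 + \<bar>t\<bar>) ^ 6) \<le> inverse (1 + \<bar>t\<bar>)" by (intro le_imp_inverse_le) auto
      qed auto
      also have "\<bar>C\<bar> * inverse (1 + \<bar>t\<bar>) < e / 2"
      proof -
        have "2 * \<bar>C\<bar> \<le> \<bar>t\<bar> * e" using t e by (simp add: divide_le_eq)
        then have "\<bar>C\<bar> < e / 2 * (1 + \<bar>t\<bar>)" using e by (simp add: algebra_simps)
        moreover have "1 + \<bar>t\<bar> > 0" by (simp add: add_pos_nonneg)
        ultimately show ?thesis by (simp add: divide_inverse[symmetric] pos_divide_less_eq)
      qed
      finally show ?thesis using C[of t] \<phi>(2) by linarith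
    qed
    show "\<forall>\<^sub>F t in at_infinity. dist (L2_norm (?u t)) 0 < e"
      unfolding eventually_at_infinity
      using small L2_norm_nonneg by (intro exI[of _ "2 * \<bar>C\<bar> / e"]) simp
  qed
  with u show "L2_tendsto ?u (\<lambda>x. 0) at_infinity"
    by (simp add: L2_tendsto_def in_L2_def)
next
  note outside = outside_cone_estimate[OF assms]
  let ?u = "\<lambda>t x. indicator (- cball 0 \<bar>t\<bar>) x *\<^sub>R U t \<psi> x"
  fix N :: real
  assume "\<exists>\<phi>. has_fourier \<psi> \<phi> \<and> Cc_infinity \<phi>" and "N > 0"
  then obtain \<phi> where \<phi>: "has_fourier \<psi> \<phi>" "Cc_infinity \<phi>" by blast
  have Cc: "CcK k \<phi>" for k
  proof -
    have "bounded (closure {x. \<phi> x \<noteq> 0})" using \<phi>(2) by (auto simp: Cc_infinity_def compact_imp_bounded)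
    then obtain R where R: "\<And>x. x \<in> closure {x. \<phi> x \<noteq> 0} \<Longrightarrow> norm x \<le> R"
      unfolding bounded_iff by blast
    have "\<phi> x = 0" if "R < norm x" for x
    proof (rule ccontr)
      assume "\<phi> x \<noteq> 0"
      then have "x \<in> closure {x. \<phi> x \<noteq> 0}" by (intro subsetD[OF closure_subset]) simp
      from R[OF this] that show False by simp
    qed
    then show ?thesis using \<phi>(2) unfolding CcK_def Cc_infinity_def by blast
  qed
  \<comment> \<open>In this case \<open>\<psi>\<close> is itself the transform of a test function,
    so no approximation error remains.\<close>
  have "AE x in lborel. \<psi> x = G \<phi> x" by (rule has_fourier_eq_G[OF \<phi>(1) Cc])
  then have "AE x in lborel. \<psi> x - G \<phi> x = 0" by simp
  from L2_norm_cong_AE[OF in_L2_diff[OF assms(4) in_L2_G[OF Cc]] _ this]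
  have 0: "L2_norm (\<lambda>x. \<psi> x - G \<phi> x) = 0" by (simp add: in_L2_def L2_norm_def)
  obtain n :: nat where n: "N \<le> real n" using real_arch_simple by blast
  obtain C where C: "\<And>t. L2_norm (?u t) \<le> C * inverse ((1 + \<bar>t\<bar>) ^ n)"
    using outside[OF Cc, of n] 0 by auto
  have "L2_norm (?u t) \<le> C * (1 + \<bar>t\<bar>) powr (- N)" for t
  proof -
    \<comment> \<open>Evaluation at t = 0 gives C \<ge> 0, which the passage from the integer
      exponent n to the real exponent N requires.\<close>
    have "L2_norm (?u 0) \<le> C" using C[of 0] by simp
    then have C0: "C \<ge> 0" using L2_norm_nonneg[of "?u 0"] by linarith
    have "inverse ((1 + \<bar>t\<bar>) ^ n) = (1 + \<bar>t\<bar>) powr (- real n)"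
      by (simp add: powr_minus powr_realpow add_pos_nonneg)
    also have "\<dots> \<le> (1 + \<bar>t\<bar>) powr (- N)" using n by (intro powr_mono) auto
    finally show ?thesis by (rule order_trans[OF C mult_left_mono[OF _ C0]])
  qed
  then show "\<exists>C. \<forall>t. L2_norm (?u t) \<le> C * (1 + \<bar>t\<bar>) powr (- N)" by blast
qed

end
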